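(* For every recursive function $f:\mathbb N\to\mathbb N$ there exists a pair of finitely presented groups $H\le G$ such that $f\preceq d_H$, where $d_H$ is the Dehn function of $H$, while the Dehn function of $G$ is quadratic.
   Context: For a finite presentation $\langle X\mid R\rangle$ of a group $P$, the area of a word $w$ over $X^{\pm1}$ with $w=1$ in $P$ is the minimal number $m$ such that $w$ is freely equal in the free group on $X$ to a product of $m$ conjugates of relators from $R^{\pm 1}$. The Dehn function is the smallest function $d(n)$ such that every word of length at most $n$ equal to $1$ in $P$ has area at most $d(n)$. For functions $f,g$, $f\preceq g$ means there is a constant $c>0$ with $f(n)\le c\,g(cn)+cn$ for all $n\ge1$; $f,g$ are equivalent if $f\preceq g$ and $g\preceq f$ (the Dehn function of a finitely presented group is defined up to this equivalence). Quadratic means equivalent to $n^2$. *)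

theory Defs
  imports Main
begin

datatype recf = Z | S | Id nat | Cn recf "recf list" | Pr recf recf | Mn recf

inductive eval :: "recf \<Rightarrow> nat list \<Rightarrow> nat \<Rightarrow> bool"
  and eval_list :: "recf list \<Rightarrow> nat list \<Rightarrow> nat list \<Rightarrow> bool" where
  eval_Z: "eval Z xs 0"
| eval_S: "eval S (x # xs) (Suc x)"
| eval_Id: "i < length xs \<Longrightarrow> eval (Id i) xs (xs ! i)"
| eval_Cn: "eval_list gs xs ys \<Longrightarrow> eval f ys z \<Longrightarrow> eval (Cn f gs) xs z"
| eval_Pr0: "eval f xs y \<Longrightarrow> eval (Pr f g) (0 # xs) y"
| eval_PrS: "eval (Pr f g) (n # xs) y \<Longrightarrow> eval g (y # n # xs) z \<Longrightarrow> eval (Pr f g) (Suc n # xs) z"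
| eval_Mn: "eval f (n # xs) 0 \<Longrightarrow> (\<forall>m<n. \<exists>y. eval f (m # xs) y \<and> y \<noteq> 0) \<Longrightarrow> eval (Mn f) xs n"
| evl_Nil: "eval_list [] xs []"
| evl_Cons: "eval g xs y \<Longrightarrow> eval_list gs xs ys \<Longrightarrow> eval_list (g # gs) xs (y # ys)"

definition recursive :: "(nat \<Rightarrow> nat) \<Rightarrow> bool" where
  "recursive f \<longleftrightarrow> (\<exists>p. \<forall>n. eval p [n] (f n))"

text \<open>A letter (a, True) is the generator x_a, (a, False) is its inverse.\<close>
type_synonym word = "(nat \<times> bool) list"

definition word_over :: "nat \<Rightarrow> word \<Rightarrow> bool" where
  "word_over k w \<longleftrightarrow> (\<forall>x\<in>set w. fst x < k)"

definition winv :: "word \<Rightarrow> word" where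
  "winv w = rev (map (\<lambda>(a, b). (a, \<not> b)) w)"

fun red :: "word \<Rightarrow> word" where
  "red [] = []"
| "red (x # xs) = (case red xs of [] \<Rightarrow> [x]
      | y # ys \<Rightarrow> (if fst y = fst x \<and> snd y \<noteq> snd x then ys else x # y # ys))"

definition freely_equal :: "word \<Rightarrow> word \<Rightarrow> bool" where
  "freely_equal u v \<longleftrightarrow> red u = red v"

text \<open>A finite presentation: number k of generators x_0..x_(k-1) and a finite list of relators.\<close>
type_synonym pres = "nat \<times> word list"

definition fin_pres :: "pres \<Rightarrow> bool" where
  "fin_pres P \<longleftrightarrow> (\<forall>r\<in>set (snd P). word_over (fst P) r)"

definition conj_rel :: "pres \<Rightarrow> word \<Rightarrow> bool" where
  "conj_rel P c \<longleftrightarrow> (\<exists>u r. word_over (fst P) u \<and> (r \<in> set (snd P) \<or> winv r \<in> set (snd P))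
                         \<and> c = u @ r @ winv u)"

definition prod_conj :: "pres \<Rightarrow> word \<Rightarrow> nat \<Rightarrow> bool" where
  "prod_conj P w m \<longleftrightarrow> (\<exists>cs. length cs = m \<and> (\<forall>c\<in>set cs. conj_rel P c) \<and> freely_equal w (concat cs))"

definition trivial :: "pres \<Rightarrow> word \<Rightarrow> bool" where
  "trivial P w \<longleftrightarrow> (\<exists>m. prod_conj P w m)"

definition area :: "pres \<Rightarrow> word \<Rightarrow> nat" where
  "area P w = (LEAST m. prod_conj P w m)"

definition dehn :: "pres \<Rightarrow> nat \<Rightarrow> nat" where
  "dehn P n = Max {area P w | w. word_over (fst P) w \<and> length w \<le> n \<and> trivial P w}"

definition preceq :: "(nat \<Rightarrow> nat) \<Rightarrow> (nat \<Rightarrow> nat) \<Rightarrow> bool" (infix "\<preceq>" 50) where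
  "f \<preceq> g \<longleftrightarrow> (\<exists>c::nat. c > 0 \<and> (\<forall>n\<ge>1. f n \<le> c * g (c * n) + c * n))"

definition fequiv :: "(nat \<Rightarrow> nat) \<Rightarrow> (nat \<Rightarrow> nat) \<Rightarrow> bool" (infix "\<simeq>" 50) where
  "f \<simeq> g \<longleftrightarrow> f \<preceq> g \<and> g \<preceq> f"

definition subst :: "(nat \<Rightarrow> word) \<Rightarrow> word \<Rightarrow> word" where
  "subst \<phi> w = concat (map (\<lambda>(a, b). if b then \<phi> a else winv (\<phi> a)) w)"

text \<open>The generator assignment phi induces an injective homomorphism from the group
  presented by PH into the group presented by PG, i.e. the group of PH is (isomorphic to)
  a subgroup of the group of PG.\<close>
definition subgroup_emb :: "pres \<Rightarrow> pres \<Rightarrow> (nat \<Rightarrow> word) \<Rightarrow> bool" where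
  "subgroup_emb PH PG \<phi> \<longleftrightarrow>
     (\<forall>a < fst PH. word_over (fst PG) (\<phi> a)) \<and>
     (\<forall>w. word_over (fst PH) w \<longrightarrow> (trivial PH w \<longleftrightarrow> trivial PG (subst \<phi> w)))"

end

theory Submission
  imports Defs "HOL-Computational_Algebra.Primes" "HOL-Library.Infinite_Set"
begin

text \<open>
  Let F be a finitely generated free group and let b(i), c(i) be finitely many pairs of elements of F.
  Write y ~ z if y and z are connected by moves z -> b(i) z c(i)^-1. The group H has generators T(i),
  generators of F, K and J, and relators [T(i), F], [K, T(i) c(i)], [J, T(i) b(i)] and [r K r^-1, J] for r in a
  finite set Rs. Conjugation by T(i) shows that [z K z^-1, J] = 1 as soon as z ~ r for some r in Rs, and the area
  of this commutator is at least the number of moves needed to go from z to Rs. If every z is connected to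
  Rs, then H embeds into Free(T) x E x E, where E is the double of F x F along the diagonal; the Dehn function of E is
  quadratic, because removing a pinch K^e v K^-e costs at most |v| times the length that is saved, by the four point
  condition in the Cayley tree of F.

  It remains to find moves that connect everything to Rs, but only slowly. A queue automaton, whose letters permute its m states,
  is coded by moves on the elements k^q w (q a state, w the queue). A Collatz-like map
  (l, M k + r) -> (l', a k + b) is realised by such an automaton, which erases every queue (inverse letters included)
  if the map has no infinite orbit on pairs of a label and an integer. Coding registers as exponents of
  primes, such maps simulate counter machines. The machine evaluates a recursive function with searches cut off after t
  rounds, for increasing t, until there is no cut-off; thus it halts from every configuration, and it counts the result up
  in a register. For the input j it starts with N = 2^j, hence for f the machine for the
  sum of f(m) over m < 2^(j+1) is used.
\<close>

text \<open>In \<open>G\<close> the letters K and J lie in different direct factors, so every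
  commutator [z K z^-1, J] with z in F is trivial there. The subgroup therefore has to satisfy
  infinitely many relations, and conjugation by the T(i) derives them from the finitely many with z
  in Rs as soon as every z is connected to Rs. This is the obstacle that shapes the proof. Elements
  of F are not only sensible configurations: they include queues with inverse letters, with missing
  or surplus markers, and words in which k stands anywhere, and all of these have to be driven to
  Rs. Hence the machine must halt from each label with arbitrary registers, integers may be negative
  or zero, and the outer loop of the machine must recover from any contents of its registers. The
  lower bound meets a second obstacle: moves can be undone, so a detour might beat the run of the
  automaton. If the graph of moves is the graph of a function, the running time changes by at most
  one along a move, and no detour helps. An inverse letter is read by undoing a transition, which is
  why letters have to permute the states.\<close>

type_synonym 'a wrd = "('a \<times> bool) list"

text \<open>Polymorphic counterpart of \<open>winv\<close>, as \<open>gred\<close> is of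
  \<open>red\<close>. Generators are taken from arbitrary types, infinite ones included, and are
  numbered only when Dehn functions come in.\<close>

definition wi :: "'a wrd \<Rightarrow> 'a wrd" where
  "wi w = rev (map (\<lambda>(a, b). (a, \<not> b)) w)"

fun rcons :: "'a \<times> bool \<Rightarrow> 'a wrd \<Rightarrow> 'a wrd" where
  "rcons x [] = [x]"
| "rcons x (y # ys) = (if fst y = fst x \<and> snd y \<noteq> snd x then ys else x # y # ys)"

definition gred :: "'a wrd \<Rightarrow> 'a wrd" where
  "gred w = foldr rcons w []"

definition reduced :: "'a wrd \<Rightarrow> bool" where
  "reduced w \<longleftrightarrow> successively (\<lambda>x y. \<not> (fst y = fst x \<and> snd y \<noteq> snd x)) w"

lemma wi_Nil [simp]: "wi [] = []" and wi_append [simp]: "wi (u @ v) = wi v @ wi u"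
  and wi_Cons: "wi (x # w) = wi w @ [(fst x, \<not> snd x)]"
  by (auto simp: wi_def split: prod.splits)

lemma wi_single [simp]: "wi [x] = [(fst x, \<not> snd x)]"
  by (simp add: wi_Cons)

lemma wi_wi [simp]: "wi (wi w) = w"
  by (induction w) (auto simp: wi_Cons)

lemma length_wi [simp]: "length (wi w) = length w"
  by (simp add: wi_def)

lemma gred_Nil [simp]: "gred [] = []" and gred_Cons: "gred (x # w) = rcons x (gred w)"
  by (simp_all add: gred_def)

lemma reduced_Nil [simp]: "reduced []" and reduced_single [simp]: "reduced [x]"
  and reduced_Cons2: "reduced (x # y # w) \<longleftrightarrow> \<not> (fst y = fst x \<and> snd y \<noteq> snd x) \<and> reduced (y # w)"
  by (auto simp: reduced_def)

lemma reduced_tl: "reduced (x # w) \<Longrightarrow> reduced w"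
  by (cases w) (auto simp: reduced_Cons2)

lemma reduced_rcons: "reduced w \<Longrightarrow> reduced (rcons x w)"
  by (cases w) (auto simp: reduced_Cons2 dest: reduced_tl)

lemma reduced_foldr: "reduced s \<Longrightarrow> reduced (foldr rcons w s)"
  by (induction w) (auto intro: reduced_rcons)

lemma reduced_gred [simp]: "reduced (gred w)"
  by (simp add: gred_def reduced_foldr)

lemma rcons_reduced: "reduced (x # w) \<Longrightarrow> rcons x w = x # w"
  by (cases w) (auto simp: reduced_Cons2)

lemma gred_reduced: "reduced w \<Longrightarrow> gred w = w"
proof (induction w)
  case (Cons x w)
  then have "gred w = w" using reduced_tl by blast
  then show ?case using Cons by (simp add: gred_Cons rcons_reduced)
qed simp

lemma gred_gred [simp]: "gred (gred w) = gred w"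
  by (simp add: gred_reduced)

lemma rcons_cancel: "reduced w \<Longrightarrow> rcons x (rcons (fst x, \<not> snd x) w) = w"
proof (cases w)
  case (Cons y ys)
  assume "reduced w"
  then show ?thesis using Cons
    by (cases ys) (auto simp: reduced_Cons2 prod_eq_iff)
qed simp

lemma rcons_cancel': "reduced w \<Longrightarrow> rcons (fst x, \<not> snd x) (rcons x w) = w"
  using rcons_cancel[of w "(fst x, \<not> snd x)"] by simp

text \<open>Letters act on the reduced words by \<open>rcons\<close>, and opposite letters act as
  inverse maps. A word and its reduction thus act alike, which yields associativity of the group
  operation without a confluence argument (van der Waerden's trick).\<close>

lemma foldr_rcons_rcons: "reduced s \<Longrightarrow> foldr rcons (rcons x w) s = rcons x (foldr rcons w s)"
proof (cases w)
  case (Cons y ys)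
  assume s: "reduced s"
  show ?thesis
  proof (cases "fst y = fst x \<and> snd y \<noteq> snd x")
    case True
    then have "y = (fst x, \<not> snd x)" by (auto simp: prod_eq_iff)
    then show ?thesis using Cons True rcons_cancel[of "foldr rcons ys s" x] reduced_foldr[OF s] by simp
  qed (use Cons in auto)
qed simp

lemma foldr_gred: "reduced s \<Longrightarrow> foldr rcons (gred w) s = foldr rcons w s"
  by (induction w) (auto simp: gred_Cons foldr_rcons_rcons)

lemma gred_append: "gred (u @ v) = foldr rcons u (gred v)"
  by (simp add: gred_def)

lemma gred_append_left [simp]: "gred (gred u @ v) = gred (u @ v)"
  by (simp add: gred_append foldr_gred)

lemma gred_append_right [simp]: "gred (u @ gred v) = gred (u @ v)"
  by (simp add: gred_append)

lemma gred_wi_left [simp]: "gred (wi w @ w) = []"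
proof (induction w)
  case (Cons x w)
  have "gred (wi (x # w) @ x # w) = foldr rcons (wi w) (gred ([(fst x, \<not> snd x)] @ [x] @ w))"
    by (simp add: wi_Cons gred_append)
  also have "gred ([(fst x, \<not> snd x)] @ [x] @ w) = gred w"
    by (simp add: gred_Cons rcons_cancel')
  finally show ?case using Cons by (simp add: gred_append)
qed simp

lemma length_rcons: "length (rcons x w) \<le> Suc (length w)"
  by (cases w) auto

lemma length_gred: "length (gred w) \<le> length w"
  by (induction w) (auto simp: gred_Cons intro: order_trans[OF length_rcons])

lemma set_rcons: "set (rcons x w) \<subseteq> insert x (set w)"
  by (cases w) auto

lemma set_gred: "set (gred w) \<subseteq> set w"
proof (induction w)
  case (Cons x w) then show ?case using set_rcons[of x "gred w"] by (auto simp: gred_Cons)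
qed simp

section \<open>Free groups\<close>

typedef 'a fg = "{w :: 'a wrd. reduced w}"
  morphisms rep_fg abs_fg by (rule exI[of _ "[]"]) simp

setup_lifting type_definition_fg

lift_definition fgw :: "'a wrd \<Rightarrow> 'a fg" is gred by simp

text \<open>\<open>group_add\<close> does not assume commutativity, so free groups are written
  additively and a conjugate is \<open>g + h - g\<close>.\<close>

instantiation fg :: (type) group_add
begin
lift_definition zero_fg :: "'a fg" is "[]" by simp
lift_definition plus_fg :: "'a fg \<Rightarrow> 'a fg \<Rightarrow> 'a fg" is "\<lambda>u v. gred (u @ v)" by simp
lift_definition uminus_fg :: "'a fg \<Rightarrow> 'a fg" is "\<lambda>u. gred (wi u)" by simp
definition minus_fg :: "'a fg \<Rightarrow> 'a fg \<Rightarrow> 'a fg" where "minus_fg u v = u + - v"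
instance
proof
  fix a b c :: "'a fg"
  show "a + b + c = a + (b + c)" by transfer simp
  show "0 + a = a" by transfer (simp add: gred_reduced)
  show "a + 0 = a" by transfer (simp add: gred_reduced)
  show "- a + a = 0" by transfer simp
  show "a + - b = a - b" by (simp add: minus_fg_def)
qed
end

definition gen :: "'a \<Rightarrow> 'a fg" where "gen a = fgw [(a, True)]"

definition len :: "'a fg \<Rightarrow> nat" where "len g = length (rep_fg g)"

text \<open>Rewrites group expressions to right-nested sums of elements and negated elements. It
  opposes the default rule \<open>add_uminus_conv_diff\<close>, which is therefore deleted along
  with it.\<close>

lemmas gs = add.assoc diff_conv_add_uminus minus_add

lemma fgw_append [simp]: "fgw (u @ v) = fgw u + fgw v"
  by transfer simp

lemma fgw_Nil [simp]: "fgw [] = 0"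
  by transfer simp

lemma fgw_rep [simp]: "fgw (rep_fg g) = g"
  by transfer (simp add: gred_reduced)

lemma rep_fgw: "rep_fg (fgw w) = gred w"
  by transfer simp

lemma reduced_rep [simp]: "reduced (rep_fg g)"
  by transfer simp

lemma fgw_wi [simp]: "fgw (wi w) = - fgw w"
proof -
  have "fgw (wi w) + fgw w = fgw (wi w @ w)" by simp
  also have "\<dots> = 0" by transfer simp
  finally show ?thesis by (simp add: eq_neg_iff_add_eq_0)
qed

lemma fgw_single [simp]: "fgw [(a, e)] = (if e then gen a else - gen a)"
  using fgw_wi[of "[(a, True)]"] by (auto simp: gen_def)

lemma fgw_Cons: "fgw ((a, e) # w) = (if e then gen a else - gen a) + fgw w"
  using fgw_append[of "[(a,e)]" w] by (simp del: fgw_append)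

lemma fgw_eq_iff: "fgw u = fgw v \<longleftrightarrow> gred u = gred v"
  by transfer simp

lemma fgw_reduced_eq_0: "reduced w \<Longrightarrow> fgw w = 0 \<Longrightarrow> w = []"
  by transfer (simp add: gred_reduced)

lemma len_fgw: "len (fgw w) \<le> length w"
  by (simp add: len_def rep_fgw length_gred)

lemma len_0 [simp]: "len 0 = 0"
  by (simp add: len_def zero_fg.rep_eq)

lemma len_add: "len (g + h) \<le> len g + len h"
  using length_gred[of "rep_fg g @ rep_fg h"] by (simp add: len_def plus_fg.rep_eq)

lemma len_minus [simp]: "len (- g) = len g"
proof -
  have "len (- h) \<le> len h" for h :: "'b fg"
    using length_gred[of "wi (rep_fg h)"] by (simp add: len_def uminus_fg.rep_eq)
  from this[of g] this[of "- g"] show ?thesis by simp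
qed

lemma len_gen: "len (gen a) \<le> 1"
  using len_fgw[of "[(a,True)]"] by simp

lemma fg_induct [case_names zero plus minus]:
  assumes "P 0" "\<And>g a. P g \<Longrightarrow> P (g + gen a)" "\<And>g a. P g \<Longrightarrow> P (g - gen a)"
  shows "P g"
proof -
  have "P (fgw w)" for w
  proof (induction w rule: rev_induct)
    case (snoc x w) then show ?case using assms(2,3) by (cases x) auto
  qed (simp add: assms)
  from this[of "rep_fg g"] show ?thesis by simp
qed

section \<open>Homomorphisms from free groups\<close>

definition evw :: "('a \<Rightarrow> 'b :: group_add) \<Rightarrow> 'a wrd \<Rightarrow> 'b" where
  "evw h w = sum_list (map (\<lambda>(a, e). if e then h a else - h a) w)"

definition lift :: "('a \<Rightarrow> 'b :: group_add) \<Rightarrow> 'a fg \<Rightarrow> 'b" where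
  "lift h g = evw h (rep_fg g)"

lemma evw_Nil [simp]: "evw h [] = 0" and evw_append [simp]: "evw h (u @ v) = evw h u + evw h v"
  and evw_Cons: "evw h ((a, e) # w) = (if e then h a else - h a) + evw h w"
  by (simp_all add: evw_def)

lemma evw_rcons: "evw h (rcons x w) = evw h [x] + evw h w"
proof (cases w)
  case (Cons y ys) then show ?thesis by (cases x; cases y) (auto simp: evw_Cons)
qed simp

lemma evw_gred [simp]: "evw h (gred w) = evw h w"
  by (induction w) (auto simp: gred_Cons evw_rcons evw_Cons)

lemma lift_fgw [simp]: "lift h (fgw w) = evw h w"
  by (simp add: lift_def rep_fgw)

lemma lift_0 [simp]: "lift h 0 = 0"
  by (simp add: lift_def zero_fg.rep_eq)

lemma lift_add [simp]: "lift h (g + g') = lift h g + lift h g'"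
  by (simp add: lift_def plus_fg.rep_eq)

lemma lift_minus [simp]: "lift h (- g) = - lift h g"
proof -
  have "lift h (- g) + lift h g = 0" by (simp flip: lift_add)
  then show ?thesis by (simp add: eq_neg_iff_add_eq_0)
qed

lemma lift_diff [simp]: "lift h (g - g') = lift h g - lift h g'"
  using lift_add[of h g "- g'"] by (simp del: lift_add)

lemma lift_gen [simp]: "lift h (gen a) = h a"
  unfolding gen_def lift_fgw by (simp add: evw_Cons)

lemma fgw_evw: "fgw w = evw gen w"
  by (induction w) (auto simp: fgw_Cons evw_Cons)

lemma evw_zero [simp]: "evw (\<lambda>_. 0) w = 0"
  by (induction w) (auto simp: evw_Cons)

lemma lift_lift: "lift h (lift k g) = lift (\<lambda>a. lift h (k a)) g"
  by (induction g rule: fg_induct) auto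

section \<open>The four point condition\<close>

fun lcp :: "'a list \<Rightarrow> 'a list \<Rightarrow> nat" where
  "lcp (x # xs) (y # ys) = (if x = y then Suc (lcp xs ys) else 0)"
| "lcp _ _ = 0"

text \<open>This is the ultrametric inequality for common prefixes, the combinatorial form of the
  fact that the Cayley graph of a free group is a tree.\<close>

lemma lcp_ultra: "min (lcp u w) (lcp v w) \<le> lcp u v"
proof (induction u v arbitrary: w rule: lcp.induct)
  case (1 x xs y ys)
  show ?case
  proof (cases w)
    case (Cons z zs)
    show ?thesis using 1[of zs] Cons by (cases "x = y") auto
  qed simp
qed auto

lemma reduced_appendI:
  "reduced u \<Longrightarrow> reduced v \<Longrightarrow> (u \<noteq> [] \<Longrightarrow> v \<noteq> [] \<Longrightarrow> \<not> (fst (hd v) = fst (last u) \<and> snd (hd v) \<noteq> snd (last u)))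
   \<Longrightarrow> reduced (u @ v)"
  by (auto simp: reduced_def successively_append_iff)

lemma reduced_appendD: "reduced (u @ v) \<Longrightarrow> reduced u \<and> reduced v"
  by (auto simp: reduced_def successively_append_iff)

lemma last_wi: "w \<noteq> [] \<Longrightarrow> last (wi w) = (fst (hd w), \<not> snd (hd w))"
  by (cases w) (auto simp: wi_Cons)

lemma wi_eq_Nil [simp]: "wi w = [] \<longleftrightarrow> w = []"
  by (cases w) (auto simp: wi_Cons)

lemma reduced_wi: "reduced w \<Longrightarrow> reduced (wi w)"
proof (induction w)
  case (Cons x w)
  have 1: "reduced (wi w)" using Cons reduced_tl by blast
  show ?case
  proof (cases w)
    case (Cons y ys)
    then have "\<not> (fst y = fst x \<and> snd y \<noteq> snd x)" using \<open>reduced (x # w)\<close> by (simp add: reduced_Cons2)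
    then have "reduced (wi w @ [(fst x, \<not> snd x)])"
      using last_wi[of w] Cons by (intro reduced_appendI 1) auto
    then show ?thesis by (simp add: wi_Cons)
  qed (simp add: wi_Cons)
qed simp

text \<open>In \<open>wi u @ v\<close> exactly the common prefix of u and v cancels, once from each
  factor; so \<open>lcp\<close> is the Gromov product based at the identity.\<close>

lemma length_gred_diff:
  "reduced u \<Longrightarrow> reduced v \<Longrightarrow> length (gred (wi u @ v)) + 2 * lcp u v = length u + length v"
proof (induction u v rule: lcp.induct)
  case (1 x xs y ys)
  show ?case
  proof (cases "x = y")
    case True
    have "gred (wi (x # xs) @ y # ys) = gred (wi xs @ gred ([(fst x, \<not> snd x)] @ [x] @ ys))"
      using True by (simp only: wi_Cons append_assoc gred_append_right append_Cons append_Nil)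
    also have "gred ([(fst x, \<not> snd x)] @ [x] @ ys) = gred ys"
      by (simp add: gred_Cons rcons_cancel')
    finally have "gred (wi (x # xs) @ y # ys) = gred (wi xs @ ys)" by simp
    moreover have "length (gred (wi xs @ ys)) + 2 * lcp xs ys = length xs + length ys"
      using 1(2,3) by (intro 1(1) True) (auto dest: reduced_tl)
    ultimately show ?thesis using True by simp
  next
    case False
    have "reduced (wi (x # xs) @ (y # ys))"
      using 1(2,3) False last_wi[of "x # xs"]
      by (intro reduced_appendI reduced_wi) (auto simp: prod_eq_iff)
    then show ?thesis using False by (simp add: gred_reduced)
  qed
qed (auto simp: gred_reduced reduced_wi)

lemma len_diff: "len (- g + h) + 2 * lcp (rep_fg g) (rep_fg h) = len g + len h"
  using length_gred_diff[of "rep_fg g" "rep_fg h"]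
  by (simp add: len_def plus_fg.rep_eq uminus_fg.rep_eq)

text \<open>Among the three sums of opposite distances of the points 0, q, r, w of a tree, the
  largest one occurs twice. Here the two other sums are at most a + b.\<close>

lemma four_point:
  assumes "len q \<le> a" "len r \<le> a" "len (- q + w) \<le> b" "len (- r + w) \<le> b"
  shows "len (- q + r) + len w \<le> a + b"
  using assms len_diff[of q r] len_diff[of q w] len_diff[of r w]
    lcp_ultra[of "rep_fg q" "rep_fg w" "rep_fg r"] by (auto simp: min_def split: if_splits)

section \<open>Products of conjugates of relators\<close>

text \<open>As \<open>nc0\<close> holds for every m, the number is only an upper bound for the count
  of conjugates, which spares exact bookkeeping.\<close>

inductive nc :: "'a wrd set \<Rightarrow> nat \<Rightarrow> 'a fg \<Rightarrow> bool" for R where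
  nc0: "nc R m 0"
| ncP: "r \<in> R \<Longrightarrow> nc R m h \<Longrightarrow> nc R (Suc m) (g + fgw r - g + h)"
| ncN: "r \<in> R \<Longrightarrow> nc R m h \<Longrightarrow> nc R (Suc m) (g - fgw r - g + h)"

lemma nc_mono: "nc R m g \<Longrightarrow> m \<le> n \<Longrightarrow> nc R n g"
proof (induction arbitrary: n rule: nc.induct)
  case (ncP r m h g) then show ?case by (cases n) (auto intro: nc.ncP)
next
  case (ncN r m h g) then show ?case by (cases n) (auto intro: nc.ncN)
qed (rule nc0)

lemma nc_add: "nc R m g \<Longrightarrow> nc R n h \<Longrightarrow> nc R (m + n) (g + h)"
proof (induction rule: nc.induct)
  case (nc0 m) then show ?case by (auto intro: nc_mono)
next
  case (ncP r m h' g) from nc.ncP[OF ncP(1) ncP(3)[OF ncP(4)], of g] show ?case by (simp add: add.assoc)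
next
  case (ncN r m h' g) from nc.ncN[OF ncN(1) ncN(3)[OF ncN(4)], of g] show ?case by (simp add: add.assoc)
qed

lemma nc_conj: "nc R m g \<Longrightarrow> nc R m (a + g - a)"
proof (induction rule: nc.induct)
  case (ncP r m h g) from nc.ncP[OF ncP(1,3), of "a + g"] show ?case
    by (simp add: gs del: add_uminus_conv_diff)
next
  case (ncN r m h g) from nc.ncN[OF ncN(1,3), of "a + g"] show ?case
    by (simp add: gs del: add_uminus_conv_diff)
qed (auto intro: nc.nc0)

lemma nc_rel: "r \<in> R \<Longrightarrow> nc R 1 (fgw r)"
  using nc.ncP[OF _ nc.nc0, of r R 0 0] by simp

lemma nc_minus: "nc R m g \<Longrightarrow> nc R m (- g)"
proof (induction rule: nc.induct)
  case (ncP r m h g)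
  have "nc R (m + 1) (- h + (g - fgw r - g))"
    using nc_add[OF ncP(3) nc.ncN[OF ncP(1) nc.nc0, of 0 g]] by simp
  then show ?case by (simp add: gs del: add_uminus_conv_diff)
next
  case (ncN r m h g)
  have "nc R (m + 1) (- h + (g + fgw r - g))"
    using nc_add[OF ncN(3) nc.ncP[OF ncN(1) nc.nc0, of 0 g]] by simp
  then show ?case by (simp add: gs del: add_uminus_conv_diff)
qed (auto intro: nc.nc0)

text \<open>Equality in the presented group at a cost of at most m relators. Costs add up along
  chains, while a context is free, since conjugates of relators count like relators.\<close>

definition eqa :: "'a wrd set \<Rightarrow> nat \<Rightarrow> 'a fg \<Rightarrow> 'a fg \<Rightarrow> bool" where
  "eqa R m g h \<longleftrightarrow> nc R m (g - h)"

lemma eqa_refl [simp]: "eqa R m g g"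
  by (simp add: eqa_def nc.nc0)

lemma eqa_mono: "eqa R m g h \<Longrightarrow> m \<le> n \<Longrightarrow> eqa R n g h"
  by (simp add: eqa_def nc_mono)

lemma eqa_sym: "eqa R m g h \<Longrightarrow> eqa R m h g"
  using nc_minus by (fastforce simp: eqa_def)

lemma eqa_trans: "eqa R m g h \<Longrightarrow> eqa R n h k \<Longrightarrow> eqa R (m + n) g k"
  unfolding eqa_def using nc_add[of R m "g - h" n "h - k"] by (simp add: gs del: add_uminus_conv_diff)

lemma eqa_left: "eqa R m g h \<Longrightarrow> eqa R m (a + g) (a + h)"
  unfolding eqa_def using nc_conj[of R m "g - h" a] by (simp add: gs del: add_uminus_conv_diff)

lemma eqa_right: "eqa R m g h \<Longrightarrow> eqa R m (g + b) (h + b)"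
  unfolding eqa_def by (simp add: gs del: add_uminus_conv_diff)

lemma eqa_ctx: "eqa R m g h \<Longrightarrow> eqa R m (a + g + b) (a + h + b)"
  by (intro eqa_left eqa_right)

lemma eqa_minus: "eqa R m g h \<Longrightarrow> eqa R m (- g) (- h)"
proof -
  assume "eqa R m g h"
  from eqa_ctx[OF eqa_sym[OF this], of "- g" "- h"] show ?thesis by (simp add: add.assoc)
qed

lemma eqa_add: "eqa R m g h \<Longrightarrow> eqa R n g' h' \<Longrightarrow> eqa R (m + n) (g + g') (h + h')"
  by (rule eqa_trans[OF eqa_right eqa_left])

lemma eqa_0: "eqa R m g 0 \<longleftrightarrow> nc R m g"
  by (simp add: eqa_def)

lemma nc_eqa: "eqa R m g h \<Longrightarrow> nc R n h \<Longrightarrow> nc R (m + n) g"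
  using eqa_trans[of R m g h n 0] by (simp add: eqa_0)

lemma nc_lift:
  assumes "\<And>r. r \<in> R \<Longrightarrow> nc R' k (evw h r)" and "nc R m g"
  shows "nc R' (k * m) (lift h g)"
  using assms(2)
proof (induction rule: nc.induct)
  case (nc0 m) show ?case by (simp add: nc.nc0)
next
  case (ncP r m x g)
  have "nc R' (k + k * m) ((lift h g + evw h r - lift h g) + lift h x)"
    by (intro nc_add nc_conj assms ncP)
  then show ?case by simp
next
  case (ncN r m x g)
  have "nc R' (k + k * m) ((lift h g + (- evw h r) - lift h g) + lift h x)"
    by (intro nc_add nc_conj nc_minus assms ncN)
  then show ?case by simp
qed

lemma nc_kill:
  assumes "\<And>r. r \<in> R \<Longrightarrow> evw h r = 0" and "nc R m g"
  shows "lift h g = 0"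
  using assms(2) by induction (auto simp: assms(1))

definition triv :: "'a wrd set \<Rightarrow> 'a fg \<Rightarrow> bool" where
  "triv R g \<longleftrightarrow> (\<exists>m. nc R m g)"

definition cmm :: "'a wrd \<Rightarrow> 'a wrd \<Rightarrow> 'a wrd" where
  "cmm u v = u @ v @ wi u @ wi v"

lemma fgw_cmm: "fgw (cmm u v) = fgw u + fgw v - fgw u - fgw v"
  by (simp add: cmm_def gs del: add_uminus_conv_diff)

lemma evw_wi [simp]: "evw h (wi w) = - evw h w"
  using lift_fgw[of h "wi w"] by (simp del: lift_fgw) simp

lemma evw_cmm: "evw h (cmm u v) = evw h u + evw h v - evw h u - evw h v"
  by (simp add: cmm_def gs del: add_uminus_conv_diff)

lemma eqa_commI: "nc R m (g + h - g - h) \<Longrightarrow> eqa R m (g + h) (h + g)"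
  by (simp add: eqa_def gs del: add_uminus_conv_diff)

lemma eqa_comm_minus_left: "eqa R m (g + h) (h + g) \<Longrightarrow> eqa R m (- g + h) (h - g)"
proof -
  assume "eqa R m (g + h) (h + g)"
  from eqa_ctx[OF eqa_sym[OF this], of "- g" "- g"] show ?thesis
    by (simp add: gs del: add_uminus_conv_diff)
qed

lemma eqa_comm_minus_right: "eqa R m (g + h) (h + g) \<Longrightarrow> eqa R m (g - h) (- h + g)"
  using eqa_comm_minus_left[OF eqa_sym, of R m g h] by (metis eqa_sym)

lemma eqa_comm_word:
  assumes "\<And>a e. (a, e) \<in> set w \<Longrightarrow> eqa R k (g + h a) (h a + g)"
  shows "eqa R (k * length w) (g + evw h w) (evw h w + g)"
  using assms
proof (induction w)
  case (Cons x w)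
  obtain a e where x: "x = (a, e)" by force
  let ?l = "if e then h a else - h a"
  have "eqa R k (g + ?l) (?l + g)"
    using Cons.prems[of a e] x eqa_comm_minus_right[of R k g "h a"] by auto
  from eqa_right[OF this, of "evw h w"]
  have "eqa R k (g + (?l + evw h w)) (?l + (g + evw h w))" by (simp add: add.assoc)
  moreover have "eqa R (k * length w) (?l + (g + evw h w)) (?l + (evw h w + g))"
    using Cons by (intro eqa_left Cons.IH) auto
  ultimately have "eqa R (k + k * length w) (g + (?l + evw h w)) (?l + (evw h w + g))"
    by (rule eqa_trans)
  then show ?case by (simp add: x evw_Cons add.assoc)
qed simp

section \<open>The double of a product of free groups along the diagonal\<close>

text \<open>Xl and Yl generate the two factors, Sl the diagonal, and Kl is the stable letter.\<close>

datatype 'a eg = Xl 'a | Yl 'a | Sl 'a | Kl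

text \<open>The letters \<open>Sl a\<close> abbreviate the products of \<open>Xl a\<close> and
  \<open>Yl a\<close>. With them a diagonal element g is spelled with \<open>len g\<close> letters
  instead of twice as many, and this is what makes the removal of a pinch shorten the word.\<close>

definition RE :: "'a eg wrd set" where
  "RE = {cmm [(Xl a, True)] [(Yl b, True)] | a b. True}
      \<union> {[(Sl a, False), (Xl a, True), (Yl a, True)] | a. True}
      \<union> {cmm [(Kl, True)] [(Sl a, True)] | a. True}"

definition Yh :: "'a fg \<Rightarrow> 'a eg fg" where "Yh = lift (\<lambda>a. gen (Yl a))"
definition Sh :: "'a fg \<Rightarrow> 'a eg fg" where "Sh = lift (\<lambda>a. gen (Sl a))"

lemma Yh_simps [simp]: "Yh 0 = 0" "Yh (g + h) = Yh g + Yh h" "Yh (- g) = - Yh g"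
  "Yh (g - h) = Yh g - Yh h" "Yh (gen a) = gen (Yl a)"
  by (simp_all add: Yh_def)

lemma Sh_simps [simp]: "Sh 0 = 0" "Sh (g + h) = Sh g + Sh h" "Sh (- g) = - Sh g"
  "Sh (g - h) = Sh g - Sh h" "Sh (gen a) = gen (Sl a)"
  by (simp_all add: Sh_def)

lemma XY_comm: "eqa RE 1 (gen (Xl a) + gen (Yl b)) (gen (Yl b) + gen (Xl a))"
proof (rule eqa_commI)
  have "nc RE 1 (fgw (cmm [(Xl a, True)] [(Yl b, True)]))" by (rule nc_rel) (auto simp: RE_def)
  then show "nc RE 1 (gen (Xl a) + gen (Yl b) - gen (Xl a) - gen (Yl b))" by (simp add: fgw_cmm)
qed

lemma KS_comm: "eqa RE 1 (gen Kl + gen (Sl a)) (gen (Sl a) + gen Kl)"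
proof (rule eqa_commI)
  have "nc RE 1 (fgw (cmm [(Kl, True)] [(Sl a, True)]))" by (rule nc_rel) (auto simp: RE_def)
  then show "nc RE 1 (gen Kl + gen (Sl a) - gen Kl - gen (Sl a))" by (simp add: fgw_cmm)
qed

lemma S_XY: "eqa RE 1 (gen (Sl a)) (gen (Xl a) + gen (Yl a))"
proof -
  have "nc RE 1 (fgw [(Sl a, False), (Xl a, True), (Yl a, True)])" by (rule nc_rel) (auto simp: RE_def)
  then have "eqa RE 1 (- gen (Sl a) + (gen (Xl a) + gen (Yl a))) 0" by (simp add: eqa_0 fgw_Cons)
  from eqa_left[OF this, of "gen (Sl a)"] show ?thesis by (simp add: eqa_sym)
qed

lemma S_YX: "eqa RE 2 (gen (Sl a)) (gen (Yl a) + gen (Xl a))"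
  using eqa_trans[OF S_XY[of a] XY_comm[of a a]] by (simp add: numeral_2_eq_2)

lemma X_SY: "eqa RE 1 (gen (Xl a)) (gen (Sl a) - gen (Yl a))"
  using eqa_right[OF eqa_sym[OF S_XY[of a]], of "- gen (Yl a)"] by (simp add: gs del: add_uminus_conv_diff)

lemma mX_SY: "eqa RE 2 (- gen (Xl a)) (- gen (Sl a) + gen (Yl a))"
proof -
  have "eqa RE 2 (gen (Xl a)) (- gen (Yl a) + gen (Sl a))"
    using eqa_left[OF eqa_sym[OF S_YX[of a]], of "- gen (Yl a)"] by simp
  from eqa_minus[OF this] show ?thesis by (simp add: gs del: add_uminus_conv_diff)
qed

lemma mS_XY: "eqa RE 2 (- gen (Sl a)) (- gen (Xl a) - gen (Yl a))"
  using eqa_minus[OF S_YX[of a]] by (simp add: gs del: add_uminus_conv_diff)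

lemma X_Yh: "eqa RE (len d) (Yh d + gen (Xl a)) (gen (Xl a) + Yh d)"
proof -
  have "eqa RE (1 * length (rep_fg d)) (gen (Xl a) + evw (\<lambda>a. gen (Yl a)) (rep_fg d)) (evw (\<lambda>a. gen (Yl a)) (rep_fg d) + gen (Xl a))"
    by (rule eqa_comm_word) (rule XY_comm)
  then show ?thesis by (simp add: len_def Yh_def lift_def eqa_sym)
qed

lemma mX_Yh: "eqa RE (len d) (Yh d - gen (Xl a)) (- gen (Xl a) + Yh d)"
  by (rule eqa_comm_minus_right[OF X_Yh])

lemma K_Sh: "eqa RE (len d) (gen Kl + Sh d) (Sh d + gen Kl)"
proof -
  have "eqa RE (1 * length (rep_fg d)) (gen Kl + evw (\<lambda>a. gen (Sl a)) (rep_fg d)) (evw (\<lambda>a. gen (Sl a)) (rep_fg d) + gen Kl)"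
    by (rule eqa_comm_word) (rule KS_comm)
  then show ?thesis by (simp add: len_def Sh_def lift_def)
qed

section \<open>Words without the stable letter as paths in F x F\<close>

fun qh :: "'a eg \<Rightarrow> 'a fg" where
  "qh (Xl a) = gen a" | "qh (Yl a) = 0" | "qh (Sl a) = gen a" | "qh Kl = 0"

fun rh :: "'a eg \<Rightarrow> 'a fg" where
  "rh (Xl a) = 0" | "rh (Yl a) = gen a" | "rh (Sl a) = gen a" | "rh Kl = 0"

text \<open>The pair (q, r) of F x F is written as its diagonal part q followed by the deviation
  \<open>- q + r\<close> in the second factor. The length of the deviation measures how expensive
  the next letter is.\<close>

definition NF :: "'a fg \<Rightarrow> 'a fg \<Rightarrow> 'a eg fg" where
  "NF q r = Sh q + Yh (- q + r)"

text \<open>A letter of the first factor or of the diagonal has to pass the deviation, which lies in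
  the second factor; each letter passed costs one commutator. The summand 4 pays for rewriting
  between \<open>Xl\<close>, \<open>Yl\<close> and \<open>Sl\<close>.\<close>

lemma step_NF:
  assumes "l \<noteq> Kl"
  shows "eqa RE (len (- q + r) + 4) (NF q r + fgw [(l, e)]) (NF (q + evw qh [(l, e)]) (r + evw rh [(l, e)]))"
proof -
  define d where "d = - q + r"
  let ?D = "len d"
  show ?thesis
  proof (cases l)
    case (Xl a)
    show ?thesis
    proof (cases e)
      case True
      have "eqa RE (?D + 1) (Yh d + gen (Xl a)) (gen (Sl a) - gen (Yl a) + Yh d)"
        by (rule eqa_trans[OF X_Yh eqa_right[OF X_SY]])
      from eqa_left[OF this, of "Sh q"] have "eqa RE (?D + 1) (NF q r + fgw [(l, e)]) (NF (q + evw qh [(l, e)]) (r + evw rh [(l, e)]))"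
        using True Xl by (simp add: NF_def d_def evw_Cons gs del: add_uminus_conv_diff)
      then show ?thesis by (rule eqa_mono) (simp add: d_def)
    next
      case False
      have "eqa RE (?D + 2) (Yh d - gen (Xl a)) (- gen (Sl a) + gen (Yl a) + Yh d)"
        by (rule eqa_trans[OF mX_Yh eqa_right[OF mX_SY]])
      from eqa_left[OF this, of "Sh q"] have "eqa RE (?D + 2) (NF q r + fgw [(l, e)]) (NF (q + evw qh [(l, e)]) (r + evw rh [(l, e)]))"
        using False Xl by (simp add: NF_def d_def evw_Cons gs del: add_uminus_conv_diff)
      then show ?thesis by (rule eqa_mono) (simp add: d_def)
    qed
  next
    case (Yl a)
    then show ?thesis by (simp add: NF_def evw_Cons gs del: add_uminus_conv_diff)
  next
    case (Sl a)
    show ?thesis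
    proof (cases e)
      case True
      have 1: "eqa RE 1 (Yh d + gen (Sl a)) (Yh d + (gen (Xl a) + gen (Yl a)))"
        by (rule eqa_left[OF S_XY])
      have 2: "eqa RE ?D (Yh d + (gen (Xl a) + gen (Yl a))) (gen (Xl a) + Yh d + gen (Yl a))"
        using eqa_right[OF X_Yh[of d a], of "gen (Yl a)"] by (simp add: add.assoc)
      have 3: "eqa RE 1 (gen (Xl a) + Yh d + gen (Yl a)) (gen (Sl a) - gen (Yl a) + Yh d + gen (Yl a))"
        by (intro eqa_right X_SY)
      have "eqa RE (1 + ?D + 1) (Yh d + gen (Sl a)) (gen (Sl a) - gen (Yl a) + Yh d + gen (Yl a))"
        by (rule eqa_trans[OF eqa_trans[OF 1 2] 3])
      from eqa_left[OF this, of "Sh q"] have "eqa RE (1 + ?D + 1) (NF q r + fgw [(l, e)]) (NF (q + evw qh [(l, e)]) (r + evw rh [(l, e)]))"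
        using True Sl by (simp add: NF_def d_def evw_Cons gs del: add_uminus_conv_diff)
      then show ?thesis by (rule eqa_mono) (simp add: d_def)
    next
      case False
      have 1: "eqa RE 2 (Yh d - gen (Sl a)) (Yh d + (- gen (Xl a) - gen (Yl a)))"
        using eqa_left[OF mS_XY[of a], of "Yh d"] by simp
      have 2: "eqa RE ?D (Yh d + (- gen (Xl a) - gen (Yl a))) (- gen (Xl a) + Yh d - gen (Yl a))"
        using eqa_right[OF mX_Yh[of d a], of "- gen (Yl a)"] by (simp add: gs del: add_uminus_conv_diff)
      have 3: "eqa RE 2 (- gen (Xl a) + Yh d - gen (Yl a)) (- gen (Sl a) + gen (Yl a) + Yh d - gen (Yl a))"
        using eqa_right[OF mX_SY[of a], of "Yh d - gen (Yl a)"] by (simp add: gs del: add_uminus_conv_diff)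
      have "eqa RE (2 + ?D + 2) (Yh d - gen (Sl a)) (- gen (Sl a) + gen (Yl a) + Yh d - gen (Yl a))"
        by (rule eqa_trans[OF eqa_trans[OF 1 2] 3])
      from eqa_left[OF this, of "Sh q"] have "eqa RE (2 + ?D + 2) (NF q r + fgw [(l, e)]) (NF (q + evw qh [(l, e)]) (r + evw rh [(l, e)]))"
        using False Sl by (simp add: NF_def d_def evw_Cons gs del: add_uminus_conv_diff)
      then show ?thesis by (rule eqa_mono) (simp add: d_def)
    qed
  qed (use assms in simp)
qed

lemma path_NF:
  assumes "Kl \<notin> fst ` set v"
    and "\<And>p s. v = p @ s \<Longrightarrow> len (- (q + evw qh p) + (r + evw rh p)) \<le> D"
  shows "eqa RE (length v * (D + 4)) (NF q r + fgw v) (NF (q + evw qh v) (r + evw rh v))"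
  using assms
proof (induction v arbitrary: q r)
  case (Cons x v)
  obtain l e where x: "x = (l, e)" by force
  let ?q = "q + evw qh [x]" and ?r = "r + evw rh [x]"
  have "len (- q + r) \<le> D" using Cons.prems(2)[of "[]"] by simp
  moreover have "l \<noteq> Kl" using Cons.prems(1) x by auto
  ultimately have "eqa RE (D + 4) (NF q r + fgw [x]) (NF ?q ?r)"
    using eqa_mono[OF step_NF[of l q r e], of "D + 4"] x by simp
  from eqa_right[OF this, of "fgw v"]
  have "eqa RE (D + 4) (NF q r + fgw (x # v)) (NF ?q ?r + fgw v)"
    by (simp add: x fgw_Cons add.assoc)
  moreover have "eqa RE (length v * (D + 4)) (NF ?q ?r + fgw v) (NF (?q + evw qh v) (?r + evw rh v))"
  proof (rule Cons.IH)
    fix p s assume "v = p @ s"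
    then show "len (- (?q + evw qh p) + (?r + evw rh p)) \<le> D"
      using Cons.prems(2)[of "x # p" s] x by (simp add: evw_Cons add.assoc)
  qed (use Cons.prems in auto)
  ultimately have "eqa RE (D + 4 + length v * (D + 4)) (NF q r + fgw (x # v)) (NF (?q + evw qh v) (?r + evw rh v))"
    by (rule eqa_trans)
  then show ?case using x by (simp add: evw_Cons add.assoc)
qed simp

lemma len_evw: "(\<And>a. len (h a) \<le> 1) \<Longrightarrow> len (evw h w) \<le> length w"
proof (induction w)
  case (Cons x w)
  obtain a e where x: "x = (a, e)" by force
  have "len (evw h (x # w)) \<le> len (if e then h a else - h a) + len (evw h w)"
    unfolding x evw_Cons by (rule len_add)
  moreover have "len (if e then h a else - h a) \<le> 1" using Cons.prems[of a] by simp
  ultimately show ?case using Cons.IH[OF Cons.prems] by simp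
qed simp

lemma len_qh: "len (qh l) \<le> 1"
  using len_gen by (cases l) auto

lemma len_rh: "len (rh l) \<le> 1"
  using len_gen by (cases l) auto

text \<open>Let q and r be the two coordinates of a prefix p of v. Both are within |p| of the
  identity and within |v| - |p| of w, so the four point condition bounds the deviation by |v| - |w|:
  a path to a diagonal element strays from the diagonal only as far as it wastes length.\<close>

lemma region:
  assumes "Kl \<notin> fst ` set v" "evw qh v = w" "evw rh v = w"
  shows "eqa RE (length v * (length v - len w + 4)) (fgw v) (Sh w)" "len w \<le> length v"
proof -
  have "len (- (0 + evw qh p) + (0 + evw rh p)) \<le> length v - len w" if v: "v = p @ s" for p s
  proof -
    have "- evw qh p + w = evw qh s" by (simp add: v flip: assms(2))
    moreover have "- evw rh p + w = evw rh s" by (simp add: v flip: assms(3))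
    ultimately have "len (- evw qh p + evw rh p) + len w \<le> length p + length s"
      by (intro four_point) (auto intro!: len_evw len_qh len_rh)
    then show ?thesis using v by simp
  qed
  from path_NF[OF assms(1) this]
  show "eqa RE (length v * (length v - len w + 4)) (fgw v) (Sh w)"
    using assms by (simp add: NF_def)
  show "len w \<le> length v" using len_evw[of qh v, OF len_qh] assms(2) by simp
qed

section \<open>An invariant: the free product with the stable letter\<close>

definition em :: "'a fg \<Rightarrow> 'a option fg" where "em = lift (\<lambda>a. gen (Some a))"

lemma em_simps [simp]: "em 0 = 0" "em (g + h) = em g + em h" "em (- g) = - em g"
  "em (g - h) = em g - em h" "em (gen a) = gen (Some a)"
  by (simp_all add: em_def)

text \<open>In E the commutation of K with X(t) Y(t) amounts to X(t) K X(t)^-1 = Y(t)^-1 K Y(t). So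
  the first factor acts on the free product of the second factor with the infinite cyclic group of
  K: it fixes the former and conjugates K, for which \<open>None\<close> stands.\<close>

definition tw :: "'a fg \<Rightarrow> 'a option fg \<Rightarrow> 'a option fg" where
  "tw t = lift (\<lambda>x. case x of Some a \<Rightarrow> gen (Some a) | None \<Rightarrow> - em t + gen None + em t)"

lemma tw_simps [simp]: "tw t 0 = 0" "tw t (g + h) = tw t g + tw t h" "tw t (- g) = - tw t g"
  "tw t (g - h) = tw t g - tw t h" "tw t (gen (Some a)) = gen (Some a)"
  "tw t (gen None) = - em t + gen None + em t"
  by (simp_all add: tw_def)

lemma tw_em [simp]: "tw t (em g) = em g"
  by (induction g rule: fg_induct) auto

lemma tw_0 [simp]: "tw 0 g = g"
proof (induction g rule: fg_induct)
  case (plus g a) then show ?case by (cases a) auto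
next
  case (minus g a) then show ?case by (cases a) auto
qed simp

lemma tw_add: "tw (t + t') g = tw t (tw t' g)"
proof (induction g rule: fg_induct)
  case (plus g a) then show ?case by (cases a) (auto simp: gs simp del: add_uminus_conv_diff)
next
  case (minus g a) then show ?case by (cases a) (auto simp: gs simp del: add_uminus_conv_diff)
qed simp

text \<open>Semidirect product of F with the free product of F and an infinite cyclic group, on
  which the first F acts by \<open>tw\<close>. It is the target of an invariant of E whose vanishing
  can be read off from reduced words.\<close>

datatype 'a sd = SD (sdq: "'a fg") (sdv: "'a option fg")

instantiation sd :: (type) group_add
begin
definition zero_sd :: "'a sd" where "zero_sd = SD 0 0"
definition plus_sd :: "'a sd \<Rightarrow> 'a sd \<Rightarrow> 'a sd" where
  "plus_sd x y = SD (sdq x + sdq y) (sdv x + tw (sdq x) (sdv y))"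
definition uminus_sd :: "'a sd \<Rightarrow> 'a sd" where "uminus_sd x = SD (- sdq x) (tw (- sdq x) (- sdv x))"
definition minus_sd :: "'a sd \<Rightarrow> 'a sd \<Rightarrow> 'a sd" where "minus_sd x y = x + - y"
instance
proof
  fix a b c :: "'a sd"
  show "a + b + c = a + (b + c)" by (simp add: plus_sd_def tw_add add.assoc)
  show "0 + a = a" by (simp add: plus_sd_def zero_sd_def)
  show "a + 0 = a" by (simp add: plus_sd_def zero_sd_def)
  show "- a + a = 0" by (simp add: plus_sd_def uminus_sd_def zero_sd_def)
  show "a + - b = a - b" by (simp add: minus_sd_def)
qed
end

fun eh :: "'a eg \<Rightarrow> 'a sd" where
  "eh (Xl a) = SD (gen a) 0" | "eh (Yl a) = SD 0 (gen (Some a))"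
| "eh (Sl a) = SD (gen a) (gen (Some a))" | "eh Kl = SD 0 (gen None)"

lemma eh_RE: "r \<in> RE \<Longrightarrow> evw eh r = 0"
proof -
  have c: "g + h - g - h = 0" if "g + h = h + g" for g h :: "'b :: group_add"
    using that by (metis add_diff_cancel diff_add_cancel diff_self)
  have "eh (Xl a) + eh (Yl b) = eh (Yl b) + eh (Xl a)" for a b :: 'a
    by (simp add: plus_sd_def)
  moreover have "eh Kl + eh (Sl a) = eh (Sl a) + eh Kl" for a :: 'a
    by (simp add: plus_sd_def gs del: add_uminus_conv_diff)
  moreover have "eh (Xl a) + eh (Yl a) = eh (Sl a)" for a :: 'a
    by (simp add: plus_sd_def)
  ultimately show "r \<in> RE \<Longrightarrow> evw eh r = 0"
    by (auto simp: RE_def evw_cmm evw_Cons c)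
qed

lemma triv_eh: "triv RE g \<Longrightarrow> lift eh g = 0"
  using nc_kill[of RE eh] eh_RE by (auto simp: triv_def)

lemma eh_word: "Kl \<notin> fst ` set v \<Longrightarrow> evw eh v = SD (evw qh v) (em (evw rh v))"
proof (induction v)
  case (Cons x v)
  obtain l e where x: "x = (l, e)" by force
  then have "l \<noteq> Kl" using Cons by auto
  moreover have "evw eh v = SD (evw qh v) (em (evw rh v))" using Cons by auto
  ultimately show ?case using x
    by (cases l) (auto simp: evw_Cons plus_sd_def uminus_sd_def)
qed (simp add: zero_sd_def)

subsection \<open>Pinches\<close>

abbreviation (input) mS :: "'a wrd \<Rightarrow> 'a option wrd" where "mS \<equiv> map (map_prod Some id)"

lemma fgw_mS: "fgw (mS (rep_fg g)) = em g"
proof -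
  have "fgw (mS w) = evw (\<lambda>a. gen (Some a)) w" for w :: "'a wrd"
    by (induction w) (auto simp: fgw_Cons evw_Cons)
  then show ?thesis by (simp add: em_def lift_def)
qed

lemma reduced_mS: "reduced w \<Longrightarrow> reduced (mS w)"
  by (simp add: reduced_def successively_map)

fun pinc :: "(bool \<times> 'a fg) list \<Rightarrow> bool" where
  "pinc ((e, c) # (e', c') # bs) \<longleftrightarrow> (e \<noteq> e' \<and> c = 0) \<or> pinc ((e', c') # bs)"
| "pinc _ \<longleftrightarrow> False"

definition bw :: "(bool \<times> 'a fg) list \<Rightarrow> 'a option wrd" where
  "bw bs = concat (map (\<lambda>(e, c). (None, e) # mS (rep_fg c)) bs)"

lemma bw_simps [simp]: "bw [] = []" "bw ((e, c) # bs) = (None, e) # mS (rep_fg c) @ bw bs"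
  by (simp_all add: bw_def)

lemma reduced_bw: "\<not> pinc bs \<Longrightarrow> reduced (bw bs)"
proof (induction bs rule: pinc.induct)
  case (1 e c e' c' bs)
  have r: "reduced (bw ((e', c') # bs))" using 1 by simp
  show ?case
  proof (cases "rep_fg c = []")
    case True
    then have "c = 0" using fgw_rep[of c] by simp
    then have "e = e'" using 1(2) by auto
    then show ?thesis using r True by (simp add: reduced_Cons2)
  next
    case False
    then obtain y ys where y: "rep_fg c = y # ys" by (cases "rep_fg c") auto
    have "reduced (mS (rep_fg c) @ bw ((e', c') # bs))"
      by (rule reduced_appendI[OF reduced_mS[OF reduced_rep] r])
        (use y in \<open>auto simp: last_map\<close>)
    then show ?thesis using y by (simp add: reduced_Cons2)
  qed
next
  case ("2_2" v)
  obtain e c where v: "v = (e, c)" by force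
  have "reduced (mS (rep_fg c))" by (rule reduced_mS) simp
  then show ?case using v by (cases "rep_fg c") (auto simp: reduced_Cons2)
qed simp

text \<open>Without a pinch the concatenation of the reduced pieces is itself reduced, and it
  contains a stable letter, so its value is not 0.\<close>

lemma pinch_free:
  assumes "em g + fgw (bw bs) = 0" "bs \<noteq> []"
  shows "pinc bs"
proof (rule ccontr)
  assume np: "\<not> pinc bs"
  have "reduced (mS (rep_fg g) @ bw bs)"
    by (rule reduced_appendI[OF reduced_mS[OF reduced_rep] reduced_bw[OF np]])
      (use assms(2) in \<open>cases bs; auto simp: last_map split: prod.splits\<close>)
  moreover have "fgw (mS (rep_fg g) @ bw bs) = 0" using assms(1) by (simp add: fgw_mS)
  ultimately have "mS (rep_fg g) @ bw bs = []" by (rule fgw_reduced_eq_0)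
  then show False using assms(2) by (cases bs) (auto split: prod.splits)
qed

definition kw :: "(bool \<times> 'a eg wrd) list \<Rightarrow> 'a eg wrd" where
  "kw bs = concat (map (\<lambda>(e, v). (Kl, e) # v) bs)"

lemma kw_simps [simp]: "kw [] = []" "kw ((e, v) # bs) = (Kl, e) # v @ kw bs" "kw (bs @ bs') = kw bs @ kw bs'"
  by (simp_all add: kw_def)

lemma kw_decomp: "\<exists>v bs. w = v @ kw bs \<and> Kl \<notin> fst ` set v \<and> (\<forall>(e, u) \<in> set bs. Kl \<notin> fst ` set u)"
proof (induction w)
  case Nil
  then show ?case by (intro exI[of _ "[]"]) simp
next
  case (Cons x w)
  then obtain v bs where w: "w = v @ kw bs" "Kl \<notin> fst ` set v" "\<forall>(e, u) \<in> set bs. Kl \<notin> fst ` set u" by blast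
  show ?case
  proof (cases "fst x = Kl")
    case True
    then show ?thesis using w
      by (intro exI[of _ "[]"] exI[of _ "(snd x, v) # bs"]) (cases x; auto)
  next
    case False
    then show ?thesis using w by (intro exI[of _ "x # v"] exI[of _ bs]) auto
  qed
qed

fun pin :: "(bool \<times> 'a eg wrd) list \<Rightarrow> bool" where
  "pin ((e, v) # (e', v') # bs) \<longleftrightarrow> (e \<noteq> e' \<and> evw qh v = evw rh v) \<or> pin ((e', v') # bs)"
| "pin _ \<longleftrightarrow> False"

lemma pinD: "pin bs \<Longrightarrow> \<exists>b1 e v v' b2. bs = b1 @ (e, v) # (\<not> e, v') # b2 \<and> evw qh v = evw rh v"
proof (induction bs rule: pin.induct)
  case (1 e v e' v' bs)
  show ?case
  proof (cases "e \<noteq> e' \<and> evw qh v = evw rh v")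
    case True
    then have "e' = (\<not> e)" by auto
    then show ?thesis using True by (intro exI[of _ "[]"] exI[of _ e] exI[of _ v] exI[of _ v'] exI[of _ bs]) simp
  next
    case False
    then obtain b1 d u u' b2 where "(e', v') # bs = b1 @ (d, u) # (\<not> d, u') # b2" "evw qh u = evw rh u"
      using 1 by auto
    then show ?thesis by (metis append_Cons)
  qed
qed auto

text \<open>A letter K read when the first coordinate is t shows up in the invariant as K conjugated
  by t. Collecting the conjugators around a block with coordinates q and r leaves t + r - (t + q)
  between two occurrences of K, which vanishes exactly for a diagonal block, q = r. The last block
  has no K behind it.\<close>

fun cb :: "'a fg \<Rightarrow> (bool \<times> 'a eg wrd) list \<Rightarrow> (bool \<times> 'a fg) list" where
  "cb t [] = []"
| "cb t [(e, v)] = [(e, t + evw rh v)]"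
| "cb t ((e, v) # b # bs) = (e, t + evw rh v - (t + evw qh v)) # cb (t + evw qh v) (b # bs)"

lemma pinc_cb: "pinc (cb t bs) \<Longrightarrow> pin bs"
proof (induction t bs rule: cb.induct)
  case (3 t e v b bs)
  obtain e' v' where b: "b = (e', v')" by force
  obtain c' r where c: "cb (t + evw qh v) (b # bs) = (e', c') # r"
    unfolding b by (cases bs) auto
  have "(e \<noteq> e' \<and> t + evw rh v - (t + evw qh v) = 0) \<or> pinc (cb (t + evw qh v) (b # bs))"
    using 3(2) c by (simp add: diff_eq_eq)
  then have "(e \<noteq> e' \<and> evw qh v = evw rh v) \<or> pinc (cb (t + evw qh v) (b # bs))" by (auto simp: right_minus_eq)
  then show ?case using 3(1) b by auto
qed auto

lemma evw_eh_kw: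
  assumes "\<forall>(e, u) \<in> set bs. Kl \<notin> fst ` set u" "bs \<noteq> []"
  shows "tw t (sdv (evw eh (kw bs))) = - em t + fgw (bw (cb t bs))"
  using assms
proof (induction t bs rule: cb.induct)
  case (2 t e v)
  then show ?case
    by (cases e) (auto simp: evw_Cons eh_word plus_sd_def uminus_sd_def fgw_Cons fgw_mS gs tw_add simp del: add_uminus_conv_diff)
next
  case (3 t e v b bs)
  have IH: "tw (t + evw qh v) (sdv (evw eh (kw (b # bs)))) = - em (t + evw qh v) + fgw (bw (cb (t + evw qh v) (b # bs)))"
    using 3 by auto
  have v: "evw eh v = SD (evw qh v) (em (evw rh v))" using 3 by (intro eh_word) auto
  have "tw t (sdv ((if e then eh Kl else - eh Kl) + (SD q (em r) + E))) =
    tw t (if e then gen None else - gen None) + em r + tw (t + q) (sdv E)" for q r and E :: "'a sd"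
    by (cases e) (simp_all add: plus_sd_def uminus_sd_def tw_add gs del: add_uminus_conv_diff)
  moreover have "evw eh (kw ((e, v) # b # bs)) = (if e then eh Kl else - eh Kl) + (evw eh v + evw eh (kw (b # bs)))"
    by (simp only: kw_simps(2) evw_Cons evw_append)
  ultimately have "tw t (sdv (evw eh (kw ((e, v) # b # bs)))) =
    tw t (if e then gen None else - gen None) + em (evw rh v) + tw (t + evw qh v) (sdv (evw eh (kw (b # bs))))"
    unfolding v by simp
  then show ?case unfolding IH
    by (cases e) (simp_all add: fgw_Cons fgw_mS gs del: kw_simps add_uminus_conv_diff)
qed simp

text \<open>Britton's lemma for the stable letter K, obtained from normal forms in a free product:
  the invariant of a trivial word is 0, so its translated blocks contain a pinch, and this comes
  from a pinch over E.\<close>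

lemma pinch_exists:
  assumes "triv RE (fgw (v @ kw bs))" "bs \<noteq> []"
    and "Kl \<notin> fst ` set v" "\<forall>(e, u) \<in> set bs. Kl \<notin> fst ` set u"
  shows "pin bs"
proof -
  have "0 = evw eh (v @ kw bs)" using triv_eh[OF assms(1)] by (simp only: lift_fgw)
  also have "\<dots> = SD (evw qh v) (em (evw rh v)) + evw eh (kw bs)" using eh_word[OF assms(3)] by simp
  finally have "em (evw rh v) + tw (evw qh v) (sdv (evw eh (kw bs))) = 0"
    by (simp add: plus_sd_def zero_sd_def)
  then have "em (evw rh v) + (- em (evw qh v) + fgw (bw (cb (evw qh v) bs))) = 0"
    using evw_eh_kw[OF assms(4,2)] by simp
  then have "em (evw rh v - evw qh v) + fgw (bw (cb (evw qh v) bs)) = 0"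
    by (simp add: gs del: add_uminus_conv_diff)
  moreover have "cb (evw qh v) bs \<noteq> []" using assms(2) by (cases "(evw qh v, bs)" rule: cb.cases) auto
  ultimately show ?thesis using pinch_free pinc_cb by blast
qed

lemma triv_eqa: "eqa R m g h \<Longrightarrow> triv R g \<longleftrightarrow> triv R h"
  unfolding triv_def using nc_eqa eqa_sym by metis

text \<open>\<open>N\<close> bounds the lengths and stays fixed while the word shrinks. Removing a
  pinch with inner word u and diagonal value g costs at most |u| (|u| - |g| + 4) + |g| and saves 2 +
  |u| - |g| letters, so 5 N relators for each saved letter suffice.\<close>

lemma E_bound: "length w \<le> N \<Longrightarrow> triv RE (fgw w) \<Longrightarrow> nc RE (5 * N * length w) (fgw w)"
proof (induction "length w" arbitrary: w rule: less_induct)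
  case less
  obtain v bs where w: "w = v @ kw bs" "Kl \<notin> fst ` set v" "\<forall>(e, u) \<in> set bs. Kl \<notin> fst ` set u"
    using kw_decomp by blast
  show ?case
  proof (cases "bs = []")
    case True
    then have "SD (evw qh v) (em (evw rh v)) = 0"
      using triv_eh[OF less.prems(2)] eh_word[OF w(2)] w by simp
    then have q: "evw qh v = 0" "em (evw rh v) = 0" by (auto simp: zero_sd_def)
    \<comment> \<open>A retraction that kills the stable letter shows that \<open>em\<close> is
      injective.\<close>
    have "lift (\<lambda>x. case x of Some a \<Rightarrow> gen a | None \<Rightarrow> 0) (em g) = g" for g :: "'a fg"
      by (induction g rule: fg_induct) auto
    then have r: "evw rh v = 0" using q(2) by (metis lift_0)
    from region(1)[OF w(2) q(1) r] have "nc RE (length v * (length v + 4)) (fgw w)"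
      using True w by (simp add: eqa_0)
    moreover have "length v * (length v + 4) \<le> 5 * N * length w"
    proof (cases "length v")
      case (Suc k)
      then have "length v + 4 \<le> 5 * N" using less.prems True w by simp
      then have "length v * (length v + 4) \<le> length v * (5 * N)" by (rule mult_le_mono2)
      then show ?thesis using True w by (simp add: mult.commute)
    qed simp
    ultimately show ?thesis by (rule nc_mono)
  next
    case False
    from pinD[OF pinch_exists[OF _ False w(2,3)]] less.prems(2) w(1)
    obtain b1 e u v' b2 where b: "bs = b1 @ (e, u) # (\<not> e, v') # b2" "evw qh u = evw rh u" by blast
    define A B where "A = v @ kw b1" and "B = v' @ kw b2"
    have wA: "w = A @ (Kl, e) # u @ (Kl, \<not> e) # B" using w b by (simp add: A_def B_def)
    have uK: "Kl \<notin> fst ` set u" using w(3) b by auto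
    define g where "g = evw qh u"
    note reg = region[OF uK g_def[symmetric], folded b(2), folded g_def, OF refl]
    define k where "k = (if e then gen Kl else - gen Kl :: 'a eg fg)"
    have kk: "eqa RE (len g) (k + Sh g) (Sh g + k)"
      using K_Sh[of g] eqa_comm_minus_left[OF K_Sh[of g]] by (simp add: k_def)
    have "eqa RE (length u * (length u - len g + 4)) (k + fgw u - k) (k + Sh g - k)"
      using eqa_ctx[OF reg(1), of k "- k"] by simp
    moreover have "eqa RE (len g) (k + Sh g - k) (Sh g)"
      using eqa_right[OF kk, of "- k"] by (simp add: add.assoc)
    ultimately have "eqa RE (length u * (length u - len g + 4) + len g) (k + fgw u - k) (Sh g)"
      by (rule eqa_trans)
    from eqa_ctx[OF this, of "fgw A" "fgw B"]
    have 1: "eqa RE (length u * (length u - len g + 4) + len g) (fgw w) (fgw A + Sh g + fgw B)"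
      by (auto simp: wA fgw_Cons k_def gs simp del: add_uminus_conv_diff)
    \<comment> \<open>The pinch is replaced by the reduced word of its value g in the letters
      \<open>Sl\<close>; both letters K disappear.\<close>
    define w' where "w' = A @ map (map_prod Sl id) (rep_fg g) @ B"
    have "fgw (map (map_prod Sl id) x) = evw (\<lambda>a. gen (Sl a)) x" for x :: "'a wrd"
      by (induction x) (auto simp: fgw_Cons evw_Cons)
    then have w': "fgw w' = fgw A + Sh g + fgw B"
      by (simp add: w'_def Sh_def lift_def add.assoc)
    have len: "length w = length w' + 2 + (length u - len g)"
      using reg(2) by (simp add: wA w'_def len_def)
    have "triv RE (fgw w')" using triv_eqa[OF 1] less.prems(2) w' by simp
    then have "nc RE (5 * N * length w') (fgw w')"
      using less.hyps[of w'] less.prems(1) len by simp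
    from nc_eqa[OF 1[folded w'] this]
    have 2: "nc RE (length u * (length u - len g + 4) + len g + 5 * N * length w') (fgw w)" .
    have u: "length u \<le> N" "len g \<le> N" using less.prems(1) wA reg(2) by auto
    have "length u * (length u - len g + 4) + len g \<le> N * (length u - len g + 4) + N"
      using u by (intro add_mono mult_le_mono) auto
    also have "\<dots> \<le> 5 * N * (2 + (length u - len g))" by (simp add: algebra_simps)
    finally have "length u * (length u - len g + 4) + len g + 5 * N * length w' \<le> 5 * N * length w"
      unfolding len by (simp add: algebra_simps)
    with 2 show ?thesis by (rule nc_mono)
  qed
qed

definition qb :: "'a wrd set \<Rightarrow> nat \<Rightarrow> bool" where
  "qb R c \<longleftrightarrow> (\<forall>w. triv R (fgw w) \<longrightarrow> nc R (c * (length w)\<^sup>2) (fgw w))"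

lemma qb_E: "qb RE 5"
proof -
  have "nc RE (5 * (length w)\<^sup>2) (fgw w)" if "triv RE (fgw w)" for w :: "'a eg wrd"
    using E_bound[OF order_refl that] by (simp add: power2_eq_square mult.assoc)
  then show ?thesis by (simp add: qb_def)
qed

section \<open>Direct products\<close>

definition prodR :: "'a wrd set \<Rightarrow> 'b wrd set \<Rightarrow> ('a + 'b) wrd set" where
  "prodR R1 R2 = map (map_prod Inl id) ` R1 \<union> map (map_prod Inr id) ` R2
     \<union> {cmm [(Inl a, True)] [(Inr b, True)] | a b. True}"

lemma evw_map: "evw h (map (map_prod f id) w) = evw (\<lambda>a. h (f a)) w"
  by (induction w) (auto simp: evw_Cons)

definition inl :: "'a fg \<Rightarrow> ('a + 'b) fg" where "inl = lift (\<lambda>a. gen (Inl a))"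
definition inr :: "'b fg \<Rightarrow> ('a + 'b) fg" where "inr = lift (\<lambda>a. gen (Inr a))"
definition prl :: "('a + 'b) fg \<Rightarrow> 'a fg" where "prl = lift (case_sum gen (\<lambda>_. 0))"
definition prr :: "('a + 'b) fg \<Rightarrow> 'b fg" where "prr = lift (case_sum (\<lambda>_. 0) gen)"

lemma inl_simps [simp]: "inl 0 = 0" "inl (g + h) = inl g + inl h" "inl (- g) = - inl g"
  "inl (g - h) = inl g - inl h" "inl (gen a) = gen (Inl a)"
  by (simp_all add: inl_def)

lemma inr_simps [simp]: "inr 0 = 0" "inr (g + h) = inr g + inr h" "inr (- g) = - inr g"
  "inr (g - h) = inr g - inr h" "inr (gen a) = gen (Inr a)"
  by (simp_all add: inr_def)

lemma prl_simps [simp]: "prl 0 = 0" "prl (g + h) = prl g + prl h" "prl (- g) = - prl g"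
  "prl (g - h) = prl g - prl h" "prl (gen (Inl a)) = gen a" "prl (gen (Inr b)) = 0"
  by (simp_all add: prl_def)

lemma prr_simps [simp]: "prr 0 = 0" "prr (g + h) = prr g + prr h" "prr (- g) = - prr g"
  "prr (g - h) = prr g - prr h" "prr (gen (Inl a)) = 0" "prr (gen (Inr b)) = gen b"
  by (simp_all add: prr_def)

lemma triv_lift:
  assumes "\<And>r. r \<in> R \<Longrightarrow> triv R' (evw h r)" and "triv R g"
  shows "triv R' (lift h g)"
proof -
  from assms(2) obtain m where "nc R m g" by (auto simp: triv_def)
  then show ?thesis
  proof (induction rule: nc.induct)
    case (nc0 m) show ?case by (auto simp: triv_def intro: nc.nc0)
  next
    case (ncP r m x g)
    obtain k n where "nc R' k (evw h r)" "nc R' n (lift h x)" using assms(1)[OF ncP(1)] ncP(3) by (auto simp: triv_def)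
    then have "nc R' (k + n) ((lift h g + evw h r - lift h g) + lift h x)" by (intro nc_add nc_conj)
    then show ?case by (auto simp: triv_def)
  next
    case (ncN r m x g)
    obtain k n where "nc R' k (evw h r)" "nc R' n (lift h x)" using assms(1)[OF ncN(1)] ncN(3) by (auto simp: triv_def)
    then have "nc R' (k + n) ((lift h g + (- evw h r) - lift h g) + lift h x)" by (intro nc_add nc_conj nc_minus)
    then show ?case by (auto simp: triv_def)
  qed
qed

lemma triv_0 [simp]: "triv R 0"
  by (auto simp: triv_def intro: nc.nc0)

lemma triv_rel: "r \<in> R \<Longrightarrow> triv R (fgw r)"
  using nc_rel by (auto simp: triv_def)

lemma nc_inl: "nc R1 m g \<Longrightarrow> nc (prodR R1 R2) m (inl g)"
proof -
  assume g: "nc R1 m g"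
  have "nc (prodR R1 R2) 1 (evw (\<lambda>a. gen (Inl a)) r)" if "r \<in> R1" for r
    using nc_rel[of "map (map_prod Inl id) r" "prodR R1 R2"] that by (simp add: prodR_def fgw_evw evw_map)
  from nc_lift[OF this g] show ?thesis by (simp add: inl_def)
qed

lemma nc_inr: "nc R2 m g \<Longrightarrow> nc (prodR R1 R2) m (inr g)"
proof -
  assume g: "nc R2 m g"
  have "nc (prodR R1 R2) 1 (evw (\<lambda>a. gen (Inr a)) r)" if "r \<in> R2" for r
    using nc_rel[of "map (map_prod Inr id) r" "prodR R1 R2"] that by (simp add: prodR_def fgw_evw evw_map)
  from nc_lift[OF this g] show ?thesis by (simp add: inr_def)
qed

lemma prod_comm: "eqa (prodR R1 R2) 1 (gen (Inr b) + gen (Inl a)) (gen (Inl a) + gen (Inr b))"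
proof (rule eqa_sym[OF eqa_commI])
  have "nc (prodR R1 R2) 1 (fgw (cmm [(Inl a, True)] [(Inr b, True)]))" by (rule nc_rel) (auto simp: prodR_def)
  then show "nc (prodR R1 R2) 1 (gen (Inl a) + gen (Inr b) - gen (Inl a) - gen (Inr b))" by (simp add: fgw_cmm)
qed

lemma prod_comm_inl: "eqa (prodR R1 R2) (len g) (gen (Inr b) + inl g) (inl g + gen (Inr b))"
proof -
  have "eqa (prodR R1 R2) (1 * length (rep_fg g)) (gen (Inr b) + evw (\<lambda>a. gen (Inl a)) (rep_fg g)) (evw (\<lambda>a. gen (Inl a)) (rep_fg g) + gen (Inr b))"
    by (rule eqa_comm_word) (rule prod_comm)
  then show ?thesis by (simp add: len_def inl_def lift_def)
qed

lemma len_prl: "len (prl (fgw w)) \<le> length w"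
  unfolding prl_def lift_fgw by (rule len_evw) (auto simp: len_gen[unfolded One_nat_def] split: sum.splits)

lemma len_prr: "len (prr (fgw w)) \<le> length w"
  unfolding prr_def lift_fgw by (rule len_evw) (auto simp: len_gen[unfolded One_nat_def] split: sum.splits)

text \<open>Bubble sort: a letter of the second factor that is put in front of w passes at most |w|
  letters of the first one.\<close>

lemma prod_sort: "eqa (prodR R1 R2) ((length w)\<^sup>2) (fgw w) (inl (prl (fgw w)) + inr (prr (fgw w)))"
proof (induction w)
  case (Cons x w)
  obtain l e where x: "x = (l, e)" by force
  let ?l = "if e then gen l else - gen l"
  let ?L = "inl (prl (fgw w)) :: ('a + 'b) fg" and ?R = "inr (prr (fgw w)) :: ('a + 'b) fg"
  have 1: "eqa (prodR R1 R2) ((length w)\<^sup>2) (fgw (x # w)) (?l + (?L + ?R))"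
    using eqa_left[OF Cons] x by (simp add: fgw_Cons)
  have 2: "eqa (prodR R1 R2) (length w) (?l + (?L + ?R)) (inl (prl (fgw (x # w))) + inr (prr (fgw (x # w))))"
  proof (cases l)
    case (Inl a) then show ?thesis by (auto simp: x fgw_Cons add.assoc)
  next
    case (Inr b)
    have "eqa (prodR R1 R2) (length w) (?l + ?L) (?L + ?l)"
      using eqa_mono[OF prod_comm_inl[of R1 R2 "prl (fgw w)" b] len_prl]
        eqa_mono[OF eqa_comm_minus_left[OF prod_comm_inl[of R1 R2 "prl (fgw w)" b]] len_prl] Inr by simp
    from eqa_right[OF this, of ?R] show ?thesis using Inr by (auto simp: x fgw_Cons add.assoc)
  qed
  from eqa_mono[OF eqa_trans[OF 1 2]] show ?case by (simp add: power2_eq_square)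
qed simp

lemma triv_prod: "triv (prodR R1 R2) g \<longleftrightarrow> triv R1 (prl g) \<and> triv R2 (prr g)"
proof
  assume g: "triv (prodR R1 R2) g"
  have *: "triv R1 (evw (case_sum gen (\<lambda>_. 0)) r)" "triv R2 (evw (case_sum (\<lambda>_. 0) gen) r)"
    if "r \<in> prodR R1 R2" for r
    using that by (auto simp: prodR_def evw_map evw_cmm evw_Cons triv_rel simp flip: fgw_evw)
  show "triv R1 (prl g) \<and> triv R2 (prr g)"
    unfolding prl_def prr_def using triv_lift[OF *(1) g] triv_lift[OF *(2) g] by simp
next
  assume "triv R1 (prl g) \<and> triv R2 (prr g)"
  then obtain m n where "nc R1 m (prl g)" "nc R2 n (prr g)" by (auto simp: triv_def)
  then have "nc (prodR R1 R2) (m + n) (inl (prl g) + inr (prr g))" by (intro nc_add nc_inl nc_inr)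
  from nc_eqa[OF prod_sort[of R1 R2 "rep_fg g", simplified] this]
  show "triv (prodR R1 R2) g" by (auto simp: triv_def)
qed

lemma qb_prod:
  assumes "qb R1 c1" "qb R2 c2"
  shows "qb (prodR R1 R2) (c1 + c2 + 1)"
  unfolding qb_def
proof (intro allI impI)
  fix w :: "('a + 'b) wrd"
  assume "triv (prodR R1 R2) (fgw w)"
  then have t: "triv R1 (prl (fgw w))" "triv R2 (prr (fgw w))" by (auto simp: triv_prod)
  let ?n = "length w"
  have "nc R1 (c1 * (len (prl (fgw w)))\<^sup>2) (prl (fgw w))"
    using assms(1)[unfolded qb_def, rule_format, of "rep_fg (prl (fgw w))"] t by (simp add: len_def)
  then have "nc R1 (c1 * ?n\<^sup>2) (prl (fgw w))" by (rule nc_mono) (simp add: len_prl)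
  moreover have "nc R2 (c2 * (len (prr (fgw w)))\<^sup>2) (prr (fgw w))"
    using assms(2)[unfolded qb_def, rule_format, of "rep_fg (prr (fgw w))"] t by (simp add: len_def)
  then have "nc R2 (c2 * ?n\<^sup>2) (prr (fgw w))" by (rule nc_mono) (simp add: len_prr)
  ultimately have "nc (prodR R1 R2) (?n\<^sup>2 + (c1 * ?n\<^sup>2 + c2 * ?n\<^sup>2)) (fgw w)"
    by (intro nc_eqa[OF prod_sort] nc_add nc_inl nc_inr)
  then show "nc (prodR R1 R2) ((c1 + c2 + 1) * ?n\<^sup>2) (fgw w)" by (simp add: algebra_simps)
qed

lemma triv_empty: "triv {} g \<longleftrightarrow> g = 0"
proof
  assume "triv {} g"
  then obtain m where "nc {} m g" by (auto simp: triv_def)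
  then show "g = 0" by (induction rule: nc.induct) auto
qed simp

lemma qb_free: "qb {} 0"
  by (simp add: qb_def triv_empty nc.nc0)

section \<open>Weighted actions and lower bounds for areas\<close>

text \<open>\<open>p\<close> and \<open>m\<close> let a generator and its inverse act on states, and
  \<open>wt l s\<close> is the weight collected when l is read in state s; an inverse letter refunds
  the weight of the state to which it leads. Hence the total weight is a cocycle, well defined on
  the free group.\<close>

locale wact =
  fixes p m :: "'l \<Rightarrow> 's \<Rightarrow> 's" and wt :: "'l \<Rightarrow> 's \<Rightarrow> int"
  assumes mp [simp]: "m l (p l s) = s" and pm [simp]: "p l (m l s) = s"
begin

fun run :: "'l wrd \<Rightarrow> 's \<Rightarrow> 's \<times> int" where
  "run [] s = (s, 0)"
| "run ((l, e) # w) s = (if e then (fst (run w (p l s)), wt l s + snd (run w (p l s)))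
     else (fst (run w (m l s)), - wt l (m l s) + snd (run w (m l s))))"

lemma run_append: "run (u @ v) s = (fst (run v (fst (run u s))), snd (run u s) + snd (run v (fst (run u s))))"
  by (induction u arbitrary: s) auto

lemma run_rcons: "run (rcons x w) s = run (x # w) s"
proof (cases w)
  case (Cons y ys) then show ?thesis by (cases x; cases y) auto
qed simp

lemma run_gred [simp]: "run (gred w) s = run w s"
proof (induction w arbitrary: s)
  case (Cons x w) then show ?case by (cases x) (auto simp: gred_Cons run_rcons)
qed simp

definition runf :: "'l fg \<Rightarrow> 's \<Rightarrow> 's \<times> int" where "runf g = run (rep_fg g)"

lemma runf_fgw [simp]: "runf (fgw w) s = run w s"
  by (simp add: runf_def rep_fgw)

lemma runf_0 [simp]: "runf 0 s = (s, 0)"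
  by (simp add: runf_def zero_fg.rep_eq)

lemma runf_add: "runf (g + h) s = (fst (runf h (fst (runf g s))), snd (runf g s) + snd (runf h (fst (runf g s))))"
  by (simp add: runf_def plus_fg.rep_eq run_append)

lemma runf_minus: "runf (- g) (fst (runf g s)) = (s, - snd (runf g s))"
proof -
  have "runf (g + - g) s = (s, 0)" by simp
  then show ?thesis unfolding runf_add by (auto simp: prod_eq_iff)
qed

text \<open>A conjugated relator is read from another state, where its weight is again at most one
  in absolute value, and what the conjugator collects is refunded on the way back.\<close>

lemma weight_bound:
  assumes R: "\<And>r s. r \<in> R \<Longrightarrow> fst (run r s) = s \<and> \<bar>snd (run r s)\<bar> \<le> 1" and g: "nc R k g"
  shows "fst (runf g s) = s \<and> \<bar>snd (runf g s)\<bar> \<le> int k"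
  using g
proof (induction arbitrary: s rule: nc.induct)
  case (ncP r k h g)
  let ?t = "fst (runf g s)"
  have 1: "fst (run r ?t) = ?t" using R[OF ncP(1), of ?t] by simp
  have "runf (g + fgw r - g) s = (s, snd (run r ?t))"
    unfolding diff_conv_add_uminus runf_add using 1 by (simp add: runf_minus)
  then show ?case unfolding runf_add using ncP(3)[of s] R[OF ncP(1), of ?t] by (auto simp: abs_le_iff)
next
  case (ncN r k h g)
  let ?t = "fst (runf g s)"
  have 1: "fst (run r ?t) = ?t" using R[OF ncN(1), of ?t] by simp
  then have 2: "runf (- fgw r) ?t = (?t, - snd (run r ?t))" using runf_minus[of "fgw r" ?t] by simp
  have "runf (g - fgw r - g) s = (s, - snd (run r ?t))"
    unfolding diff_conv_add_uminus runf_add by (simp add: 2 runf_minus)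
  then show ?case unfolding runf_add using ncN(3)[of s] R[OF ncN(1), of ?t] by (auto simp: abs_le_iff)
qed simp

end

section \<open>Equality and commutation in a presented group\<close>

definition eqt :: "'a wrd set \<Rightarrow> 'a fg \<Rightarrow> 'a fg \<Rightarrow> bool" where
  "eqt R g h \<longleftrightarrow> (\<exists>m. eqa R m g h)"

lemma eqt_refl [simp]: "eqt R g g" by (auto simp: eqt_def)
lemma eqt_sym: "eqt R g h \<Longrightarrow> eqt R h g" by (auto simp: eqt_def intro: eqa_sym)
lemma eqt_trans [trans]: "eqt R g h \<Longrightarrow> eqt R h k \<Longrightarrow> eqt R g k" by (auto simp: eqt_def intro: eqa_trans)
lemma eqt_left: "eqt R g h \<Longrightarrow> eqt R (a + g) (a + h)" by (auto simp: eqt_def intro: eqa_left)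
lemma eqt_right: "eqt R g h \<Longrightarrow> eqt R (g + b) (h + b)" by (auto simp: eqt_def intro: eqa_right)
lemma eqt_add: "eqt R g h \<Longrightarrow> eqt R g' h' \<Longrightarrow> eqt R (g + g') (h + h')" by (auto simp: eqt_def intro: eqa_add)
lemma eqt_minus: "eqt R g h \<Longrightarrow> eqt R (- g) (- h)" by (auto simp: eqt_def intro: eqa_minus)
lemma eqt_conj: "eqt R g h \<Longrightarrow> eqt R (a + g - a) (a + h - a)"
  using eqt_right[OF eqt_left, of R g h a "- a"] by simp
lemma eqt_0: "eqt R g 0 \<longleftrightarrow> triv R g" by (auto simp: eqt_def triv_def eqa_0)
lemma eqt_triv: "eqt R g h \<longleftrightarrow> triv R (g - h)" by (auto simp: eqt_def triv_def eqa_def)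

definition com :: "'a wrd set \<Rightarrow> 'a fg \<Rightarrow> 'a fg \<Rightarrow> bool" where
  "com R g h \<longleftrightarrow> eqt R (g + h) (h + g)"

lemma com_triv: "com R g h \<longleftrightarrow> triv R (g + h - g - h)"
  by (simp add: com_def eqt_triv gs del: add_uminus_conv_diff)

lemma com_sym: "com R g h \<Longrightarrow> com R h g" by (auto simp: com_def intro: eqt_sym)
lemma com_0 [simp]: "com R g 0" by (simp add: com_def)

lemma com_add: "com R g h \<Longrightarrow> com R g k \<Longrightarrow> com R g (h + k)"
proof -
  assume "com R g h" "com R g k"
  then have "eqt R (g + h + k) (h + g + k)" "eqt R (h + (g + k)) (h + (k + g))"
    by (auto simp: com_def intro: eqt_left eqt_right)
  then show ?thesis unfolding com_def by (metis add.assoc eqt_trans)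
qed

lemma com_minus: "com R g h \<Longrightarrow> com R g (- h)"
  by (auto simp: com_def eqt_def dest: eqa_comm_minus_right)

lemma com_diff: "com R g h \<Longrightarrow> com R g k \<Longrightarrow> com R g (h - k)"
  using com_add[of R g h "- k"] com_minus[of R g k] by simp

lemma com_eqt: "eqt R g g' \<Longrightarrow> eqt R h h' \<Longrightarrow> com R g h \<Longrightarrow> com R g' h'"
  unfolding com_def by (meson eqt_add eqt_sym eqt_trans)

lemma com_conj: "com R g h \<Longrightarrow> com R (a + g - a) (a + h - a)"
  unfolding com_def using eqt_conj[of R "g + h" "h + g" a] by (simp add: gs del: add_uminus_conv_diff)

lemma com_lift: "(\<And>a. com R g (h a)) \<Longrightarrow> com R g (lift h x)"
  by (induction x rule: fg_induct) (auto intro: com_add com_diff)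

section \<open>The subgroup\<close>

datatype ('i, 'a) hg = Tl 'i | Fl 'a | Kh | Jh

abbreviation mF :: "'a wrd \<Rightarrow> ('i, 'a) hg wrd" where "mF \<equiv> map (map_prod Fl id)"

definition Fh :: "'a fg \<Rightarrow> ('i, 'a) hg fg" where "Fh = lift (\<lambda>a. gen (Fl a))"
definition Th :: "'i fg \<Rightarrow> ('i, 'a) hg fg" where "Th = lift (\<lambda>i. gen (Tl i))"

lemma Fh_simps [simp]: "Fh 0 = 0" "Fh (g + h) = Fh g + Fh h" "Fh (- g) = - Fh g"
  "Fh (g - h) = Fh g - Fh h" "Fh (gen a) = gen (Fl a)"
  by (simp_all add: Fh_def)

lemma Th_simps [simp]: "Th 0 = 0" "Th (g + h) = Th g + Th h" "Th (- g) = - Th g"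
  "Th (g - h) = Th g - Th h" "Th (gen a) = gen (Tl a)"
  by (simp_all add: Th_def)

lemma fgw_mF [simp]: "fgw (mF w) = Fh (fgw w)"
  by (induction w) (auto simp: fgw_Cons)

definition RH :: "('i \<Rightarrow> 'a wrd) \<Rightarrow> ('i \<Rightarrow> 'a wrd) \<Rightarrow> 'a wrd set \<Rightarrow> ('i, 'a) hg wrd set" where
  "RH b c Rs = {cmm [(Tl i, True)] [(Fl a, True)] | i a. True}
     \<union> {cmm [(Kh, True)] ((Tl i, True) # mF (c i)) | i. True}
     \<union> {cmm [(Jh, True)] ((Tl i, True) # mF (b i)) | i. True}
     \<union> {cmm (mF z @ [(Kh, True)] @ wi (mF z)) [(Jh, True)] | z. z \<in> Rs}"

inductive conn :: "('i \<Rightarrow> 'a wrd) \<Rightarrow> ('i \<Rightarrow> 'a wrd) \<Rightarrow> 'a fg \<Rightarrow> 'a fg \<Rightarrow> bool" for b c where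
  conn_refl: "conn b c z z"
| conn_fwd: "conn b c (fgw (b i) + z - fgw (c i)) z' \<Longrightarrow> conn b c z z'"
| conn_bwd: "conn b c z z' \<Longrightarrow> conn b c (fgw (b i) + z - fgw (c i)) z'"

text \<open>In the first copy of E the element T(i) c(i) becomes X(c(i)) Y(c(i)), which is diagonal
  and commutes with K; in the second one T(i) b(i) becomes diagonal and commutes with J. T and F
  commute because X and Y do, and the component in Free(T) keeps the T(i) free.\<close>

fun Phw :: "('i \<Rightarrow> 'a wrd) \<Rightarrow> ('i \<Rightarrow> 'a wrd) \<Rightarrow> ('i, 'a) hg \<Rightarrow> ('i + 'a eg + 'a eg) wrd" where
  "Phw b c (Tl i) = [(Inl i, True)] @ map (map_prod (Inr \<circ> Inl \<circ> Xl) id) (c i) @ map (map_prod (Inr \<circ> Inr \<circ> Xl) id) (b i)"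
| "Phw b c (Fl a) = [(Inr (Inl (Yl a)), True), (Inr (Inr (Yl a)), True)]"
| "Phw b c Kh = [(Inr (Inl Kl), True)]"
| "Phw b c Jh = [(Inr (Inr Kl), True)]"

definition RG :: "('i + 'a eg + 'a eg) wrd set" where "RG = prodR {} (prodR RE RE)"

text \<open>12 = 0 + (5 + 5 + 1) + 1, where each of the two direct products contributes a 1 for
  sorting.\<close>

lemma qb_G: "qb RG 12"
  using qb_prod[OF qb_free qb_prod[OF qb_E qb_E]] by (simp add: RG_def)

definition Xh :: "'a fg \<Rightarrow> 'a eg fg" where "Xh = lift (\<lambda>a. gen (Xl a))"

lemma Xh_simps [simp]: "Xh 0 = 0" "Xh (g + h) = Xh g + Xh h" "Xh (- g) = - Xh g"
  "Xh (g - h) = Xh g - Xh h" "Xh (gen a) = gen (Xl a)"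
  by (simp_all add: Xh_def)

lemma com_X_Y: "com RE (Xh g) (Yh h)"
proof -
  have "com RE (gen (Xl a)) (gen (Yl b))" for a b :: 'a
    using XY_comm[of a b] by (auto simp: com_def eqt_def)
  then have "com RE (gen (Yl b)) (Xh g)" for b unfolding Xh_def by (intro com_lift) (rule com_sym)
  then show ?thesis unfolding Yh_def by (intro com_lift) (rule com_sym)
qed

lemma XY_Sh: "eqt RE (Xh g + Yh g) (Sh g)"
proof (induction g rule: fg_induct)
  case (plus g a)
  have "eqt RE (Xh g + (gen (Xl a) + Yh g) + gen (Yl a)) (Xh g + (Yh g + gen (Xl a)) + gen (Yl a))"
    using com_X_Y[of "gen a" g] by (intro eqt_right eqt_left) (simp add: com_def)
  also have "Xh g + (Yh g + gen (Xl a)) + gen (Yl a) = (Xh g + Yh g) + (gen (Xl a) + gen (Yl a))"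
    by (simp add: add.assoc)
  also have "eqt RE \<dots> (Sh g + gen (Sl a))"
    using S_XY[of a] by (intro eqt_add plus) (auto simp: eqt_def intro: eqa_sym)
  finally show ?case by (simp add: add.assoc)
next
  case (minus g a)
  have "eqt RE (Xh g + (- gen (Xl a) + Yh g) + - gen (Yl a)) (Xh g + (Yh g + - gen (Xl a)) + - gen (Yl a))"
    using com_X_Y[of "- gen a" g] by (intro eqt_right eqt_left) (simp add: com_def)
  also have "Xh g + (Yh g + - gen (Xl a)) + - gen (Yl a) = (Xh g + Yh g) + (- gen (Xl a) - gen (Yl a))"
    by (simp add: gs del: add_uminus_conv_diff)
  also have "eqt RE \<dots> (Sh g + - gen (Sl a))"
    using mS_XY[of a] by (intro eqt_add minus) (auto simp: eqt_def intro: eqa_sym)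
  finally show ?case by (simp add: gs del: add_uminus_conv_diff)
qed simp

lemma com_K_XY: "com RE (gen Kl) (Xh g + Yh g)"
proof -
  have "com RE (gen Kl) (Sh g)"
    unfolding Sh_def by (intro com_lift) (unfold com_def eqt_def, rule exI[of _ 1], rule KS_comm)
  from com_eqt[OF eqt_refl eqt_sym[OF XY_Sh] this] show ?thesis .
qed

locale hgrp =
  fixes b c :: "'i \<Rightarrow> 'a wrd" and Rs :: "'a wrd set"
begin

abbreviation "H \<equiv> RH b c Rs"
abbreviation "bg \<equiv> \<lambda>i. fgw (b i)"
abbreviation "cg \<equiv> \<lambda>i. fgw (c i)"
abbreviation "bl \<equiv> lift bg"
abbreviation "cl \<equiv> lift cg"

lemma comTF: "com H (gen (Tl i)) (gen (Fl a))"
proof -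
  have "cmm [(Tl i, True)] [(Fl a, True)] \<in> H" unfolding RH_def  by blast
  from triv_rel[OF this] show ?thesis by (simp add: com_triv fgw_cmm)
qed

lemma comT_F: "com H (Th t) (Fh f)"
proof -
  have "com H (gen (Fl a)) (Th t)" for a unfolding Th_def using comTF by (intro com_lift) (rule com_sym)
  then show ?thesis unfolding Fh_def by (intro com_lift) (rule com_sym)
qed

lemma comK: "com H (gen Kh) (gen (Tl i) + Fh (cg i))"
proof -
  have "cmm [(Kh, True)] ((Tl i, True) # mF (c i)) \<in> H" unfolding RH_def  by blast
  from triv_rel[OF this] show ?thesis by (simp add: com_triv fgw_cmm fgw_Cons)
qed

lemma comJ: "com H (gen Jh) (gen (Tl i) + Fh (bg i))"
proof -
  have "cmm [(Jh, True)] ((Tl i, True) # mF (b i)) \<in> H" unfolding RH_def  by blast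
  from triv_rel[OF this] show ?thesis by (simp add: com_triv fgw_cmm fgw_Cons)
qed

lemma conj_of_com:
  assumes k: "com H k (t + f)" and tf: "com H t f"
  shows "eqt H (t + k - t) (- f + k + f)"
proof -
  have "eqt H (t + f + k - (t + f)) (k + (t + f) - (t + f))"
    unfolding diff_conv_add_uminus using k by (intro eqt_right) (auto simp: com_def intro: eqt_sym)
  then have 1: "eqt H (t + f + k - (t + f)) k" by (simp add: add.assoc)
  have "eqt H (- f + (t + f) + k - (t + f) + f) (- f + k + f)"
    using eqt_right[OF eqt_left[OF 1, of "- f"], of f] by (simp add: gs del: add_uminus_conv_diff)
  moreover have "eqt H (- f + (t + f)) t"
    using eqt_left[of H "t + f" "f + t" "- f"] tf by (simp add: com_def)
  then have "eqt H (- f + (t + f) + k - (- f + (t + f))) (t + k - t)"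
    unfolding diff_conv_add_uminus by (intro eqt_add eqt_minus) auto
  ultimately show ?thesis
    by (metis (no_types, lifting) add.assoc diff_conv_add_uminus eqt_sym eqt_trans minus_add minus_minus)
qed

text \<open>A word t in the T(i) acts on K by conjugation like the inverse of its image in F, where
  T(i) is sent to c(i); for J the image uses b(i).\<close>

lemma T_conj:
  assumes k: "\<And>i. com H k (gen (Tl i) + Fh (fgw (d i)))"
  shows "eqt H (Th t + k - Th t) (- Fh (lift (\<lambda>i. fgw (d i)) t) + k + Fh (lift (\<lambda>i. fgw (d i)) t))"
proof (induction t rule: fg_induct)
  case (plus t i)
  let ?D = "Fh (lift (\<lambda>i. fgw (d i)) t)" and ?d = "Fh (fgw (d i))"
  have 1: "eqt H (gen (Tl i) + k - gen (Tl i)) (- ?d + k + ?d)"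
    by (rule conj_of_com[OF k]) (use comT_F[of "gen i" "fgw (d i)"] in simp)
  have "eqt H (Th t + (gen (Tl i) + k - gen (Tl i)) - Th t) (Th t + (- ?d + k + ?d) - Th t)"
    by (rule eqt_conj[OF 1])
  also have "Th t + (- ?d + k + ?d) - Th t = (Th t - ?d - Th t) + (Th t + k - Th t) + (Th t + ?d - Th t)"
    by (simp add: gs del: add_uminus_conv_diff)
  also have "eqt H \<dots> (- ?d + (- ?D + k + ?D) + ?d)"
  proof (intro eqt_add plus)
    have "com H (Th t) (Fh x)" for x by (rule comT_F)
    then have *: "eqt H (Th t + Fh x - Th t) (Fh x)" for x
      using eqt_right[of H "Th t + Fh x" "Fh x + Th t" "- Th t"] by (simp add: com_def add.assoc)
    show "eqt H (Th t + ?d - Th t) ?d" by (rule *)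
    show "eqt H (Th t - ?d - Th t) (- ?d)" using *[of "- fgw (d i)"] by simp
  qed
  finally show ?case by (simp add: gs del: add_uminus_conv_diff)
next
  case (minus t i)
  let ?D = "Fh (lift (\<lambda>i. fgw (d i)) t)" and ?d = "Fh (fgw (d i))"
  have "com H k (- gen (Tl i) - ?d)"
  proof -
    have "com H k (- (gen (Tl i) + ?d))" by (rule com_minus[OF k])
    moreover have "eqt H (- (gen (Tl i) + ?d)) (- gen (Tl i) - ?d)"
      using comT_F[of "- gen i" "- fgw (d i)"] by (simp add: com_def eqt_sym gs del: add_uminus_conv_diff)
    ultimately show ?thesis using com_eqt[OF eqt_refl] by blast
  qed
  then have 1: "eqt H (- gen (Tl i) + k + gen (Tl i)) (?d + k - ?d)"
    using conj_of_com[of k "- gen (Tl i)" "- ?d"] comT_F[of "- gen i" "- fgw (d i)"] by simp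
  have "eqt H (Th t + (- gen (Tl i) + k + gen (Tl i)) - Th t) (Th t + (?d + k - ?d) - Th t)"
    by (rule eqt_conj[OF 1])
  also have "Th t + (?d + k - ?d) - Th t = (Th t + ?d - Th t) + (Th t + k - Th t) + (Th t - ?d - Th t)"
    by (simp add: gs del: add_uminus_conv_diff)
  also have "eqt H \<dots> (?d + (- ?D + k + ?D) + - ?d)"
  proof (intro eqt_add minus)
    have "com H (Th t) (Fh x)" for x by (rule comT_F)
    then have *: "eqt H (Th t + Fh x - Th t) (Fh x)" for x
      using eqt_right[of H "Th t + Fh x" "Fh x + Th t" "- Th t"] by (simp add: com_def add.assoc)
    show "eqt H (Th t + ?d - Th t) ?d" by (rule *)
    show "eqt H (Th t - ?d - Th t) (- ?d)" using *[of "- fgw (d i)"] by simp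
  qed
  finally show ?case by (simp add: gs del: add_uminus_conv_diff)
qed simp

text \<open>Conjugate both elements by T(i) b(i). This fixes J, and since T(i) commutes with b(i) z
  and acts on K like c(i)^-1, it turns z K z^-1 into the conjugate of K by b(i) z c(i)^-1: one
  move.\<close>

lemma comKJ_step:
  "com H (Fh z + gen Kh - Fh z) (gen Jh) \<longleftrightarrow>
   com H (Fh (bg i + z - cg i) + gen Kh - Fh (bg i + z - cg i)) (gen Jh)"
proof -
  let ?T = "gen (Tl i)" and ?b = "Fh (bg i)" and ?c = "Fh (cg i)" and ?z = "Fh z"
  let ?a = "?T + ?b"
  have J: "eqt H (?a + gen Jh - ?a) (gen Jh)"
    using eqt_right[of H "?a + gen Jh" "gen Jh + ?a" "- ?a"] com_sym[OF comJ[of i]] by (simp add: com_def add.assoc)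
  have bz: "eqt H (?T + (?b + ?z)) (?b + ?z + ?T)" using comT_F[of "gen i" "bg i + z"] by (simp add: com_def)
  have K: "eqt H (?T + gen Kh - ?T) (- ?c + gen Kh + ?c)"
    using T_conj[OF comK, of "gen i"] by simp
  have "?a + (?z + gen Kh - ?z) - ?a = (?T + (?b + ?z)) + gen Kh - (?T + (?b + ?z))"
    by (simp add: gs del: add_uminus_conv_diff)
  also have "eqt H \<dots> ((?b + ?z + ?T) + gen Kh - (?b + ?z + ?T))"
    unfolding diff_conv_add_uminus by (intro eqt_add eqt_minus bz) auto
  also have "\<dots> = (?b + ?z) + (?T + gen Kh - ?T) - (?b + ?z)" by (simp add: gs del: add_uminus_conv_diff)
  also have "eqt H \<dots> ((?b + ?z) + (- ?c + gen Kh + ?c) - (?b + ?z))" by (rule eqt_conj[OF K])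
  also have "\<dots> = Fh (bg i + z - cg i) + gen Kh - Fh (bg i + z - cg i)" by (simp add: gs del: add_uminus_conv_diff)
  finally have E: "eqt H (?a + (?z + gen Kh - ?z) - ?a) (Fh (bg i + z - cg i) + gen Kh - Fh (bg i + z - cg i))" .
  show ?thesis
  proof
    assume "com H (Fh z + gen Kh - Fh z) (gen Jh)"
    from com_eqt[OF E J com_conj[OF this, of ?a]]
    show "com H (Fh (bg i + z - cg i) + gen Kh - Fh (bg i + z - cg i)) (gen Jh)" .
  next
    assume "com H (Fh (bg i + z - cg i) + gen Kh - Fh (bg i + z - cg i)) (gen Jh)"
    from com_eqt[OF eqt_sym[OF E] eqt_sym[OF J] this]
    have "com H (?a + (?z + gen Kh - ?z) - ?a) (?a + gen Jh - ?a)" .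
    from com_conj[OF this, of "- ?a"]
    show "com H (Fh z + gen Kh - Fh z) (gen Jh)" by (simp add: gs del: add_uminus_conv_diff)
  qed
qed

lemma comKJ_base:
  assumes "z \<in> Rs"
  shows "com H (Fh (fgw z) + gen Kh - Fh (fgw z)) (gen Jh)"
proof -
  have "cmm (mF z @ [(Kh, True)] @ wi (mF z)) [(Jh, True)] \<in> H" unfolding RH_def using assms by blast
  from triv_rel[OF this] show ?thesis by (simp add: com_triv fgw_cmm fgw_Cons gs del: add_uminus_conv_diff)
qed

lemma comKJ_conn: "conn b c z z' \<Longrightarrow> com H (Fh z + gen Kh - Fh z) (gen Jh) \<longleftrightarrow> com H (Fh z' + gen Kh - Fh z') (gen Jh)"
proof (induction rule: conn.induct)
  case (conn_fwd i z z') then show ?case using comKJ_step by blast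
next
  case (conn_bwd z z' i) then show ?case using comKJ_step by blast
qed simp

text \<open>\<open>gK\<close> and \<open>gJ\<close> are the two copies of E seen through the
  invariant \<open>eh\<close>, as functions of the generators of H. Together with \<open>gT\<close>
  they determine the normal form of an element of H.\<close>

fun gK :: "('i, 'a) hg \<Rightarrow> 'a sd" where
  "gK (Tl i) = SD (cg i) 0" | "gK (Fl a) = SD 0 (gen (Some a))" | "gK Kh = SD 0 (gen None)" | "gK Jh = 0"

fun gJ :: "('i, 'a) hg \<Rightarrow> 'a sd" where
  "gJ (Tl i) = SD (bg i) 0" | "gJ (Fl a) = SD 0 (gen (Some a))" | "gJ Kh = 0" | "gJ Jh = SD 0 (gen None)"

fun gT :: "('i, 'a) hg \<Rightarrow> 'i fg" where
  "gT (Tl i) = gen i" | "gT _ = 0"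

fun gF :: "('i, 'a) hg \<Rightarrow> 'a fg" where
  "gF (Fl a) = gen a" | "gF _ = 0"

definition iK :: "'a option fg \<Rightarrow> ('i, 'a) hg fg" where
  "iK = lift (\<lambda>x. case x of Some a \<Rightarrow> gen (Fl a) | None \<Rightarrow> gen Kh)"
definition iJ :: "'a option fg \<Rightarrow> ('i, 'a) hg fg" where
  "iJ = lift (\<lambda>x. case x of Some a \<Rightarrow> gen (Fl a) | None \<Rightarrow> gen Jh)"

lemma iK_simps [simp]: "iK 0 = 0" "iK (g + h) = iK g + iK h" "iK (- g) = - iK g"
  "iK (g - h) = iK g - iK h" "iK (gen (Some a)) = gen (Fl a)" "iK (gen None) = gen Kh"
  by (simp_all add: iK_def)

lemma iJ_simps [simp]: "iJ 0 = 0" "iJ (g + h) = iJ g + iJ h" "iJ (- g) = - iJ g"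
  "iJ (g - h) = iJ g - iJ h" "iJ (gen (Some a)) = gen (Fl a)" "iJ (gen None) = gen Jh"
  by (simp_all add: iJ_def)

lemma iK_em [simp]: "iK (em g) = Fh g" by (induction g rule: fg_induct) auto
lemma iJ_em [simp]: "iJ (em g) = Fh g" by (induction g rule: fg_induct) auto

lemma sd_proj [simp]: "sdq (x + y) = sdq x + sdq y" "sdq (- x) = - sdq x" "sdq (x - y) = sdq x - sdq y" "sdq 0 = 0"
  "sdv (x + y) = sdv x + tw (sdq x) (sdv y)" "sdv (- x) = - tw (- sdq x) (sdv x)" "sdv 0 = 0"
  "sdv (x - y) = sdv x - tw (sdq x) (tw (- sdq y) (sdv y))"
  by (simp_all add: plus_sd_def uminus_sd_def minus_sd_def zero_sd_def)

lemma sdq_gK: "sdq (lift gK g) = cl (lift gT g)"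
proof (induction g rule: fg_induct)
  case (plus g a) then show ?case by (cases a) auto
next
  case (minus g a) then show ?case by (cases a) auto
qed simp

lemma sdq_gJ: "sdq (lift gJ g) = bl (lift gT g)"
proof (induction g rule: fg_induct)
  case (plus g a) then show ?case by (cases a) auto
next
  case (minus g a) then show ?case by (cases a) auto
qed simp

text \<open>The F-part is visible in the K-coordinate after K is killed, so triviality of the
  coordinates in G forces it to vanish too.\<close>

lemma gF_gK: "lift gF g = lift (\<lambda>x. case x of Some a \<Rightarrow> gen a | None \<Rightarrow> 0) (sdv (lift gK g))"
proof (induction g rule: fg_induct)
  case (plus g a) then show ?case by (cases a) auto
next
  case (minus g a) then show ?case by (cases a) auto
qed simp

context
  assumes connected: "\<And>z. \<exists>z'\<in>Rs. conn b c z (fgw z')"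
begin

lemma comKJ0: "com H (Fh z + gen Kh - Fh z) (gen Jh)"
  using connected[of z] comKJ_conn comKJ_base by blast

lemma comKJ: "com H (Fh z + gen Kh - Fh z) (Fh y + gen Jh - Fh y)"
  using com_conj[OF comKJ0[of "- y + z"], of "Fh y"] by (simp add: gs del: add_uminus_conv_diff)

text \<open>\<open>iJ (sdv (lift gJ g))\<close> is a word in F and J whose F-part is
  \<open>lift gF g\<close>. Without this part a product of conjugates of J by elements of F remains,
  and these commute with all conjugates of K.\<close>

lemma comD: "com H (Fh z + gen Kh - Fh z) (- Fh (lift gF g) + iJ (sdv (lift gJ g)))"
proof (induction g arbitrary: z rule: fg_induct)
  case (plus g l)
  let ?D = "- Fh (lift gF g) + iJ (sdv (lift gJ g))"
  show ?case
  proof (cases l)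
    case (Fl a)
    \<comment> \<open>A further letter of F conjugates the product by it; the induction hypothesis
      for the shifted z absorbs this.\<close>
    from com_conj[OF plus[of "gen a + z"], of "- gen (Fl a)"] show ?thesis
      using Fl by (simp add: gs del: add_uminus_conv_diff)
  next
    case Jh
    let ?q = "Fh (bl (lift gT g))"
    have "com H (Fh z + gen Kh - Fh z) (?D + (- ?q + gen Jh + ?q))"
      using com_add[OF plus comKJ[of z "- bl (lift gT g)"]] by simp
    then show ?thesis using Jh by (simp add: sdq_gJ gs del: add_uminus_conv_diff)
  qed (use plus in auto)
next
  case (minus g l)
  let ?D = "- Fh (lift gF g) + iJ (sdv (lift gJ g))"
  show ?case
  proof (cases l)
    case (Fl a)
    from com_conj[OF minus[of "- gen a + z"], of "gen (Fl a)"] show ?thesis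
      using Fl by (simp add: gs del: add_uminus_conv_diff)
  next
    case Jh
    let ?q = "Fh (bl (lift gT g))"
    have "com H (Fh z + gen Kh - Fh z) (?D - (- ?q + gen Jh + ?q))"
      using com_diff[OF minus comKJ[of z "- bl (lift gT g)"]] by simp
    then show ?thesis using Jh by (simp add: sdq_gJ gs del: add_uminus_conv_diff)
  qed (use minus in auto)
qed simp

text \<open>K-part, J-part and T-part. The K-part and the J-part both contain the F-part of g, so
  one copy of it is cancelled between them.\<close>

definition nf :: "('i, 'a) hg fg \<Rightarrow> ('i, 'a) hg fg" where
  "nf g = iK (sdv (lift gK g)) - Fh (lift gF g) + iJ (sdv (lift gJ g)) + Th (lift gT g)"

lemma T_pass: "eqt H (Th t + k - Th t) k' \<Longrightarrow> eqt H (Th t + k) (k' + Th t)"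
  using eqt_right[of H "Th t + k - Th t" k' "Th t"] by simp

text \<open>A new letter K has to pass the T-part, where \<open>T_conj\<close> turns it into a
  conjugate by an element of F, and the product of conjugates of J, which it passes by
  \<open>comD\<close>. Letters of F and J pass only the T-part.\<close>

lemma nf_step:
  assumes x: "x = gen l \<or> x = - gen l"
  shows "eqt H (nf g + x) (nf (g + x))"
proof (cases l)
  case (Tl i)
  then show ?thesis using x by (auto simp: nf_def gs simp del: add_uminus_conv_diff)
next
  case (Fl a)
  let ?T = "Th (lift gT g)" and ?A = "iK (sdv (lift gK g)) - Fh (lift gF g) + iJ (sdv (lift gJ g))"
  have "eqt H (?T + x) (x + ?T)"
    using comT_F[of "lift gT g" "gen a"] comT_F[of "lift gT g" "- gen a"] x Fl by (auto simp: com_def)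
  from eqt_left[OF this, of ?A] show ?thesis
    using x Fl by (auto simp: nf_def gs simp del: add_uminus_conv_diff)
next
  case Kh
  let ?T = "Th (lift gT g)" and ?V = "iK (sdv (lift gK g))" and ?D = "- Fh (lift gF g) + iJ (sdv (lift gJ g))"
  let ?q = "Fh (cl (lift gT g))"
  have xx: "com H x (gen (Tl i) + Fh (cg i))" for i
    using comK[of i] com_sym[OF com_minus[OF com_sym[OF comK[of i]]]] x Kh by auto
  have 1: "eqt H (?T + x) (- ?q + x + ?q + ?T)" by (rule T_pass[OF T_conj[OF xx]])
  have "com H ?D (- ?q + gen Kh + ?q)" using com_sym[OF comD[of "- cl (lift gT g)" g]] by simp
  then have "com H ?D (- ?q + x + ?q)" using com_minus[of H ?D "- ?q + gen Kh + ?q"] x Kh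
    by (auto simp: gs simp del: add_uminus_conv_diff)
  then have 2: "eqt H (?V + (?D + (- ?q + x + ?q)) + ?T) (?V + ((- ?q + x + ?q) + ?D) + ?T)"
    unfolding com_def by (intro eqt_right eqt_left)
  have "nf g + x = ?V + ?D + (?T + x)" by (simp add: nf_def gs del: add_uminus_conv_diff)
  also have "eqt H \<dots> (?V + ?D + (- ?q + x + ?q + ?T))" by (rule eqt_left[OF 1])
  also have "\<dots> = ?V + (?D + (- ?q + x + ?q)) + ?T" by (simp add: add.assoc)
  also note 2
  also have "?V + ((- ?q + x + ?q) + ?D) + ?T = nf (g + x)"
    using x Kh by (auto simp: nf_def sdq_gK gs simp del: add_uminus_conv_diff)
  finally show ?thesis .
next
  case Jh
  let ?T = "Th (lift gT g)" and ?A = "iK (sdv (lift gK g)) - Fh (lift gF g) + iJ (sdv (lift gJ g))"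
  let ?q = "Fh (bl (lift gT g))"
  have xx: "com H x (gen (Tl i) + Fh (bg i))" for i
    using comJ[of i] com_sym[OF com_minus[OF com_sym[OF comJ[of i]]]] x Jh by auto
  have 1: "eqt H (?T + x) (- ?q + x + ?q + ?T)" by (rule T_pass[OF T_conj[OF xx]])
  from eqt_left[OF 1, of ?A] show ?thesis
    using x Jh by (auto simp: nf_def sdq_gJ gs simp del: add_uminus_conv_diff)
qed

lemma eqt_nf: "eqt H g (nf g)"
proof (induction g rule: fg_induct)
  case zero show ?case by (simp add: nf_def)
next
  case (plus g l)
  from eqt_trans[OF eqt_right[OF plus] nf_step[of "gen l" l g]] show ?case by simp
next
  case (minus g l)
  from eqt_trans[OF eqt_right[OF minus, of "- gen l"] nf_step[of "- gen l" l g]] show ?case by simp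
qed

section \<open>The embedding of H into Free(T) x E x E\<close>

fun pL :: "('i, 'a) hg \<Rightarrow> 'a eg fg" where
  "pL (Tl i) = Xh (cg i)" | "pL (Fl a) = gen (Yl a)" | "pL Kh = gen Kl" | "pL Jh = 0"

fun pR :: "('i, 'a) hg \<Rightarrow> 'a eg fg" where
  "pR (Tl i) = Xh (bg i)" | "pR (Fl a) = gen (Yl a)" | "pR Kh = 0" | "pR Jh = gen Kl"

abbreviation "Ph \<equiv> lift (\<lambda>l. fgw (Phw b c l))"

lemma fgw_map_X: "fgw (map (map_prod (Inr \<circ> Inl \<circ> Xl) id) w) = inr (inl (Xh (fgw w)))"
  "fgw (map (map_prod (Inr \<circ> Inr \<circ> Xl) id) w) = inr (inr (Xh (fgw w)))"
  by (induction w) (auto simp: fgw_Cons)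

lemma prl_inl [simp]: "prl (inl g) = g" by (induction g rule: fg_induct) auto
lemma prl_inr [simp]: "prl (inr h) = 0" by (induction h rule: fg_induct) auto
lemma prr_inl [simp]: "prr (inl g) = 0" by (induction g rule: fg_induct) auto
lemma prr_inr [simp]: "prr (inr h) = h" by (induction h rule: fg_induct) auto

lemma Ph_proj: "prl (Ph g) = lift gT g" "prl (prr (Ph g)) = lift pL g" "prr (prr (Ph g)) = lift pR g"
proof -
  have "prl (fgw (Phw b c l)) = gT l" "prl (prr (fgw (Phw b c l))) = pL l" "prr (prr (fgw (Phw b c l))) = pR l" for l
    by (cases l; simp add: fgw_Cons fgw_map_X)+
  then show "prl (Ph g) = lift gT g" "prl (prr (Ph g)) = lift pL g" "prr (prr (Ph g)) = lift pR g"
    by (induction g rule: fg_induct) auto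
qed

lemma eh_Xh [simp]: "lift eh (Xh g) = SD g 0"
  by (induction g rule: fg_induct) (auto simp: zero_sd_def plus_sd_def minus_sd_def uminus_sd_def)

lemma evw_lift_mF: "evw h (mF w) = lift h (Fh (fgw w))"
  by (simp flip: fgw_mF)

lemma lift_Fh_pL [simp]: "lift pL (Fh g) = Yh g" "lift pR (Fh g) = Yh g" "lift gT (Fh g) = 0"
  by (induction g rule: fg_induct) auto

text \<open>Relators of H are checked in each coordinate of G. Conversely, if the image is trivial,
  all coordinates that determine \<open>nf g\<close> vanish; so \<open>nf g\<close> is 0, and g
  equals it in H.\<close>

lemma embed_iff: "triv H g \<longleftrightarrow> triv RG (Ph g)"
proof
  assume g: "triv H g"
  have c0: "x + y - x - y = 0" if "y = 0 \<or> x = 0" for x y :: "'b :: group_add" using that by auto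
  have "triv RE (evw pL r)" "triv RE (evw pR r)" "triv {} (evw gT r)" if "r \<in> H" for r
    using that com_X_Y[of "cg _" "gen _"] com_X_Y[of "bg _" "gen _"] com_K_XY[of "cg _"] com_K_XY[of "bg _"]
    by (auto simp: RH_def evw_cmm evw_Cons evw_lift_mF com_triv triv_empty)
  then have "triv RE (lift pL g)" "triv RE (lift pR g)" "triv {} (lift gT g)"
    using triv_lift[OF _ g, of RE pL] triv_lift[OF _ g, of RE pR] triv_lift[OF _ g, of "{}" gT] by auto
  then show "triv RG (Ph g)" by (simp add: RG_def triv_prod Ph_proj)
next
  assume "triv RG (Ph g)"
  then have t: "lift gT g = 0" "triv RE (lift pL g)" "triv RE (lift pR g)"
    by (auto simp: RG_def triv_prod Ph_proj triv_empty)
  have "(\<lambda>l. lift eh (pL l)) = gK" "(\<lambda>l. lift eh (pR l)) = gJ"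
    by (rule ext, rename_tac l, case_tac l; simp)+
  then have "lift gK g = 0" "lift gJ g = 0"
    using triv_eh[OF t(2)] triv_eh[OF t(3)] by (simp_all add: lift_lift)
  then have "nf g = 0" using t(1) gF_gK[of g] by (simp add: nf_def)
  then show "triv H g" using eqt_nf[of g] by (simp add: eqt_0)
qed

end

end

section \<open>Lower bounds for areas\<close>

context wact
begin

lemma runf_gen [simp]: "runf (gen l) s = (p l s, wt l s)" "runf (- gen l) s = (m l s, - wt l (m l s))"
proof -
  show "runf (gen l) s = (p l s, wt l s)" using runf_fgw[of "[(l, True)]" s] by (simp del: runf_fgw)
  show "runf (- gen l) s = (m l s, - wt l (m l s))" using runf_fgw[of "[(l, False)]" s] by (simp del: runf_fgw)
qed

end

context hgrp
begin

text \<open>A state is a set M of lit lamps in F together with a position (u, f) in Free(T) x F; K switches the lamp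
  at f c(u)^-1. The weight of J distinguishes M only through lamps at distance at least D from Rs.\<close>

fun hp :: "('i, 'a) hg \<Rightarrow> 'a fg set \<times> 'i fg \<times> 'a fg \<Rightarrow> 'a fg set \<times> 'i fg \<times> 'a fg" where
  "hp (Tl i) (M, u, f) = (M, u + gen i, f)"
| "hp (Fl a) (M, u, f) = (M, u, f + gen a)"
| "hp Kh (M, u, f) = (if f - cl u \<in> M then M - {f - cl u} else insert (f - cl u) M, u, f)"
| "hp Jh s = s"

fun hm :: "('i, 'a) hg \<Rightarrow> 'a fg set \<times> 'i fg \<times> 'a fg \<Rightarrow> 'a fg set \<times> 'i fg \<times> 'a fg" where
  "hm (Tl i) (M, u, f) = (M, u - gen i, f)"
| "hm (Fl a) (M, u, f) = (M, u, f - gen a)"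
| "hm Kh (M, u, f) = (if f - cl u \<in> M then M - {f - cl u} else insert (f - cl u) M, u, f)"
| "hm Jh s = s"

text \<open>J has weight only on the graph f = b(u), which T(i) b(i) preserves; there the default
  weight \<open>min (len u) D\<close> changes by at most one, so the relators [J, T(i) b(i)] have
  weight at most one. A relator [r K r^-1, J] switches at such a position a lamp y with h y at most
  \<open>len u\<close>. If this lamp is far, the weight is D with or without it; otherwise the
  weight ignores it.\<close>

definition phi :: "('a fg \<Rightarrow> nat) \<Rightarrow> nat \<Rightarrow> 'a fg set \<times> 'i fg \<times> 'a fg \<Rightarrow> int" where
  "phi h D = (\<lambda>(M, u, f). if f = bl u then (if \<exists>y\<in>M. D \<le> h y then int D else int (min (len u) D)) else 0)"

definition hw :: "('a fg \<Rightarrow> nat) \<Rightarrow> nat \<Rightarrow> ('i, 'a) hg \<Rightarrow> 'a fg set \<times> 'i fg \<times> 'a fg \<Rightarrow> int" where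
  "hw h D l s = (if l = Jh then phi h D s else 0)"

lemma wact_h: "wact hp hm"
proof
  show "hm l (hp l s) = s" for l s by (cases l; cases s) auto
  show "hp l (hm l s) = s" for l s by (cases l; cases s) auto
qed

lemma len_step: "\<bar>int (min (len u) D) - int (min (len (u + gen i)) D)\<bar> \<le> 1"
proof -
  have "len (u + gen i) \<le> len u + 1" using len_add[of u "gen i"] len_gen[of i] by simp
  moreover have "len u \<le> len (u + gen i) + 1" using len_add[of "u + gen i" "- gen i"] len_gen[of i] by simp
  ultimately show ?thesis by auto
qed

context
  fixes h :: "'a fg \<Rightarrow> nat"
  assumes lip: "\<And>i z. h (bg i + z - cg i) \<le> Suc (h z)" "\<And>i z. h z \<le> Suc (h (bg i + z - cg i))"
    and h0: "\<And>r. r \<in> Rs \<Longrightarrow> h (fgw r) = 0"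
begin

text \<open>Reading u from the right, each letter T(i) or its inverse applies a move or undoes one,
  and \<open>h\<close> changes by at most one.\<close>

lemma h_orbit: "r \<in> Rs \<Longrightarrow> h (bl u + fgw r - cl u) \<le> len u"
proof -
  assume r: "r \<in> Rs"
  have "h (evw bg w + fgw r - evw cg w) \<le> length w" for w
  proof (induction w)
    case (Cons x w)
    obtain i e where x: "x = (i, e)" by force
    let ?Z = "evw bg w + fgw r - evw cg w"
    show ?case
    proof (cases e)
      case True
      have "evw bg (x # w) + fgw r - evw cg (x # w) = bg i + ?Z - cg i"
        using x True by (simp add: evw_Cons gs del: add_uminus_conv_diff)
      then show ?thesis using lip(1)[of i ?Z] Cons by simp
    next
      case False
      have "bg i + (evw bg (x # w) + fgw r - evw cg (x # w)) - cg i = ?Z"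
        using x False by (simp add: evw_Cons gs del: add_uminus_conv_diff)
      then show ?thesis using lip(2)[of "evw bg (x # w) + fgw r - evw cg (x # w)" i] Cons by simp
    qed
  qed (simp add: h0[OF r])
  from this[of "rep_fg u"] show ?thesis by (simp add: len_def lift_def)
qed

text \<open>Start with all lamps off at the origin. The commutator lights the lamp z, reads J with
  weight D = h(z), switches the lamp off again, and reads J^-1 with weight 0; its total weight is
  D.\<close>

lemma area_H_lower:
  assumes "nc H k (fgw (cmm (mF z @ [(Kh, True)] @ wi (mF z)) [(Jh, True)]))"
  shows "h (fgw z) \<le> k"
proof -
  define D where "D = h (fgw z)"
  interpret wact hp hm "hw h D" using wact_h .
  have [simp]: "hw h D (Tl i) s = 0" "hw h D (Fl a) s = 0" "hw h D Kh s = 0" "hw h D Jh s = phi h D s" for i a s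
    by (simp_all add: hw_def)
  have rF: "runf (Fh g) (M, u, f) = ((M, u, f + g), 0)" for g M u f
  proof (induction g rule: fg_induct)
    case (minus g a) then show ?case unfolding Fh_simps diff_conv_add_uminus runf_add by (simp add: gs del: add_uminus_conv_diff)
  qed (auto simp: runf_add add.assoc)
  have rF': "runf (- Fh g) (M, u, f) = ((M, u, f - g), 0)" for g M u f
    using rF[of "- g"] by simp
  note rs = gs runf_add rF rF'
  have bl: "f + bg i = bl (u + gen i) \<longleftrightarrow> f = bl u" for f u i by simp
  have "fst (run r s) = s \<and> \<bar>snd (run r s)\<bar> \<le> 1" if r: "r \<in> H" for r s
  proof -
    obtain M u f where s: "s = (M, u, f)" by (cases s)
    have "fst (runf (fgw r) s) = s \<and> \<bar>snd (runf (fgw r) s)\<bar> \<le> 1"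
      using r unfolding RH_def
    proof (elim UnE CollectE exE conjE)
      fix i a assume "r = cmm [(Tl i, True)] [(Fl a, True)]"
      then show ?thesis by (simp add: fgw_cmm s rs del: add_uminus_conv_diff runf_fgw)
    next
      fix i assume "r = cmm [(Kh, True)] ((Tl i, True) # mF (c i))"
      then have "fgw r = gen Kh + (gen (Tl i) + Fh (cg i)) - gen Kh - (gen (Tl i) + Fh (cg i))"
        by (simp add: fgw_cmm fgw_Cons)
      then show ?thesis by (simp add: s rs del: add_uminus_conv_diff runf_fgw) auto
    next
      fix i assume "r = cmm [(Jh, True)] ((Tl i, True) # mF (b i))"
      then have "fgw r = gen Jh + (gen (Tl i) + Fh (bg i)) - gen Jh - (gen (Tl i) + Fh (bg i))"
        by (simp add: fgw_cmm fgw_Cons)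
      then have "runf (fgw r) s = (s, phi h D (M, u, f) - phi h D (M, u + gen i, f + bg i))"
        by (simp add: s rs del: add_uminus_conv_diff runf_fgw)
      moreover have "\<bar>phi h D (M, u, f) - phi h D (M, u + gen i, f + bg i)\<bar> \<le> 1"
        using len_step[of u D i] bl[of f i u] by (auto simp: phi_def)
      ultimately show ?thesis by simp
    next
      fix z assume z: "z \<in> Rs" and "r = cmm (mF z @ [(Kh, True)] @ wi (mF z)) [(Jh, True)]"
      then have e: "fgw r = Fh (fgw z) + gen Kh - Fh (fgw z) + gen Jh - (Fh (fgw z) + gen Kh - Fh (fgw z)) - gen Jh"
        by (simp add: fgw_cmm fgw_Cons gs del: add_uminus_conv_diff)
      define y where "y = f + fgw z - cl u"
      define M' where "M' = (if y \<in> M then M - {y} else insert y M)"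
      have "runf (fgw r) s = (s, phi h D (M', u, f) - phi h D (M, u, f))"
        unfolding e by (simp add: s rs M'_def y_def del: add_uminus_conv_diff runf_fgw) (auto simp: insert_absorb)
      moreover have "phi h D (M', u, f) = phi h D (M, u, f)"
      proof (cases "f = bl u")
        case True
        then have y: "h y \<le> len u" using h_orbit[OF z, of u] by (simp add: y_def)
        show ?thesis
        proof (cases "D \<le> h y")
          case True
          then have "min (len u) D = D" using y by simp
          then show ?thesis by (simp add: phi_def)
        next
          case False
          then have "(\<exists>x\<in>M'. D \<le> h x) \<longleftrightarrow> (\<exists>x\<in>M. D \<le> h x)" by (auto simp: M'_def)
          then show ?thesis by (simp add: phi_def)
        qed
      qed (simp add: phi_def)
      ultimately show ?thesis by simp
    qed
    then show ?thesis by simp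
  qed
  from weight_bound[OF this assms, of "({}, 0, 0)"]
  have b: "\<bar>snd (runf (fgw (cmm (mF z @ [(Kh, True)] @ wi (mF z)) [(Jh, True)])) ({}, 0, 0))\<bar> \<le> int k" by blast
  have e: "fgw (cmm (mF z @ [(Kh, True)] @ wi (mF z)) [(Jh, True)]) =
      Fh (fgw z) + gen Kh - Fh (fgw z) + gen Jh - (Fh (fgw z) + gen Kh - Fh (fgw z)) - gen Jh"
    by (simp add: fgw_cmm fgw_Cons gs del: add_uminus_conv_diff)
  have "snd (runf (fgw (cmm (mF z @ [(Kh, True)] @ wi (mF z)) [(Jh, True)])) ({}, 0, 0)) = phi h D ({fgw z}, 0, 0) - phi h D ({}, 0, 0)"
    unfolding e by (simp add: rs del: add_uminus_conv_diff runf_fgw)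
  also have "\<dots> = int D" by (simp add: phi_def D_def)
  finally show ?thesis using b by (simp add: D_def)
qed

end

end

text \<open>The state counts the exponent of the free generator and each stable letter collects it:
  this is the signed area in the plane spanned by the two commuting letters, a square of side n for
  the commutator of the n-th powers.\<close>

lemma area_G_lower:
  fixes i :: 'i
  assumes "nc (RG :: ('i + 'a eg + 'a eg) wrd set) k (fgw (cmm (replicate n (Inl i, True)) (replicate n (Inr (Inl Kl), True))))"
  shows "n\<^sup>2 \<le> k"
proof -
  define p where "p = (\<lambda>(l :: 'i + 'a eg + 'a eg) (d :: int). if l = Inl i then d + 1 else d)"
  define m where "m = (\<lambda>(l :: 'i + 'a eg + 'a eg) (d :: int). if l = Inl i then d - 1 else d)"
  define wt where "wt = (\<lambda>(l :: 'i + 'a eg + 'a eg) (d :: int). if l = Inr (Inl Kl) then d else 0)"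
  interpret wact p m wt by unfold_locales (auto simp: p_def m_def)
  have [simp]: "p (Inr x) d = d" "m (Inr x) d = d" "p (Inl i) d = d + 1" "m (Inl i) d = d - 1"
    "wt (Inl j) d = 0" "wt (Inr (Inr y)) d = 0" "wt (Inr (Inl Kl)) d = d"
    "wt (Inr (Inl (Xl a))) d = 0" "wt (Inr (Inl (Yl a))) d = 0" "wt (Inr (Inl (Sl a))) d = 0" for x j y a d
    by (auto simp: p_def m_def wt_def)
  have "\<bar>wt l (p k d) - wt l d\<bar> \<le> 1" for l k d by (auto simp: p_def wt_def)
  then have "fst (run r s) = s \<and> \<bar>snd (run r s)\<bar> \<le> 1" if "r \<in> RG" for r s
    using that by (auto simp: RG_def prodR_def RE_def cmm_def)
  note wb = weight_bound[OF this assms, of 0]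
  have 1: "run (replicate n (Inl i, True)) d = (d + int n, 0)" for d n
    by (induction n arbitrary: d) auto
  have 2: "run (replicate n (Inl i, False)) d = (d - int n, 0)" for d n
    by (induction n arbitrary: d) auto
  have 3: "run (replicate n (Inr (Inl Kl), True)) d = (d, int n * d)" for d n
    by (induction n arbitrary: d) (auto simp: algebra_simps)
  have 4: "run (replicate n (Inr (Inl Kl), False)) d = (d, - int n * d)" for d n
    by (induction n arbitrary: d) (auto simp: algebra_simps)
  have w: "wi (replicate n (x, e)) = replicate n (x, \<not> e)" for x :: "'i + 'a eg + 'a eg" and e
    by (simp add: wi_def)
  have "snd (run (cmm (replicate n (Inl i, True)) (replicate n (Inr (Inl Kl), True))) 0) = int n * int n"
    by (simp add: cmm_def w run_append 1 2 3 4)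
  with wb have "int n * int n \<le> int k" by simp
  then show ?thesis by (simp add: power2_eq_square flip: of_nat_mult)
qed

section \<open>Passing to finite presentations\<close>

lemma red_eq_gred: "red w = gred w"
proof (induction w)
  case (Cons x w)
  then show ?case by (cases "gred w") (auto simp: gred_Cons)
qed simp

lemma winv_eq_wi: "winv = wi"
  by (simp add: winv_def wi_def fun_eq_iff)

lemma freely_equal_fgw: "freely_equal u v \<longleftrightarrow> fgw u = fgw v"
  by (simp add: freely_equal_def red_eq_gred fgw_eq_iff)

abbreviation restr :: "'a set \<Rightarrow> 'a wrd \<Rightarrow> 'a wrd" where "restr G \<equiv> filter (\<lambda>x. fst x \<in> G)"

lemma prod_conj_nc: "prod_conj P w m \<Longrightarrow> nc (set (snd P)) m (fgw w)"
proof -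
  have "nc (set (snd P)) (length cs) (fgw (concat cs))" if "\<forall>c\<in>set cs. conj_rel P c" for cs
    using that
  proof (induction cs)
    case (Cons c cs)
    then obtain u r where c: "c = u @ r @ winv u" "r \<in> set (snd P) \<or> winv r \<in> set (snd P)" by (auto simp: conj_rel_def)
    have n: "nc (set (snd P)) (length cs) (fgw (concat cs))" using Cons by simp
    show ?case
    proof (cases "r \<in> set (snd P)")
      case True
      from nc.ncP[OF this n, of "fgw u"] show ?thesis using c by (simp add: winv_eq_wi gs del: add_uminus_conv_diff)
    next
      case False
      then have "wi r \<in> set (snd P)" using c by (simp add: winv_eq_wi)
      from nc.ncN[OF this n, of "fgw u"] show ?thesis using c by (simp add: winv_eq_wi gs del: add_uminus_conv_diff)
    qed
  qed (simp add: nc.nc0)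
  then show "prod_conj P w m \<Longrightarrow> nc (set (snd P)) m (fgw w)"
    by (auto simp: prod_conj_def freely_equal_fgw)
qed

lemma fgw_restr: "fgw (restr G w) = lift (\<lambda>a. if a \<in> G then gen a else 0) (fgw w)"
  by (induction w) (auto simp: fgw_Cons evw_Cons)

lemma restr_id: "fst ` set w \<subseteq> G \<Longrightarrow> restr G w = w"
  by (induction w) auto

text \<open>\<open>nc\<close> ranges over the free group on all letters, so conjugators may use
  foreign ones. Erasing these is a homomorphism that fixes the relators and the word.\<close>

lemma nc_prod_conj:
  assumes "fin_pres P" "word_over (fst P) w" "nc (set (snd P)) m (fgw w)"
  shows "\<exists>m'\<le>m. prod_conj P w m'"
proof -
  let ?G = "{..<fst P}"
  let ?l = "lift (\<lambda>a. if a \<in> ?G then gen a else 0)"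
  have r: "?l (fgw r) = fgw r" if "r \<in> set (snd P)" for r
  proof -
    have "fst ` set r \<subseteq> ?G" using assms(1) that by (auto simp: fin_pres_def word_over_def)
    then show ?thesis using fgw_restr[of ?G r] restr_id[of r ?G] by (simp only:)
  qed
  have cr: "conj_rel P (u @ r @ wi u)" if "r \<in> set (snd P) \<or> wi r \<in> set (snd P)" "word_over (fst P) u" for u r
    using that by (auto simp: conj_rel_def winv_eq_wi)
  have wo: "word_over (fst P) (restr ?G u)" for u by (auto simp: word_over_def)
  from assms(3) have "\<exists>cs. length cs \<le> m \<and> (\<forall>c\<in>set cs. conj_rel P c) \<and> fgw (concat cs) = ?l (fgw w)"
  proof (induction rule: nc.induct)
    case (nc0 m) show ?case by (intro exI[of _ "[]"]) simp
  next
    case (ncP r m x g)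
    then obtain cs where cs: "length cs \<le> m" "\<forall>c\<in>set cs. conj_rel P c" "fgw (concat cs) = ?l x" by blast
    let ?u = "restr ?G (rep_fg g)"
    have "fgw ?u = ?l g" using fgw_restr[of ?G "rep_fg g"] by (simp only: fgw_rep)
    then show ?case using cs r[OF ncP(1)] cr[of r ?u] wo[of "rep_fg g"] ncP(1)
      by (intro exI[of _ "(?u @ r @ wi ?u) # cs"]) (auto simp: gs simp del: add_uminus_conv_diff lift_fgw)
  next
    case (ncN r m x g)
    then obtain cs where cs: "length cs \<le> m" "\<forall>c\<in>set cs. conj_rel P c" "fgw (concat cs) = ?l x" by blast
    let ?u = "restr ?G (rep_fg g)"
    have "fgw ?u = ?l g" using fgw_restr[of ?G "rep_fg g"] by (simp only: fgw_rep)
    then show ?case using cs r[OF ncN(1)] cr[of "wi r" ?u] wo[of "rep_fg g"] ncN(1)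
      by (intro exI[of _ "(?u @ wi r @ wi ?u) # cs"]) (auto simp: gs simp del: add_uminus_conv_diff lift_fgw)
  qed
  then obtain cs where cs: "length cs \<le> m" "\<forall>c\<in>set cs. conj_rel P c" "fgw (concat cs) = ?l (fgw w)" by blast
  have "fst ` set w \<subseteq> ?G" using assms(2) by (auto simp: word_over_def)
  then have "?l (fgw w) = fgw w" using fgw_restr[of ?G w] restr_id[of w ?G] by (simp only:)
  then have "prod_conj P w (length cs)" unfolding prod_conj_def freely_equal_fgw using cs by (intro exI[of _ cs]) simp
  then show ?thesis using cs(1) by blast
qed

text \<open>\<open>e\<close> numbers the letters in G, and for words in these letters areas over P
  agree with areas over R, which may be an infinite set over an infinite alphabet. The bound m'
  \<le> m reflects that \<open>nc\<close> is only an upper bound.\<close>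

definition presents :: "pres \<Rightarrow> ('l \<Rightarrow> nat) \<Rightarrow> 'l set \<Rightarrow> 'l wrd set \<Rightarrow> bool" where
  "presents P e G R \<longleftrightarrow> fin_pres P \<and> bij_betw e G {..<fst P} \<and>
     (\<forall>w m. fst ` set w \<subseteq> G \<longrightarrow> ((\<exists>m'\<le>m. prod_conj P (map (map_prod e id) w) m') \<longleftrightarrow> nc R m (fgw w)))"

text \<open>Killing the letters outside G sends each relator to a relator over G or to the identity.
  So the group on G is a retract, and foreign letters cannot make areas smaller.\<close>

lemma presents_exists:
  fixes G :: "'l set" and R :: "'l wrd set"
  assumes "finite G" and fR: "finite {r \<in> R. fst ` set r \<subseteq> G}"
    and restr: "\<And>r. r \<in> R \<Longrightarrow> restr G r \<in> R \<or> fgw (restr G r) = 0"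
  shows "\<exists>P e. presents P e G R"
proof -
  obtain e where e: "bij_betw e G {..<card G}" using ex_bij_betw_finite_nat[OF assms(1)] by (auto simp: atLeast0LessThan)
  define R0 where "R0 = {r \<in> R. fst ` set r \<subseteq> G}"
  obtain rs where rs: "set rs = R0" using finite_list fR R0_def by metis
  define P where "P = (card G, map (map (map_prod e id)) rs)"
  have eG: "e a < card G" if "a \<in> G" for a using e that by (auto simp: bij_betw_def)
  define d where "d = inv_into G e"
  have de: "d (e a) = a" if "a \<in> G" for a using e that by (simp add: d_def bij_betw_def)
  have fp: "fin_pres P" using rs eG by (fastforce simp: fin_pres_def P_def word_over_def R0_def)
  have map_eq: "evw (\<lambda>a. gen (d (e a))) w = fgw w" if "fst ` set w \<subseteq> G" for w
    using that by (induction w) (auto simp: evw_Cons fgw_Cons de)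
  have "(\<exists>m'\<le>m. prod_conj P (map (map_prod e id) w) m') \<longleftrightarrow> nc R m (fgw w)" if w: "fst ` set w \<subseteq> G" for w m
  proof
    assume "\<exists>m'\<le>m. prod_conj P (map (map_prod e id) w) m'"
    then obtain m' where m': "m' \<le> m" "nc (set (snd P)) m' (fgw (map (map_prod e id) w))" using prod_conj_nc by blast
    have "nc R 1 (evw (\<lambda>n. gen (d n)) r)" if rP: "r \<in> set (snd P)" for r
    proof -
      obtain r' where r': "r = map (map_prod e id) r'" "r' \<in> R0" using rP unfolding P_def rs[symmetric] by auto
      then have "evw (\<lambda>n. gen (d n)) r = fgw r'" using map_eq[of r'] by (simp add: evw_map R0_def)
      then show ?thesis using r' nc_rel[of r' R] by (simp add: R0_def)
    qed
    from nc_lift[OF this m'(2)] have "nc R m' (fgw w)" using map_eq[OF w] by (simp add: evw_map)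
    then show "nc R m (fgw w)" using m'(1) nc_mono by blast
  next
    assume n: "nc R m (fgw w)"
    let ?h = "\<lambda>a. if a \<in> G then gen (e a) else 0"
    have hm: "evw ?h r = fgw (map (map_prod e id) (restr G r))" for r
      by (induction r) (auto simp: evw_Cons fgw_Cons)
    have "nc (set (snd P)) 1 (evw ?h r)" if "r \<in> R" for r
    proof (cases "fgw (restr G r) = 0")
      case True
      have "evw ?h r = lift ?h (fgw (restr G r))" unfolding lift_fgw hm by (simp add: fgw_evw evw_map)
      then show ?thesis using True by (simp add: nc.nc0)
    next
      case False
      then have "restr G r \<in> R0" using restr[OF that] by (auto simp: R0_def)
      then have "map (map_prod e id) (restr G r) \<in> set (snd P)" using rs by (auto simp: P_def)
      from nc_rel[OF this] show ?thesis by (simp add: hm)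
    qed
    from nc_lift[OF this n] have "nc (set (snd P)) m (fgw (map (map_prod e id) w))"
      using hm[of w] restr_id[OF w] by simp
    moreover have "word_over (fst P) (map (map_prod e id) w)" using w eG by (auto simp: word_over_def P_def)
    ultimately show "\<exists>m'\<le>m. prod_conj P (map (map_prod e id) w) m'" using nc_prod_conj[OF fp] by blast
  qed
  then have "presents P e G R" using fp e by (auto simp: presents_def P_def)
  then show ?thesis by blast
qed

lemma presents_nc:
  "presents P e G R \<Longrightarrow> fst ` set w \<subseteq> G \<Longrightarrow> (\<exists>m'\<le>m. prod_conj P (map (map_prod e id) w) m') \<longleftrightarrow> nc R m (fgw w)"
  by (simp add: presents_def)

lemma presents_trivial:
  "presents P e G R \<Longrightarrow> fst ` set w \<subseteq> G \<Longrightarrow> trivial P (map (map_prod e id) w) \<longleftrightarrow> triv R (fgw w)"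
  unfolding presents_def trivial_def triv_def by (metis order_refl)

lemma area_le: "prod_conj P w m' \<Longrightarrow> m' \<le> m \<Longrightarrow> area P w \<le> m"
  unfolding area_def using Least_le order_trans by metis

lemma presents_decode:
  assumes "presents P e G R" "word_over (fst P) w"
  obtains v where "w = map (map_prod e id) v" "fst ` set v \<subseteq> G" "length v = length w"
proof -
  have e: "bij_betw e G {..<fst P}" using assms(1) by (simp add: presents_def)
  have inG: "fst x \<in> e ` G" if "x \<in> set w" for x
    using e assms(2) that by (auto simp: word_over_def bij_betw_def)
  let ?v = "map (map_prod (inv_into G e) id) w"
  have "map_prod e id (map_prod (inv_into G e) id x) = x" if "x \<in> set w" for x
    using inG[OF that] by (cases x) (auto simp: f_inv_into_f)
  then have "map (map_prod e id) ?v = w" unfolding map_map comp_def by (rule map_idI)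
  then have "w = map (map_prod e id) ?v" by simp
  moreover have "fst ` set ?v \<subseteq> G" using inG by (force intro: inv_into_into)
  ultimately show ?thesis by (rule that) simp
qed

section \<open>Upper and lower bounds for Dehn functions\<close>

lemma finite_words: "finite {w. word_over k w \<and> length w \<le> n}"
proof -
  have "{w. word_over k w \<and> length w \<le> n} \<subseteq> {w. set w \<subseteq> {..<k} \<times> UNIV \<and> length w \<le> n}"
    by (auto simp: word_over_def)
  then show ?thesis by (rule finite_subset) (intro finite_lists_length_le, simp)
qed

lemma finite_areas: "finite {area P w | w. word_over (fst P) w \<and> length w \<le> n \<and> trivial P w}"
proof -
  have "{area P w | w. word_over (fst P) w \<and> length w \<le> n \<and> trivial P w} \<subseteq> area P ` {w. word_over (fst P) w \<and> length w \<le> n}"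
    by auto
  then show ?thesis by (rule finite_subset) (intro finite_imageI finite_words)
qed

lemma dehn_le:
  assumes P: "presents P e G R" and B: "\<And>w. fst ` set w \<subseteq> G \<Longrightarrow> length w \<le> n \<Longrightarrow> triv R (fgw w) \<Longrightarrow> nc R B (fgw w)"
  shows "dehn P n \<le> B"
  unfolding dehn_def
proof (rule Max.boundedI[OF finite_areas])
  have "trivial P []" unfolding trivial_def by (rule exI[of _ 0]) (simp add: prod_conj_def freely_equal_def)
  then show "{area P w | w. word_over (fst P) w \<and> length w \<le> n \<and> trivial P w} \<noteq> {}"
    by (auto simp: word_over_def intro!: exI[of _ "[]"])
next
  fix a assume "a \<in> {area P w | w. word_over (fst P) w \<and> length w \<le> n \<and> trivial P w}"
  then obtain w where w: "a = area P w" "word_over (fst P) w" "length w \<le> n" "trivial P w" by blast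
  obtain v where v: "w = map (map_prod e id) v" "fst ` set v \<subseteq> G" "length v = length w"
    using presents_decode[OF P w(2)] by blast
  have "triv R (fgw v)" using w(4) presents_trivial[OF P v(2)] unfolding v(1) by blast
  then have "nc R B (fgw v)" using v(3) w(3) by (intro B[OF v(2)]) simp_all
  then obtain m' where "m' \<le> B" "prod_conj P w m'" using presents_nc[OF P v(2), of B] v(1) by blast
  then show "a \<le> B" using area_le w(1) by blast
qed

lemma dehn_ge:
  assumes P: "presents P e G R" and w: "fst ` set w \<subseteq> G" "length w \<le> n" "triv R (fgw w)"
    and B: "\<And>m. nc R m (fgw w) \<Longrightarrow> B \<le> m"
  shows "B \<le> dehn P n"
proof -
  let ?w = "map (map_prod e id) w"
  have t: "trivial P ?w" using presents_trivial[OF P w(1)] w(3) by simp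
  then have "prod_conj P ?w (area P ?w)" unfolding trivial_def area_def by (rule LeastI_ex)
  then have "nc R (area P ?w) (fgw w)" using presents_nc[OF P w(1)] by blast
  then have "B \<le> area P ?w" by (rule B)
  also have "word_over (fst P) ?w" using P w(1) by (auto simp: presents_def word_over_def bij_betw_def)
  then have "area P ?w \<le> dehn P n" unfolding dehn_def using t w(2) by (intro Max_ge[OF finite_areas]) auto
  finally show ?thesis .
qed

lemma restr_wi: "restr G (wi w) = wi (restr G w)"
  by (induction w) (auto simp: wi_Cons)

lemma restr_cmm: "restr G (cmm u v) = cmm (restr G u) (restr G v)"
  by (simp add: cmm_def restr_wi)

lemma wi_map: "wi (map (map_prod f id) w) = map (map_prod f id) (wi w)"
  by (induction w) (auto simp: wi_Cons)

lemma map_cmm: "map (map_prod f id) (cmm u v) = cmm (map (map_prod f id) u) (map (map_prod f id) v)"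
  by (simp add: cmm_def wi_map)

lemma fgw_cmm_0: "fgw u = 0 \<or> fgw v = 0 \<Longrightarrow> fgw (cmm u v) = 0"
  by (auto simp: fgw_cmm)

lemma set_wi: "fst ` set (wi w) = fst ` set w"
  by (auto simp: wi_def image_iff split: prod.splits) force+

lemma set_cmm: "fst ` set (cmm u v) = fst ` set u \<union> fst ` set v"
  by (simp add: cmm_def image_Un set_wi) blast

lemma RG_cases:
  assumes "r \<in> RG"
  obtains x y where "r = cmm [(x, True)] [(y, True)]"
  | a where "r = [(Inr (Inl (Sl a)), False), (Inr (Inl (Xl a)), True), (Inr (Inl (Yl a)), True)]"
  | a where "r = [(Inr (Inr (Sl a)), False), (Inr (Inr (Xl a)), True), (Inr (Inr (Yl a)), True)]"
  using assms unfolding RG_def prodR_def RE_def by (auto simp: map_cmm image_iff)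

definition egs :: "'a set \<Rightarrow> 'a eg set" where "egs A = Xl ` A \<union> Yl ` A \<union> Sl ` A \<union> {Kl}"

definition GG :: "'i set \<Rightarrow> 'a set \<Rightarrow> ('i + 'a eg + 'a eg) set" where
  "GG I A = Inl ` I \<union> (Inr \<circ> Inl) ` egs A \<union> (Inr \<circ> Inr) ` egs A"

definition GH :: "'i set \<Rightarrow> 'a set \<Rightarrow> ('i, 'a) hg set" where
  "GH I A = Tl ` I \<union> Fl ` A \<union> {Kh, Jh}"

lemma presents_G:
  fixes I :: "'i set" and A :: "'a set"
  assumes "finite I" "finite A"
  shows "\<exists>P e. presents P e (GG I A) RG"
proof (rule presents_exists)
  let ?G = "GG I A"
  show fin: "finite ?G" using assms by (simp add: GG_def egs_def)
  have "length r \<le> 4" if "r \<in> RG" for r :: "('i + 'a eg + 'a eg) wrd"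
    using that by (cases rule: RG_cases) (auto simp: cmm_def)
  moreover have "set r \<subseteq> ?G \<times> UNIV" if "fst ` set r \<subseteq> ?G" for r :: "('i + 'a eg + 'a eg) wrd" using that by force
  ultimately have "{r \<in> RG. fst ` set r \<subseteq> ?G} \<subseteq> {r. set r \<subseteq> ?G \<times> UNIV \<and> length r \<le> 4}" by blast
  then show "finite {r \<in> RG. fst ` set r \<subseteq> ?G}"
    by (rule finite_subset) (intro finite_lists_length_le finite_cartesian_product fin, simp)
  fix r :: "('i + 'a eg + 'a eg) wrd" assume r: "r \<in> RG"
  then show "restr ?G r \<in> RG \<or> fgw (restr ?G r) = 0"
  proof (cases rule: RG_cases)
    case (1 x y)
    show ?thesis
    proof (cases "x \<in> ?G \<and> y \<in> ?G")
      case True then show ?thesis using r 1 by (simp add: restr_cmm)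
    next
      case False then show ?thesis using 1 by (auto simp: restr_cmm intro!: fgw_cmm_0)
    qed
  next
    case (2 a)
    then show ?thesis using r by (cases "a \<in> A") (auto simp: GG_def egs_def image_iff)
  next
    case (3 a)
    then show ?thesis using r by (cases "a \<in> A") (auto simp: GG_def egs_def image_iff)
  qed
qed

lemma restr_mF: "restr (GH I A) (mF w) = mF (restr A w)"
  by (induction w) (auto simp: GH_def)

context hgrp
begin

text \<open>If T(i) is killed, the relator [K, T(i) c(i)] turns into [K, c(i)] with foreign letters
  erased. The last two assumptions make such leftovers trivial.\<close>

lemma presents_H:
  assumes "finite I" "finite A" "finite Rs"
    and b: "\<And>i. i \<in> I \<Longrightarrow> fst ` set (b i) \<subseteq> A" and c: "\<And>i. i \<in> I \<Longrightarrow> fst ` set (c i) \<subseteq> A"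
    and Rs: "\<And>z. z \<in> Rs \<Longrightarrow> fst ` set z \<subseteq> A"
    and b0: "\<And>i. i \<notin> I \<Longrightarrow> fgw (restr A (b i)) = 0" and c0: "\<And>i. i \<notin> I \<Longrightarrow> fgw (restr A (c i)) = 0"
  shows "\<exists>P e. presents P e (GH I A) H"
proof (rule presents_exists)
  let ?G = "GH I A"
  show fin: "finite ?G" using assms by (simp add: GH_def)
  have "{r \<in> H. fst ` set r \<subseteq> ?G} \<subseteq> (\<lambda>(i, a). cmm [(Tl i, True)] [(Fl a, True)]) ` (I \<times> A)
     \<union> (\<lambda>i. cmm [(Kh, True)] ((Tl i, True) # mF (c i))) ` I
     \<union> (\<lambda>i. cmm [(Jh, True)] ((Tl i, True) # mF (b i))) ` I
     \<union> (\<lambda>z. cmm (mF z @ [(Kh, True)] @ wi (mF z)) [(Jh, True)]) ` Rs"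
    by (auto simp: RH_def set_cmm GH_def image_iff)
  then show "finite {r \<in> H. fst ` set r \<subseteq> ?G}"
    by (rule finite_subset) (intro finite_UnI finite_imageI finite_cartesian_product assms(1-3))
  have [simp]: "Tl i \<in> ?G \<longleftrightarrow> i \<in> I" "Fl a \<in> ?G \<longleftrightarrow> a \<in> A" "Kh \<in> ?G" "Jh \<in> ?G" for i a
    by (auto simp: GH_def)
  fix r assume r: "r \<in> H"
  show "restr ?G r \<in> H \<or> fgw (restr ?G r) = 0"
    using r[unfolded RH_def]
  proof (elim UnE CollectE exE conjE)
    fix i a assume 1: "r = cmm [(Tl i, True)] [(Fl a, True)]"
    then show ?thesis using r by (cases "i \<in> I"; cases "a \<in> A") (auto simp: restr_cmm intro!: fgw_cmm_0)
  next
    fix i assume 1: "r = cmm [(Kh, True)] ((Tl i, True) # mF (c i))"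
    then show ?thesis using r c[of i] c0[of i]
      by (cases "i \<in> I") (auto simp: restr_cmm restr_mF restr_id intro!: fgw_cmm_0)
  next
    fix i assume 1: "r = cmm [(Jh, True)] ((Tl i, True) # mF (b i))"
    then show ?thesis using r b[of i] b0[of i]
      by (cases "i \<in> I") (auto simp: restr_cmm restr_mF restr_id intro!: fgw_cmm_0)
  next
    fix z assume 1: "r = cmm (mF z @ [(Kh, True)] @ wi (mF z)) [(Jh, True)]" and "z \<in> Rs"
    then show ?thesis using r Rs[of z] by (auto simp: restr_cmm restr_wi restr_mF restr_id)
  qed
qed

end

lemma subst_map: "subst (\<lambda>n. map (map_prod e id) (P n)) (map (map_prod f id) v) =
  map (map_prod e id) (concat (map (\<lambda>(l, s). if s then P (f l) else wi (P (f l))) v))"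
  by (induction v) (auto simp: subst_def winv_eq_wi wi_map[unfolded id_def] id_def)

text \<open>A function \<open>h\<close> that vanishes on Rs and changes by at most one along moves
  bounds the number of moves to Rs from below, and thereby the area. The length of [z K z^-1, J] is
  4 |z| + 4.\<close>

theorem group_theorem:
  fixes b c :: "'i \<Rightarrow> 'a wrd" and Rs :: "'a wrd set" and I :: "'i set" and A :: "'a set" and h :: "'a fg \<Rightarrow> nat"
  assumes fin: "finite I" "I \<noteq> {}" "finite A" "finite Rs"
    and b: "\<And>i. i \<in> I \<Longrightarrow> fst ` set (b i) \<subseteq> A" and c: "\<And>i. i \<in> I \<Longrightarrow> fst ` set (c i) \<subseteq> A"
    and Rs: "\<And>z. z \<in> Rs \<Longrightarrow> fst ` set z \<subseteq> A"
    and b0: "\<And>i. i \<notin> I \<Longrightarrow> fgw (restr A (b i)) = 0" and c0: "\<And>i. i \<notin> I \<Longrightarrow> fgw (restr A (c i)) = 0"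
    and conn: "\<And>z. \<exists>z'\<in>Rs. conn b c z (fgw z')"
    and lip: "\<And>i z. h (fgw (b i) + z - fgw (c i)) \<le> Suc (h z)" "\<And>i z. h z \<le> Suc (h (fgw (b i) + z - fgw (c i)))"
    and h0: "\<And>r. r \<in> Rs \<Longrightarrow> h (fgw r) = 0"
  shows "\<exists>PG PH \<phi>. fin_pres PG \<and> fin_pres PH \<and> subgroup_emb PH PG \<phi> \<and> dehn PG \<simeq> (\<lambda>n. n ^ 2)
    \<and> (\<forall>z n. fst ` set z \<subseteq> A \<longrightarrow> 4 * length z + 4 \<le> n \<longrightarrow> h (fgw z) \<le> dehn PH n)"
proof -
  interpret hgrp b c Rs .
  obtain PG eG where G: "presents PG eG (GG I A) (RG :: ('i + 'a eg + 'a eg) wrd set)"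
    using presents_G[OF fin(1,3)] by blast
  obtain PH eH where H: "presents PH eH (GH I A) H"
    using presents_H[OF fin(1,3,4) b c Rs b0 c0] by blast
  define dH where "dH = inv_into (GH I A) eH"
  define \<phi> where "\<phi> = (\<lambda>n. map (map_prod eG id) (Phw b c (dH n)))"
  have eH: "bij_betw eH (GH I A) {..<fst PH}" and eG: "bij_betw eG (GG I A) {..<fst PG}"
    using H G by (auto simp: presents_def)
  have dH: "dH (eH l) = l" if "l \<in> GH I A" for l using eH that by (simp add: dH_def bij_betw_def)
  have PhG: "fst ` set (Phw b c l) \<subseteq> GG I A" if "l \<in> GH I A" for l
    using that b c by (auto simp: GH_def GG_def egs_def image_iff) (force simp: subset_eq)+
  have "subgroup_emb PH PG \<phi>"
    unfolding subgroup_emb_def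
  proof (intro conjI allI impI)
    fix a assume "a < fst PH"
    then have "dH a \<in> GH I A" using eH unfolding dH_def by (intro inv_into_into) (auto simp: bij_betw_def)
    then show "word_over (fst PG) (\<phi> a)" using PhG[of "dH a"] eG by (fastforce simp: \<phi>_def word_over_def bij_betw_def)
  next
    fix w assume "word_over (fst PH) w"
    then obtain v where v: "w = map (map_prod eH id) v" "fst ` set v \<subseteq> GH I A" using presents_decode[OF H] by metis
    define W where "W = concat (map (\<lambda>(l, s). if s then Phw b c (dH (eH l)) else wi (Phw b c (dH (eH l)))) v)"
    have 1: "subst \<phi> w = map (map_prod eG id) W" unfolding v(1) \<phi>_def W_def by (rule subst_map)
    have 2: "fst ` set W \<subseteq> GG I A \<and> fgw W = lift (\<lambda>l. fgw (Phw b c l)) (fgw v)"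
      unfolding W_def using v(2)
    proof (induction v)
      case (Cons x v)
      obtain l s where x: "x = (l, s)" by force
      then have l: "l \<in> GH I A" using Cons.prems by auto
      show ?case using Cons x PhG[OF l] dH[OF l] by (auto simp: image_Un set_wi evw_Cons)
    qed simp
    have "trivial PH w \<longleftrightarrow> triv H (fgw v)" unfolding v(1) by (rule presents_trivial[OF H v(2)])
    also have "\<dots> \<longleftrightarrow> triv RG (fgw W)" using embed_iff[OF conn, of "fgw v"] 2 by simp
    also have "\<dots> \<longleftrightarrow> trivial PG (subst \<phi> w)" unfolding 1 using presents_trivial[OF G] 2 by blast
    finally show "trivial PH w \<longleftrightarrow> trivial PG (subst \<phi> w)" .
  qed
  moreover have "dehn PG \<simeq> (\<lambda>n. n ^ 2)"
    unfolding fequiv_def preceq_def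
  proof (intro conjI)
    have 1: "dehn PG n \<le> 12 * n\<^sup>2" for n
    proof (rule dehn_le[OF G])
      fix w :: "('i + 'a eg + 'a eg) wrd" assume "length w \<le> n" "triv RG (fgw w)"
      then show "nc RG (12 * n\<^sup>2) (fgw w)"
        using nc_mono[of RG "12 * (length w)\<^sup>2" "fgw w" "12 * n\<^sup>2"] qb_G by (auto simp: qb_def power_mono)
    qed
    have "12 * n\<^sup>2 \<le> 12 * (12 * n)\<^sup>2 + 12 * n" for n :: nat by (simp add: power_mult_distrib)
    then have "dehn PG n \<le> 12 * (12 * n)\<^sup>2 + 12 * n" for n by (rule order_trans[OF 1])
    then show "\<exists>c>0. \<forall>n\<ge>1. dehn PG n \<le> c * (c * n)\<^sup>2 + c * n"
      by (intro exI[of _ 12] conjI allI impI) simp_all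
    obtain i where i: "i \<in> I" using fin(2) by blast
    have 2: "n\<^sup>2 \<le> dehn PG (4 * n)" for n
    proof (rule dehn_ge[OF G])
      let ?u = "replicate n (Inl i, True) :: ('i + 'a eg + 'a eg) wrd"
      let ?v = "replicate n (Inr (Inl Kl), True) :: ('i + 'a eg + 'a eg) wrd"
      show "fst ` set (cmm ?u ?v) \<subseteq> GG I A" using i by (auto simp: set_cmm GG_def egs_def)
      show "length (cmm ?u ?v) \<le> 4 * n" by (simp add: cmm_def)
      have "prr (fgw ?u) = 0" "prl (fgw ?v) = 0" by (induction n) (auto simp: fgw_Cons)
      then show "triv RG (fgw (cmm ?u ?v))" by (simp add: RG_def triv_prod fgw_cmm)
      show "nc RG m (fgw (cmm ?u ?v)) \<Longrightarrow> n\<^sup>2 \<le> m" for m by (rule area_G_lower)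
    qed
    have "n\<^sup>2 \<le> 4 * dehn PG (4 * n) + 4 * n" for n using 2[of n] by simp
    then show "\<exists>c>0. \<forall>n\<ge>1. n\<^sup>2 \<le> c * dehn PG (c * n) + c * n"
      by (intro exI[of _ 4] conjI allI impI) simp_all
  qed
  moreover have "h (fgw z) \<le> dehn PH n" if z: "fst ` set z \<subseteq> A" "4 * length z + 4 \<le> n" for z n
  proof (rule dehn_ge[OF H])
    let ?w = "cmm (mF z @ [(Kh, True)] @ wi (mF z)) [(Jh, True)] :: ('i, 'a) hg wrd"
    show "fst ` set ?w \<subseteq> GH I A" using z(1) by (auto simp: set_cmm set_wi image_Un GH_def)
    show "length ?w \<le> n" using z(2) by (simp add: cmm_def)
    have "fgw ?w = Fh (fgw z) + gen Kh - Fh (fgw z) + gen Jh - (Fh (fgw z) + gen Kh - Fh (fgw z)) - gen Jh"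
      by (simp add: fgw_cmm fgw_Cons gs del: add_uminus_conv_diff)
    then show "triv H (fgw ?w)" using comKJ0[OF conn, of "fgw z"] by (simp add: com_triv)
    show "nc H m (fgw ?w) \<Longrightarrow> h (fgw z) \<le> m" for m by (rule area_H_lower[OF lip h0])
  qed
  moreover have "fin_pres PG" "fin_pres PH" using G H by (simp_all add: presents_def)
  ultimately show ?thesis by (intro exI[of _ PG] exI[of _ PH] exI[of _ \<phi>]) blast
qed

section \<open>Queue automata whose letters permute the states\<close>

lemma gred_append_reduced:
  assumes "reduced s" "reduced t"
  shows "\<exists>s1 s2 t2. s = s1 @ s2 \<and> t = wi s2 @ t2 \<and> gred (s @ t) = s1 @ t2"
  using assms
proof (induction s arbitrary: t rule: rev_induct)
  case Nil then show ?case by (simp add: gred_reduced)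
next
  case (snoc y s)
  show ?case
  proof (cases "t \<noteq> [] \<and> hd t = (fst y, \<not> snd y)")
    case True
    then obtain t' where t: "t = (fst y, \<not> snd y) # t'" by (cases t) auto
    obtain s1 s2 t2 where IH: "s = s1 @ s2" "t' = wi s2 @ t2" "gred (s @ t') = s1 @ t2"
      using snoc.IH[of t'] snoc.prems t reduced_appendD[of s "[y]"] reduced_tl by blast
    have "gred ([y] @ (fst y, \<not> snd y) # t') = gred t'" by (simp add: gred_Cons rcons_cancel)
    then have "gred ((s @ [y]) @ t) = gred (s @ t')" unfolding t by (metis append_assoc gred_append_right)
    then show ?thesis using IH t by (intro exI[of _ s1] exI[of _ "s2 @ [y]"] exI[of _ t2]) simp
  next
    case False
    then have "reduced ((s @ [y]) @ t)"
      using snoc.prems by (rule_tac reduced_appendI) (auto simp: prod_eq_iff)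
    then show ?thesis by (intro exI[of _ "s @ [y]"] exI[of _ "[]"] exI[of _ t]) (simp add: gred_reduced)
  qed
qed

text \<open>A first letter other than that of s is exposed only if s cancels completely, and then it
  comes from t. This is applied to an output t that does not contain the letter just read.\<close>

lemma hd_gred_append:
  assumes "reduced s" "gred (s @ t) = x # u"
  shows "(s \<noteq> [] \<and> hd s = x) \<or> x \<in> set t"
proof -
  obtain s1 s2 t2 where *: "s = s1 @ s2" "gred t = wi s2 @ t2" "gred (s @ gred t) = s1 @ t2"
    using gred_append_reduced[OF assms(1) reduced_gred[of t]] by blast
  then have e: "s1 @ t2 = x # u" using assms(2) by (metis gred_append_right)
  show ?thesis
  proof (cases s1)
    case Nil
    then have "x \<in> set (gred t)" using * e by auto
    then show ?thesis using set_gred by blast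
  next
    case (Cons y ys) then show ?thesis using e *(1) by simp
  qed
qed

text \<open>The configuration with state q and queue w is the element Kp^q w.\<close>

datatype 'b kl = Kp | La 'b

definition mL :: "'b wrd \<Rightarrow> 'b kl wrd" where "mL w = map (\<lambda>(a, e). (La a, e)) w"
abbreviation mp :: "'b list \<Rightarrow> 'b wrd" where "mp \<equiv> map (\<lambda>a. (a, True))"

lemma mL_simps [simp]: "mL [] = []" "mL (u @ v) = mL u @ mL v" "mL ((a, e) # w) = (La a, e) # mL w"
  "length (mL w) = length w"
  by (auto simp: mL_def split: prod.splits)

lemma mL_wi [simp]: "mL (wi w) = wi (mL w)"
  by (induction w) (auto simp: mL_def wi_Cons)

lemma set_mL: "set (mL w) = (\<lambda>(a, e). (La a, e)) ` set w"
  by (simp add: mL_def)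

section \<open>Integer powers of the state letter\<close>

definition kw' :: "nat \<Rightarrow> 'b kl wrd" where "kw' n = replicate n (Kp, True)"
definition kp :: "int \<Rightarrow> 'b kl fg" where "kp j = fgw (replicate (nat \<bar>j\<bar>) (Kp, 0 \<le> j))"

lemma fgw_kw: "fgw (kw' n) = kp (int n)"
  by (simp add: kw'_def kp_def)

lemma fgw_wi_kw: "- fgw (kw' n) = (kp (- int n) :: 'a kl fg)"
proof -
  have "wi (replicate n (Kp :: 'a kl, True)) = replicate n (Kp, False)" by (simp add: wi_def)
  then have "- fgw (kw' n :: 'a kl wrd) = fgw (replicate n (Kp, False))" by (simp add: kw'_def flip: fgw_wi)
  then show ?thesis by (cases "n = 0") (simp_all add: kp_def)
qed

lemma kp_diff: "kp (int a - int b) = fgw (kw' a) - (fgw (kw' b) :: 'b kl fg)"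
proof -
  have add: "fgw (kw' (x + y)) = fgw (kw' x) + (fgw (kw' y) :: 'b kl fg)" for x y by (simp add: kw'_def replicate_add)
  show ?thesis
  proof (cases "b \<le> a")
    case True
    then have "fgw (kw' a) = fgw (kw' (a - b)) + (fgw (kw' b) :: 'b kl fg)" by (simp flip: add)
    moreover have "kp (int a - int b) = (fgw (kw' (a - b)) :: 'b kl fg)" using True by (simp add: fgw_kw of_nat_diff)
    ultimately show ?thesis by (simp add: eq_diff_eq)
  next
    case False
    then have "fgw (kw' b) = fgw (kw' (b - a)) + (fgw (kw' a) :: 'b kl fg)" by (simp flip: add)
    then have "fgw (kw' a) - fgw (kw' b) = - (fgw (kw' (b - a)) :: 'b kl fg)" by (simp add: gs del: add_uminus_conv_diff)
    then show ?thesis using False by (simp add: fgw_wi_kw of_nat_diff)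
  qed
qed

lemma kp_add: "kp (i + j) = kp i + (kp j :: 'b kl fg)"
proof -
  have add: "fgw (kw' (x + y)) = fgw (kw' x) + (fgw (kw' y) :: 'b kl fg)" for x y by (simp add: kw'_def replicate_add)
  obtain a b where i: "i = int a - int b" using int_diff_cases by blast
  obtain d e where j: "j = int d - int e" using int_diff_cases by blast
  have "fgw (kw' (d + b)) = (fgw (kw' (b + d)) :: 'b kl fg)" by (simp add: add.commute)
  then have "fgw (kw' d) = - fgw (kw' b) + fgw (kw' d) + (fgw (kw' b) :: 'b kl fg)"
    unfolding add by (metis add.assoc minus_add_cancel)
  then have c: "fgw (kw' d) - fgw (kw' b) = - fgw (kw' b) + (fgw (kw' d) :: 'b kl fg)"
    by (metis add_diff_cancel)
  have "kp (i + j) = (kp (int (a + d) - int (e + b)) :: 'b kl fg)" by (simp add: i j algebra_simps)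
  also have "\<dots> = fgw (kw' a) + (fgw (kw' d) - fgw (kw' b)) - fgw (kw' e)"
    unfolding kp_diff add by (simp add: gs del: add_uminus_conv_diff)
  also have "\<dots> = kp i + kp j" unfolding c i j kp_diff by (simp add: gs del: add_uminus_conv_diff)
  finally show ?thesis .
qed

lemma kp_0 [simp]: "kp 0 = 0" by (simp add: kp_def)
lemma kp_minus: "kp (- j) = - (kp j :: 'b kl fg)"
  using kp_add[of "- j" j, where 'b = 'b] by (simp add: eq_neg_iff_add_eq_0)
lemma kp_1: "kp 1 = gen Kp" by (simp add: kp_def)

fun kd :: "'b kl wrd \<Rightarrow> int \<times> 'b kl wrd" where
  "kd ((Kp, e) # w) = ((if e then 1 else - 1) + fst (kd w), snd (kd w))"
| "kd w = (0, w)"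

definition nok :: "'b kl wrd \<Rightarrow> bool" where "nok r \<longleftrightarrow> reduced r \<and> (r = [] \<or> fst (hd r) \<noteq> Kp)"

lemma reduced_replicate: "reduced (replicate n x)"
proof (induction n)
  case (Suc n) then show ?case by (cases n) (auto simp: reduced_Cons2)
qed simp

lemma kd_nok: "nok r \<Longrightarrow> kd r = (0, r)"
  by (cases r rule: kd.cases) (auto simp: nok_def)

lemma kd_kp: "nok r \<Longrightarrow> kd (rep_fg (kp j + fgw r)) = (j, r)"
proof -
  assume r: "nok r"
  have "kd (replicate n (Kp, e) @ r) = ((if e then int n else - int n), r)" for n e
    by (induction n) (auto simp: kd_nok[OF r])
  note 1 = this[of "nat \<bar>j\<bar>" "0 \<le> j"]
  have "reduced (replicate n (Kp, e) @ r)" for n e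
    using r by (rule_tac reduced_appendI) (auto simp: nok_def reduced_replicate)
  then have "rep_fg (kp j + fgw r) = replicate (nat \<bar>j\<bar>) (Kp, 0 \<le> j) @ r"
    unfolding kp_def fgw_append[symmetric] rep_fgw by (rule gred_reduced)
  then show ?thesis using 1 by auto
qed

lemma kd_cases: obtains j r where "g = kp j + fgw r" "nok r" "kd (rep_fg g) = (j, r)"
proof -
  have "\<exists>j r. w = w \<and> fgw w = kp j + fgw r \<and> nok r" if "reduced w" for w :: "'a kl wrd"
    using that
  proof (induction w)
    case (Cons x w)
    obtain j r where jr: "fgw w = kp j + fgw r" "nok r" using Cons reduced_tl by blast
    obtain l e where x: "x = (l, e)" by force
    show ?case
    proof (cases l)
      case Kp
      have "fgw (x # w) = kp ((if e then 1 else - 1) + j) + fgw r"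
        using x Kp jr by (auto simp: fgw_Cons kp_add kp_1 kp_minus add.assoc)
      then show ?thesis using jr by blast
    next
      case (La a)
      then have "nok (x # w)" using Cons.prems x by (simp add: nok_def)
      then show ?thesis by (intro exI[of _ 0] exI[of _ "x # w"]) simp
    qed
  qed (auto simp: nok_def intro!: exI[of _ 0] exI[of _ "[]"])
  from this[OF reduced_rep[of g]] obtain j r where "g = kp j + fgw r" "nok r" by auto
  then show ?thesis using that kd_kp by metis
qed

text \<open>Reading a in state q removes it from the front of the queue, changes the state to
  \<open>nx a q\<close> and appends \<open>out a q\<close>. As \<open>nx a\<close> permutes the
  states with inverse \<open>pv a\<close>, reading the inverse of a in state q can undo the reading
  of a in state \<open>pv a q\<close>. Letters outside the finite alphabet \<open>Bs\<close> keep
  the state and output nothing.\<close>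

locale qaut =
  fixes m :: nat and nx pv :: "'b \<Rightarrow> nat \<Rightarrow> nat" and out :: "'b \<Rightarrow> nat \<Rightarrow> 'b list" and Bs :: "'b set"
  assumes m: "0 < m"
    and nx: "q < m \<Longrightarrow> nx a q < m" and pv: "q < m \<Longrightarrow> pv a q < m"
    and pv_nx: "q < m \<Longrightarrow> pv a (nx a q) = q" and nx_pv: "q < m \<Longrightarrow> nx a (pv a q) = q"
    and out: "q < m \<Longrightarrow> a \<notin> set (out a q)"
    and Bs: "finite Bs" "a \<in> Bs \<Longrightarrow> q < m \<Longrightarrow> set (out a q) \<subseteq> Bs"
    and nBs: "a \<notin> Bs \<Longrightarrow> q < m \<Longrightarrow> nx a q = q" "a \<notin> Bs \<Longrightarrow> q < m \<Longrightarrow> out a q = []"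
begin

fun st :: "nat \<Rightarrow> 'b \<times> bool \<Rightarrow> nat" where "st q (a, e) = (if e then nx a q else pv a q)"
fun ot :: "nat \<Rightarrow> 'b \<times> bool \<Rightarrow> 'b wrd" where "ot q (a, e) = (if e then mp (out a q) else wi (mp (out a (pv a q))))"

lemma st_less: "q < m \<Longrightarrow> st q x < m" by (cases x) (auto simp: nx pv)

text \<open>The move of index \<open>Some (q, a)\<close> sends k^q a w to k^(nx a q) w out(a, q),
  and the move of index \<open>None\<close> multiplies by k^m, which reduces exponents of k modulo
  m. For q out of range the move is the identity.\<close>

definition mb :: "(nat \<times> 'b) option \<Rightarrow> 'b kl wrd" where
  "mb i = (case i of None \<Rightarrow> kw' m | Some (q, a) \<Rightarrow> if q < m then kw' (nx a q) @ [(La a, False)] @ wi (kw' q) else [])"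
definition mc :: "(nat \<times> 'b) option \<Rightarrow> 'b kl wrd" where
  "mc i = (case i of None \<Rightarrow> [] | Some (q, a) \<Rightarrow> if q < m then wi (mL (mp (out a q))) else [])"

definition Rq :: "'b kl wrd set" where "Rq = kw' ` {..<m}"

abbreviation cfg :: "nat \<Rightarrow> 'b wrd \<Rightarrow> 'b kl fg" where "cfg q w \<equiv> kp (int q) + fgw (mL w)"

text \<open>The letter a^-1 in state q is read by the move of a in state \<open>pv a q\<close>,
  taken backwards. The middle part g is arbitrary, as moves only touch the two ends.\<close>

lemma conn_letter:
  assumes "q < m" "conn mb mc (kp (int (st q x)) + g + fgw (mL (ot q x))) z"
  shows "conn mb mc (kp (int q) + fgw (mL [x]) + g) z"
proof -
  obtain a e where x: "x = (a, e)" by force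
  show ?thesis
  proof (cases e)
    case True
    have "fgw (mb (Some (q, a))) + (kp (int q) + fgw (mL [x]) + g) - fgw (mc (Some (q, a)))
        = kp (int (st q x)) + g + fgw (mL (ot q x))"
      using x True assms(1)
      by (simp add: mb_def mc_def fgw_kw fgw_Cons gs del: add_uminus_conv_diff)
    then show ?thesis using conn_fwd[of mb mc "Some (q, a)"] assms(2) by metis
  next
    case False
    let ?z = "kp (int (st q x)) + g + fgw (mL (ot q x))"
    have "fgw (mb (Some (pv a q, a))) + ?z - fgw (mc (Some (pv a q, a))) = kp (int q) + fgw (mL [x]) + g"
      using x False assms(1) pv[OF assms(1)] nx_pv[OF assms(1)]
      by (simp add: mb_def mc_def fgw_kw fgw_Cons gs del: add_uminus_conv_diff)
    then show ?thesis using conn_bwd[OF assms(2), of "Some (pv a q, a)"] by simp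
  qed
qed

inductive qsteps :: "nat \<Rightarrow> 'b wrd \<Rightarrow> nat \<Rightarrow> 'b wrd \<Rightarrow> bool" where
  qs_refl: "qsteps q w q w"
| qs_step: "qsteps (st q x) (w @ ot q x) q' w' \<Longrightarrow> qsteps q (x # w) q' w'"

lemma qsteps_conn: "qsteps q w q' w' \<Longrightarrow> q < m \<Longrightarrow> conn mb mc (cfg q' w') z \<Longrightarrow> conn mb mc (cfg q w) z"
proof (induction rule: qsteps.induct)
  case (qs_step q x w q' w')
  have "conn mb mc (cfg (st q x) (w @ ot q x)) z" using qs_step st_less by blast
  then show ?case using conn_letter[OF qs_step.prems(1), of x "fgw (mL w)" z]
    by (cases x) (simp add: fgw_Cons add.assoc)
qed simp

text \<open>In an arbitrary element the state letter may occur anywhere. Its word u is read letter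
  by letter: outputs are collected in the queue v behind it, and a state letter that comes to the
  front is absorbed by the state, modulo m. What is left is a genuine configuration.\<close>

lemma conn_all:
  assumes tm: "\<And>q w. q < m \<Longrightarrow> \<exists>q'. q' < m \<and> qsteps q w q' []"
  shows "\<exists>z'\<in>Rq. conn mb mc z (fgw z')"
proof -
  have base: "\<exists>z'\<in>Rq. conn mb mc (cfg q w) (fgw z')" if q: "q < m" for q w
  proof -
    obtain q' where "q' < m" "qsteps q w q' []" using tm[OF q] by blast
    then show ?thesis using qsteps_conn[OF _ q, of w q' "[]" "fgw (kw' q')"]
      by (intro bexI[of _ "kw' q'"]) (auto simp: Rq_def fgw_kw conn_refl)
  qed
  have "\<exists>z'\<in>Rq. conn mb mc (kp (int q) + fgw u + fgw (mL v)) (fgw z')" if "q < m" for q u v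
    using that
  proof (induction u arbitrary: q v)
    case Nil then show ?case using base by simp
  next
    case (Cons x u)
    obtain l e where x: "x = (l, e)" by force
    show ?case
    proof (cases l)
      case (La a)
      obtain z' where z': "z' \<in> Rq" "conn mb mc (kp (int (st q (a, e))) + fgw u + fgw (mL (v @ ot q (a, e)))) (fgw z')"
        using Cons.IH[OF st_less[OF Cons.prems]] by blast
      then have "conn mb mc (kp (int q) + fgw (mL [(a, e)]) + (fgw u + fgw (mL v))) (fgw z')"
        by (intro conn_letter[OF Cons.prems]) (simp add: add.assoc)
      then show ?thesis using z'(1) x La by (intro bexI[of _ z']) (auto simp: fgw_Cons add.assoc)
    next
      case Kp
      let ?g = "fgw u + fgw (mL v)"
      have N: "fgw (mb None) + z - fgw (mc None) = kp (int m) + z" for z by (simp add: mb_def mc_def fgw_kw)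
      show ?thesis
      proof (cases e)
        case True
        have e: "kp (int q) + fgw (x # u) + fgw (mL v) = kp (int (Suc q)) + ?g"
          using x Kp True kp_add[of "int q" 1, where 'b = 'b] by (simp add: fgw_Cons kp_1 add.assoc add.commute[of 1])
        show ?thesis
        proof (cases "Suc q < m")
          case True then show ?thesis using Cons.IH[OF True, of v] e by (simp add: add.assoc)
        next
          case False
          then have "Suc q = m" using Cons.prems by simp
          moreover obtain z' where "z' \<in> Rq" "conn mb mc (kp (int 0) + fgw u + fgw (mL v)) (fgw z')"
            using Cons.IH[OF m] by blast
          ultimately show ?thesis using conn_bwd[of mb mc "kp (int 0) + fgw u + fgw (mL v)" "fgw z'" None] e N by auto
        qed
      next
        case False
        have e: "kp (int q) + fgw (x # u) + fgw (mL v) = kp (int q - 1) + ?g"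
          using x Kp False kp_add[of "int q" "- 1", where 'b = 'b] by (simp add: fgw_Cons kp_1 kp_minus gs del: add_uminus_conv_diff)
        show ?thesis
        proof (cases q)
          case (Suc p)
          then show ?thesis using Cons.IH[of p v] Cons.prems e by (simp add: add.assoc)
        next
          case 0
          obtain z' where z': "z' \<in> Rq" "conn mb mc (kp (int (m - 1)) + fgw u + fgw (mL v)) (fgw z')"
            using Cons.IH[of "m - 1" v] m by auto
          have "kp (int m) + (kp (int q - 1) + ?g) = kp (int (m - 1)) + fgw u + fgw (mL v)"
            using 0 m kp_add[of "int m" "- 1", where 'b = 'b] by (simp add: add.assoc[symmetric] of_nat_diff)
          then show ?thesis using conn_fwd[of mb mc None "kp (int q - 1) + ?g" "fgw z'"] z' e N by auto
        qed
      qed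
    qed
  qed
  from this[OF m, of "rep_fg z" "[]"] show ?thesis by simp
qed

text \<open>One step of the automaton, extended to all of F: an exponent out of range is moved
  towards the range from 0 to m - 1, and otherwise the first letter of the queue is read. Empty
  queues are left fixed.\<close>

definition Phi :: "'b kl fg \<Rightarrow> 'b kl fg" where
  "Phi g = (let (j, r) = kd (rep_fg g) in
     if j < 0 then kp (int m) + g else if int m \<le> j then - kp (int m) + g
     else case r of (La a, e) # w \<Rightarrow> kp (int (st (nat j) (a, e))) + fgw w + fgw (mL (ot (nat j) (a, e))) | _ \<Rightarrow> g)"

definition RR :: "'b kl fg set" where "RR = fgw ` Rq"

lemma Phi_form:
  assumes "nok r"
  shows "j < 0 \<Longrightarrow> Phi (kp j + fgw r) = kp (int m) + (kp j + fgw r)"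
    and "int m \<le> j \<Longrightarrow> Phi (kp j + fgw r) = - kp (int m) + (kp j + fgw r)"
    and "q < m \<Longrightarrow> r = (La a, e) # w \<Longrightarrow> Phi (kp (int q) + fgw r) = kp (int (st q (a, e))) + fgw w + fgw (mL (ot q (a, e)))"
    and "q < m \<Longrightarrow> r = [] \<Longrightarrow> Phi (kp (int q) + fgw r) = kp (int q) + fgw r"
  using kd_kp[OF assms] unfolding Phi_def by simp_all

lemma RR_iff: "nok r \<Longrightarrow> kp j + fgw r \<in> RR \<longleftrightarrow> 0 \<le> j \<and> j < int m \<and> r = []"
proof
  assume r: "nok r" and "kp j + fgw r \<in> RR"
  then obtain q where q: "q < m" "kp j + fgw r = kp (int q) + fgw []" by (auto simp: RR_def Rq_def fgw_kw)
  have "kd (rep_fg (kp (int q) + fgw ([] :: 'b kl wrd))) = (int q, [])" by (rule kd_kp) (simp add: nok_def)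
  then show "0 \<le> j \<and> j < int m \<and> r = []" using kd_kp[OF r, of j] q by simp
next
  assume "nok r" "0 \<le> j \<and> j < int m \<and> r = []"
  then show "kp j + fgw r \<in> RR" by (auto simp: RR_def Rq_def fgw_kw image_iff intro!: bexI[of _ "nat j"])
qed

lemma Phi_RR: "g \<in> RR \<Longrightarrow> Phi g = g"
proof -
  assume g: "g \<in> RR"
  obtain j r where "g = kp j + fgw r" "nok r" by (rule kd_cases)
  then show ?thesis using g RR_iff[of r j] Phi_form(4)[of r "nat j"] by auto
qed

text \<open>As a letter does not occur in the word that replaces it, every move is a step of the automaton, forwards or
  backwards: the graph of moves is the graph of a function.\<close>

lemma functional:
  defines "mv \<equiv> \<lambda>i z. fgw (mb i) + z - fgw (mc i)"
  shows "mv i z = Phi z \<or> Phi (mv i z) = z \<or> mv i z = z"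
proof -
  obtain j r where z: "z = kp j + fgw r" and r: "nok r" by (rule kd_cases)
  show ?thesis
  proof (cases i)
    case None
    have mv: "mv i z = kp (int m) + z" by (simp add: mv_def None mb_def mc_def fgw_kw)
    show ?thesis
    proof (cases "j < 0")
      case True
      then have "mv i z = Phi z" using mv Phi_form(1)[OF r True] z by metis
      then show ?thesis by simp
    next
      case False
      have "mv i z = kp (int m + j) + fgw r" unfolding mv by (simp add: z kp_add add.assoc)
      then show ?thesis using Phi_form(2)[OF r, of "int m + j"] False by (simp add: z kp_add add.assoc)
    qed
  next
    case (Some qa)
    obtain q a where qa: "qa = (q, a)" by force
    show ?thesis
    proof (cases "q < m")
      case False then show ?thesis by (simp add: mv_def Some qa mb_def mc_def)
    next
      case q: True
      let ?o = "mL (mp (out a q))"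
      have mv: "mv i z = kp (int (nx a q)) + - gen (La a) + (- kp (int q) + z + fgw ?o)"
        using q by (simp add: mv_def Some qa mb_def mc_def fgw_kw fgw_Cons gs del: add_uminus_conv_diff)
      show ?thesis
      proof (cases "j = int q \<and> (\<exists>r'. r = (La a, True) # r')")
        case True
        then obtain r' where r': "r = (La a, True) # r'" by blast
        have "Phi z = kp (int (nx a q)) + fgw r' + fgw ?o" using Phi_form(3)[OF r q r'] True z by simp
        moreover have "mv i z = kp (int (nx a q)) + fgw r' + fgw ?o"
          unfolding mv unfolding z using True r' by (simp add: fgw_Cons gs del: add_uminus_conv_diff)
        ultimately show ?thesis by simp
      next
        case False
        \<comment> \<open>s is the reduced word of k^-q z, and it does not begin with a. Since a
          does not occur in the output either, a^-1 stays uncancelled in front of what remains, and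
          \<open>Phi\<close> reads it and restores z.\<close>
        define s where "s = replicate (nat \<bar>j - int q\<bar>) (Kp :: 'b kl, 0 \<le> j - int q) @ r"
        have s: "- kp (int q) + z = fgw s"
        proof -
          have "- kp (int q) + z = kp (- int q + j) + fgw r" by (simp only: z kp_add kp_minus add.assoc)
          also have "- int q + j = j - int q" by simp
          finally show ?thesis by (simp add: s_def kp_def)
        qed
        have sr: "reduced s" unfolding s_def
        proof (rule reduced_appendI)
          show "reduced r" using r by (simp add: nok_def)
        qed (use r in \<open>auto simp: nok_def reduced_replicate\<close>)
        have sh: "\<not> (s \<noteq> [] \<and> hd s = (La a, True))"
        proof
          assume s1: "s \<noteq> [] \<and> hd s = (La a, True)"
          show False
          proof (cases "j = int q")
            case True
            then have "s = r" by (simp add: s_def)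
            then show False using s1 False True by (cases r) auto
          next
            case j: False
            then obtain k where "nat \<bar>j - int q\<bar> = Suc k" by (cases "nat \<bar>j - int q\<bar>") auto
            then show False using s1 by (simp add: s_def)
          qed
        qed
        define t where "t = gred (s @ ?o)"
        have "\<not> (t \<noteq> [] \<and> hd t = (La a, True))"
        proof
          assume "t \<noteq> [] \<and> hd t = (La a, True)"
          then obtain u where "gred (s @ ?o) = (La a, True) # u" unfolding t_def by (cases "gred (s @ ?o)") auto
          then have "(La a, True) \<in> set ?o" using hd_gred_append[OF sr] sh by blast
          then show False using out[OF q, of a] by (auto simp: set_mL)
        qed
        moreover have "reduced t" by (simp add: t_def)
        ultimately have nt: "nok ((La a, False) # t)"
          unfolding nok_def by (cases t) (auto simp: reduced_Cons2)
        have ft: "fgw t = - kp (int q) + z + fgw ?o" unfolding t_def s by (simp add: fgw_eq_iff flip: fgw_append)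
        have mv': "mv i z = kp (int (nx a q)) + fgw ((La a, False) # t)"
          unfolding mv by (simp add: fgw_Cons ft gs del: add_uminus_conv_diff)
        have "Phi (mv i z) = kp (int (st (nx a q) (a, False))) + fgw t + fgw (mL (ot (nx a q) (a, False)))"
          unfolding mv' by (rule Phi_form(3)[OF nt nx[OF q] refl])
        also have "\<dots> = z" using pv_nx[OF q, of a] by (simp add: ft gs del: add_uminus_conv_diff)
        finally show ?thesis by simp
      qed
    qed
  qed
qed

definition ht :: "'b kl fg \<Rightarrow> nat" where "ht z = (LEAST t. (Phi ^^ t) z \<in> RR)"

lemma Phi_absorb:
  assumes "(Phi ^^ t) z \<in> RR" "t \<le> t'"
  shows "(Phi ^^ t') z \<in> RR"
proof -
  have "(Phi ^^ (k + t)) z \<in> RR" for k by (induction k) (auto simp: assms(1) Phi_RR)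
  from this[of "t' - t"] show ?thesis using assms(2) by simp
qed

inductive prun :: "nat \<Rightarrow> nat \<Rightarrow> 'b list \<Rightarrow> nat \<Rightarrow> 'b list \<Rightarrow> bool" where
  pr_refl: "prun 0 q w q w"
| pr_step: "prun t (nx a q) (w @ out a q) q' w' \<Longrightarrow> prun (Suc t) q (a # w) q' w'"

context
  assumes tm: "\<And>q w. q < m \<Longrightarrow> \<exists>q'. q' < m \<and> qsteps q w q' []"
begin

lemma good_Phi: "(\<exists>t. (Phi ^^ t) (Phi z) \<in> RR) \<longleftrightarrow> (\<exists>t. (Phi ^^ t) z \<in> RR)"
proof
  assume "\<exists>t. (Phi ^^ t) (Phi z) \<in> RR"
  then obtain t where "(Phi ^^ Suc t) z \<in> RR" by (auto simp: funpow_swap1)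
  then show "\<exists>t. (Phi ^^ t) z \<in> RR" by blast
next
  assume "\<exists>t. (Phi ^^ t) z \<in> RR"
  then obtain t where "(Phi ^^ t) z \<in> RR" by blast
  then have "(Phi ^^ Suc t) z \<in> RR" by (rule Phi_absorb) simp
  then show "\<exists>t. (Phi ^^ t) (Phi z) \<in> RR" by (auto simp: funpow_swap1)
qed

text \<open>By \<open>functional\<close> a move is a step of \<open>Phi\<close>, a step back, or the
  identity, so reaching \<open>RR\<close> under iteration of \<open>Phi\<close> is invariant along
  moves.\<close>

lemma good: "\<exists>t. (Phi ^^ t) z \<in> RR"
proof -
  obtain z' where "z' \<in> Rq" "conn mb mc z (fgw z')" using conn_all[OF tm] by blast
  then have "conn mb mc z (fgw z')" "fgw z' \<in> RR" by (auto simp: RR_def)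
  then show ?thesis
  proof (induction z "fgw z'" rule: conn.induct)
    case conn_refl then show ?case by (intro exI[of _ 0]) simp
  next
    case (conn_fwd i z) then show ?case using functional[of i z] good_Phi by metis
  next
    case (conn_bwd z i) then show ?case using functional[of i z] good_Phi by metis
  qed
qed

text \<open>With \<open>functional\<close> these inequalities make \<open>ht\<close> change by at
  most one along every move, as \<open>group_theorem\<close> demands of its function.\<close>

lemma ht_Phi: "ht z \<le> Suc (ht (Phi z))" "ht (Phi z) \<le> ht z"
proof -
  have "(Phi ^^ ht (Phi z)) (Phi z) \<in> RR" unfolding ht_def by (rule LeastI_ex[OF good])
  then have "(Phi ^^ Suc (ht (Phi z))) z \<in> RR" by (simp add: funpow_swap1)
  then show "ht z \<le> Suc (ht (Phi z))" unfolding ht_def[of z] by (rule Least_le)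
  have "(Phi ^^ ht z) z \<in> RR" unfolding ht_def by (rule LeastI_ex[OF good])
  then have "(Phi ^^ Suc (ht z)) z \<in> RR" by (rule Phi_absorb) simp
  have "(Phi ^^ ht z) (Phi z) \<in> RR" using \<open>(Phi ^^ Suc (ht z)) z \<in> RR\<close> by (simp add: funpow_swap1)
  then show "ht (Phi z) \<le> ht z" unfolding ht_def[of "Phi z"] by (rule Least_le)
qed

lemma ht_ge: "(Phi ^^ t) z \<notin> RR \<Longrightarrow> t \<le> ht z"
proof (rule ccontr)
  assume a: "(Phi ^^ t) z \<notin> RR" "\<not> t \<le> ht z"
  have "(Phi ^^ ht z) z \<in> RR" unfolding ht_def by (rule LeastI_ex[OF good])
  then show False using Phi_absorb[of "ht z" z t] a by simp
qed

lemma nok_pos: "nok (mL (mp w))"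
proof -
  have "reduced (mL (mp w))"
  proof (induction w)
    case (Cons a w) then show ?case by (cases w) (auto simp: reduced_Cons2)
  qed simp
  then show ?thesis by (cases w) (auto simp: nok_def)
qed

lemma prun_Phi: "prun t q w q' w' \<Longrightarrow> q < m \<Longrightarrow> q' < m \<and> (Phi ^^ t) (cfg q (mp w)) = cfg q' (mp w')"
proof (induction rule: prun.induct)
  case (pr_step t a q w q' w')
  have "Phi (cfg q (mp (a # w))) = cfg (nx a q) (mp (w @ out a q))"
    using Phi_form(3)[OF nok_pos[of "a # w"] pr_step.prems, of a True "mL (mp w)"] by (simp add: add.assoc)
  then show ?case using pr_step nx by (simp add: funpow_swap1 del: fgw_append)
qed simp

lemma prun_ht: "prun t q w q' w' \<Longrightarrow> q < m \<Longrightarrow> w' \<noteq> [] \<Longrightarrow> t \<le> ht (cfg q (mp w))"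
proof (rule ht_ge)
  assume "prun t q w q' w'" "q < m" "w' \<noteq> []"
  then show "(Phi ^^ t) (cfg q (mp w)) \<notin> RR"
    using prun_Phi[of t q w q' w'] RR_iff[OF nok_pos, of "int q'" w'] by (simp add: mL_def)
qed

text \<open>The word k^q w has length at most m + |w|, which explains the bound on n. In a positive
  queue nothing cancels, so \<open>Phi\<close> follows the automaton, and a non-empty queue is not
  in \<open>RR\<close>.\<close>

theorem queue_theorem:
  "\<exists>PG PH \<phi>. fin_pres PG \<and> fin_pres PH \<and> subgroup_emb PH PG \<phi> \<and> dehn PG \<simeq> (\<lambda>n. n ^ 2)
    \<and> (\<forall>t q w q' w' n. prun t q w q' w' \<longrightarrow> q < m \<longrightarrow> set w \<subseteq> Bs \<longrightarrow> w' \<noteq> [] \<longrightarrow>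
         4 * (m + length w) + 4 \<le> n \<longrightarrow> t \<le> dehn PH n)"
proof -
  let ?I = "{None} \<union> Some ` ({..<m} \<times> Bs)" and ?A = "{Kp} \<union> La ` Bs"
  have kwA: "fst ` set (kw' n) \<subseteq> ?A" for n by (auto simp: kw'_def)
  have kwr: "fgw (restr ?A (kw' n @ [(La a, False)] @ wi (kw' n))) = 0" if "a \<notin> Bs" for n a
  proof -
    have 1: "restr ?A (kw' n) = kw' n" by (rule restr_id[OF kwA])
    have 2: "restr ?A (wi (kw' n)) = wi (kw' n)" unfolding restr_wi 1 ..
    have 3: "restr ?A [(La a, False)] = []" using that by auto
    show ?thesis unfolding filter_append 1 2 3 by simp
  qed
  have "\<exists>PG PH \<phi>. fin_pres PG \<and> fin_pres PH \<and> subgroup_emb PH PG \<phi> \<and> dehn PG \<simeq> (\<lambda>n. n ^ 2)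
    \<and> (\<forall>z n. fst ` set z \<subseteq> ?A \<longrightarrow> 4 * length z + 4 \<le> n \<longrightarrow> ht (fgw z) \<le> dehn PH n)"
  proof (rule group_theorem[of ?I ?A Rq mb mc])
    show "finite ?I" "?I \<noteq> {}" "finite ?A" "finite Rq" using Bs(1) by (auto simp: Rq_def)
    show "fst ` set (mb i) \<subseteq> ?A" if "i \<in> ?I" for i
      using that by (auto simp: mb_def kw'_def wi_def split: if_splits)
    show "fst ` set (mc i) \<subseteq> ?A" if "i \<in> ?I" for i
      using that Bs(2) by (fastforce simp: mc_def wi_def mL_def split: if_splits)
    show "fst ` set z \<subseteq> ?A" if "z \<in> Rq" for z using that kwA by (auto simp: Rq_def)
    show "fgw (restr ?A (mb i)) = 0" if i: "i \<notin> ?I" for i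
    proof -
      obtain q a where qa: "i = Some (q, a)" using i by (cases i) auto
      show ?thesis
      proof (cases "q < m")
        case True
        then have a: "a \<notin> Bs" using i qa by auto
        then have "mb i = kw' q @ [(La a, False)] @ wi (kw' q)" using True nBs(1)[OF a True] by (simp add: mb_def qa)
        then show ?thesis using kwr[OF a, of q] by (simp only:)
      qed (simp add: mb_def qa)
    qed
    show "fgw (restr ?A (mc i)) = 0" if i: "i \<notin> ?I" for i
    proof -
      obtain q a where qa: "i = Some (q, a)" using i by (cases i) auto
      then have "q < m \<Longrightarrow> a \<notin> Bs" using i by auto
      then have "mc i = []" using nBs(2) by (simp add: mc_def qa)
      then show ?thesis by simp
    qed
    show "\<exists>z'\<in>Rq. conn mb mc z (fgw z')" for z by (rule conn_all[OF tm])
    show "ht (fgw (mb i) + z - fgw (mc i)) \<le> Suc (ht z)" for i z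
      using functional[of i z] ht_Phi[of z] ht_Phi[of "fgw (mb i) + z - fgw (mc i)"] by (metis le_SucI order_refl)
    show "ht z \<le> Suc (ht (fgw (mb i) + z - fgw (mc i)))" for i z
      using functional[of i z] ht_Phi[of z] ht_Phi[of "fgw (mb i) + z - fgw (mc i)"] by (metis le_SucI order_refl)
    show "ht (fgw r) = 0" if "r \<in> Rq" for r
      unfolding ht_def using that by (intro Least_eq_0) (simp add: RR_def)
  qed
  then obtain PG PH \<phi> where P: "fin_pres PG" "fin_pres PH" "subgroup_emb PH PG \<phi>" "dehn PG \<simeq> (\<lambda>n. n ^ 2)"
    "\<And>z n. fst ` set z \<subseteq> ?A \<Longrightarrow> 4 * length z + 4 \<le> n \<Longrightarrow> ht (fgw z) \<le> dehn PH n" by blast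
  have "t \<le> dehn PH n" if "prun t q w q' w'" "q < m" "set w \<subseteq> Bs" "w' \<noteq> []" "4 * (m + length w) + 4 \<le> n" for t q w q' w' n
  proof -
    have "t \<le> ht (cfg q (mp w))" by (rule prun_ht[OF that(1,2,4)])
    also have "cfg q (mp w) = fgw (kw' q @ mL (mp w))" by (simp add: fgw_kw)
    also have "ht \<dots> \<le> dehn PH n"
      using that kwA by (intro P(5)) (auto simp: kw'_def set_mL)
    finally show ?thesis .
  qed
  with P(1-4) show ?thesis by blast
qed

end

end

section \<open>A queue automaton for Collatz-like maps\<close>

text \<open>A queue x^N y read in state SA l 0 becomes u^N (Lm l r) with r = N mod M, while the state becomes SB l r 0;
  reading u^N replaces M letters u by a letters x, and the marker Lm l r checks the remainder and adds
  x^b y.\<close>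

datatype tl = Lx | Lu | Ly | Lm nat nat
datatype stt = SA nat nat | SB nat nat nat

text \<open>For label l and N = M k + r the map goes to label \<open>nxt l r\<close> and number
  \<open>ca l r * k + cb l r\<close>; it stops where \<open>nxt\<close> is
  \<open>None\<close>.\<close>

locale collatz =
  fixes L M :: nat and nxt :: "nat \<Rightarrow> nat \<Rightarrow> nat option" and ca cb :: "nat \<Rightarrow> nat \<Rightarrow> nat"
  assumes L: "0 < L" and M: "0 < M" and nxt: "l < L \<Longrightarrow> r < M \<Longrightarrow> nxt l r = Some l' \<Longrightarrow> l' < L"
begin

definition cstep :: "nat \<Rightarrow> int \<Rightarrow> (nat \<times> int) option" where
  "cstep l N = (let r = nat (N mod int M) in
     map_option (\<lambda>l'. (l', int (ca l r) * (N div int M) + int (cb l r))) (nxt l r))"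

inductive halts :: "nat \<Rightarrow> int \<Rightarrow> bool" where
  halts: "(\<And>l' N'. cstep l N = Some (l', N') \<Longrightarrow> halts l' N') \<Longrightarrow> halts l N"

text \<open>\<open>SA l s\<close> has counted s letters x modulo M; \<open>SB l r s\<close>
  remembers the remainder r of N and has counted s letters u modulo M. \<open>Ly\<close> exchanges
  \<open>SA l s\<close> with \<open>SB l s 0\<close>, and \<open>Lm l r\<close> exchanges
  \<open>SB l r r\<close> with \<open>SA l' 0\<close>; both fix all other states, so they are
  involutions and agree with their inverses in \<open>pvs\<close>.\<close>

fun nxs :: "tl \<Rightarrow> stt \<Rightarrow> stt" where
  "nxs Lx (SA l s) = SA l (Suc s mod M)"
| "nxs Lx (SB l r s) = SB l r s"
| "nxs Lu (SA l s) = SA l s"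
| "nxs Lu (SB l r s) = SB l r (Suc s mod M)"
| "nxs Ly (SA l s) = SB l s 0"
| "nxs Ly (SB l r s) = (if s = 0 then SA l r else SB l r s)"
| "nxs (Lm l r) q = (if l < L \<and> r < M then case nxt l r of None \<Rightarrow> q
     | Some l' \<Rightarrow> if q = SB l r r then SA l' 0 else if q = SA l' 0 then SB l r r else q else q)"

fun pvs :: "tl \<Rightarrow> stt \<Rightarrow> stt" where
  "pvs Lx (SA l s) = SA l ((s + (M - 1)) mod M)"
| "pvs Lx (SB l r s) = SB l r s"
| "pvs Lu (SA l s) = SA l s"
| "pvs Lu (SB l r s) = SB l r ((s + (M - 1)) mod M)"
| "pvs Ly q = nxs Ly q"
| "pvs (Lm l r) q = nxs (Lm l r) q"

text \<open>A marker read in a state that does not fit is lost without replacement; termination on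
  malformed queues rests on this. In phase B the letters x come out in packets of
  \<open>ca l r\<close>, one for each full cycle of M letters u.\<close>

fun outs :: "tl \<Rightarrow> stt \<Rightarrow> tl list" where
  "outs Lx (SA l s) = [Lu]"
| "outs Lx (SB l r s) = []"
| "outs Lu (SA l s) = []"
| "outs Lu (SB l r s) = (if Suc s = M then replicate (ca l r) Lx else [])"
| "outs Ly (SA l s) = [Lm l s]"
| "outs Ly (SB l r s) = []"
| "outs (Lm l r) q = (if l < L \<and> r < M \<and> nxt l r \<noteq> None \<and> q = SB l r r then replicate (cb l r) Lx @ [Ly] else [])"

definition VS :: "stt set" where
  "VS = {SA l s | l s. l < L \<and> s < M} \<union> {SB l r s | l r s. l < L \<and> r < M \<and> s < M}"

lemma VS_simps [simp]: "SA l s \<in> VS \<longleftrightarrow> l < L \<and> s < M" "SB l r s \<in> VS \<longleftrightarrow> l < L \<and> r < M \<and> s < M"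
  by (auto simp: VS_def)

lemma nxs_VS: "q \<in> VS \<Longrightarrow> nxs a q \<in> VS"
  using M nxt by (cases "(a, q)" rule: nxs.cases) (auto split: option.splits)

lemma pvs_VS: "q \<in> VS \<Longrightarrow> pvs a q \<in> VS"
  using M nxs_VS[of q a] by (cases "(a, q)" rule: pvs.cases) auto

lemma mod_pred: "s < M \<Longrightarrow> (Suc s mod M + (M - 1)) mod M = s" "s < M \<Longrightarrow> Suc ((s + (M - 1)) mod M) mod M = s"
proof -
  assume s: "s < M"
  have "(Suc s mod M + (M - 1)) mod M = (Suc s + (M - 1)) mod M" by (rule mod_add_left_eq)
  also have "Suc s + (M - 1) = s + M" using M by simp
  finally show "(Suc s mod M + (M - 1)) mod M = s" using s by simp
  have "Suc ((s + (M - 1)) mod M) mod M = Suc (s + (M - 1)) mod M" by (rule mod_Suc_eq)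
  also have "Suc (s + (M - 1)) = s + M" using M by simp
  finally show "Suc ((s + (M - 1)) mod M) mod M = s" using s by simp
qed

lemma pvs_nxs: "q \<in> VS \<Longrightarrow> pvs a (nxs a q) = q"
  using mod_pred by (cases "(a, q)" rule: nxs.cases) (auto split: option.splits)

lemma nxs_pvs: "q \<in> VS \<Longrightarrow> nxs a (pvs a q) = q"
  using mod_pred by (cases "(a, q)" rule: nxs.cases) (auto split: option.splits)

section \<open>Runs on queues that may contain inverse letters\<close>

fun sx :: "stt \<Rightarrow> tl \<times> bool \<Rightarrow> stt" where "sx q (a, e) = (if e then nxs a q else pvs a q)"
fun ox :: "stt \<Rightarrow> tl \<times> bool \<Rightarrow> tl wrd" where "ox q (a, e) = (if e then mp (outs a q) else wi (mp (outs a (pvs a q))))"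

lemma sx_VS: "q \<in> VS \<Longrightarrow> sx q x \<in> VS" by (cases x) (auto simp: nxs_VS pvs_VS)

fun sxs :: "stt \<Rightarrow> tl wrd \<Rightarrow> stt" where "sxs q [] = q" | "sxs q (x # u) = sxs (sx q x) u"
fun oxs :: "stt \<Rightarrow> tl wrd \<Rightarrow> tl wrd" where "oxs q [] = []" | "oxs q (x # u) = ox q x @ oxs (sx q x) u"

lemma sxs_VS: "q \<in> VS \<Longrightarrow> sxs q u \<in> VS" by (induction u arbitrary: q) (auto simp: sx_VS)

inductive reach :: "stt \<Rightarrow> tl wrd \<Rightarrow> stt \<Rightarrow> tl wrd \<Rightarrow> bool" where
  r_refl: "reach q w q w"
| r_step: "reach (sx q x) (w @ ox q x) q' w' \<Longrightarrow> reach q (x # w) q' w'"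

lemma reach_trans: "reach q w q' w' \<Longrightarrow> reach q' w' q'' w'' \<Longrightarrow> reach q w q'' w''"
  by (induction rule: reach.induct) (auto intro: reach.intros)

lemma reach_VS: "reach q w q' w' \<Longrightarrow> q \<in> VS \<Longrightarrow> q' \<in> VS"
  by (induction rule: reach.induct) (auto simp: sx_VS)

lemma reach_pass: "reach q (u @ v) (sxs q u) (v @ oxs q u)"
proof (induction u arbitrary: q v)
  case (Cons x u)
  from Cons[of "sx q x" "v @ ox q x"] show ?case by (auto intro: r_step)
qed (simp add: r_refl)

definition mk :: "tl \<times> bool \<Rightarrow> bool" where "mk x \<longleftrightarrow> fst x \<noteq> Lx \<and> fst x \<noteq> Lu"
definition nu :: "tl wrd \<Rightarrow> nat" where "nu w = length (filter mk w)"

lemma mk_simps [simp]: "\<not> mk (Lx, e)" "\<not> mk (Lu, e)" "mk (Ly, e)" "mk (Lm l r, e)"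
  by (auto simp: mk_def)

lemma nu_simps [simp]: "nu [] = 0" "nu (u @ v) = nu u + nu v" "nu (x # w) = (if mk x then 1 else 0) + nu w"
  by (auto simp: nu_def)

lemma nu_wi [simp]: "nu (wi w) = nu w"
  by (induction w) (auto simp: wi_Cons mk_def)

lemma nu_rep [simp]: "nu (replicate n (Lx, e)) = 0"
  by (induction n) auto

lemma nu_ox: "nu (ox q x) \<le> (if mk x then 1 else 0)"
proof -
  obtain a e where x: "x = (a, e)" by force
  have *: "nu (mp (outs a q)) \<le> (if mk x then 1 else 0)" for q
    using x by (cases "(a, q)" rule: outs.cases) (auto simp: mk_def)
  show ?thesis using *[of q] *[of "pvs a q"] x by (auto simp: mk_def)
qed

lemma reach_nu: "reach q w q' w' \<Longrightarrow> nu w' \<le> nu w"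
proof (induction rule: reach.induct)
  case (r_step q x w q' w') then show ?case using nu_ox[of q x] by auto
qed simp

text \<open>Configurations that never lose a marker. The others reach one with fewer markers, so an
  induction on their number leaves only the live ones to be studied.\<close>

definition live :: "stt \<Rightarrow> tl wrd \<Rightarrow> bool" where
  "live q w \<longleftrightarrow> q \<in> VS \<and> (\<forall>q' w'. reach q w q' w' \<longrightarrow> nu w' = nu w)"

lemma live_reach: "live q w \<Longrightarrow> reach q w q' w' \<Longrightarrow> live q' w'"
  unfolding live_def using reach_trans reach_VS by metis

definition pd :: "stt \<Rightarrow> tl \<times> bool \<Rightarrow> bool" where "pd q x \<longleftrightarrow> nu (ox q x) = 1"

lemma live_pd: "live q (x # w) \<Longrightarrow> mk x \<Longrightarrow> pd q x"
proof -
  assume "live q (x # w)" "mk x"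
  moreover have "reach q (x # w) (sx q x) (w @ ox q x)" by (intro r_step r_refl)
  ultimately have "nu (w @ ox q x) = nu (x # w)" unfolding live_def by blast
  then show "pd q x" using \<open>mk x\<close> by (simp add: pd_def)
qed

text \<open>A surviving marker keeps its sign and alternates between the kinds \<open>Ly\<close> and
  \<open>Lm\<close>, and it survives only in states of a prescribed form.\<close>

lemma pd_cases:
  assumes "pd q x" "q \<in> VS"
  obtains l s where "x = (Ly, True)" "q = SA l s" "sx q x = SB l s 0" "ox q x = [(Lm l s, True)]"
  | l r where "x = (Ly, False)" "q = SB l r 0" "sx q x = SA l r" "ox q x = [(Lm l r, False)]"
  | l r l' where "x = (Lm l r, True)" "q = SB l r r" "nxt l r = Some l'" "l < L" "r < M" "sx q x = SA l' 0"
      "ox q x = replicate (cb l r) (Lx, True) @ [(Ly, True)]"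
  | l r l' where "x = (Lm l r, False)" "q = SA l' 0" "nxt l r = Some l'" "l < L" "r < M" "sx q x = SB l r r"
      "ox q x = [(Ly, False)] @ replicate (cb l r) (Lx, False)"
proof -
  obtain a e where x: "x = (a, e)" by force
  have wr: "wi (replicate n (y, True)) = replicate n (y, False)" for n and y :: tl by (simp add: wi_def)
  show ?thesis
  proof (cases a)
    case Lx
    then show ?thesis using assms x nu_ox[of q x] by (simp add: pd_def)
  next
    case Lu
    then show ?thesis using assms x nu_ox[of q x] by (simp add: pd_def)
  next
    case Ly
    show ?thesis
    proof (cases q)
      case (SA l s)
      then show ?thesis using assms(1) x Ly that(1) by (cases e) (auto simp: pd_def)
    next
      case (SB l r s)
      then show ?thesis using assms(1) x Ly that(2) by (cases e; cases "s = 0") (auto simp: pd_def)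
    qed
  next
    case (Lm l r)
    show ?thesis
    proof (cases e)
      case True
      then have "l < L \<and> r < M \<and> nxt l r \<noteq> None \<and> q = SB l r r"
        using assms(1) x Lm by (auto simp: pd_def split: if_splits)
      then show ?thesis using that(3) x Lm True by (auto simp: map_replicate_const)
    next
      case False
      then have *: "l < L \<and> r < M \<and> nxt l r \<noteq> None \<and> pvs a q = SB l r r"
        using assms(1) x Lm by (auto simp: pd_def split: if_splits)
      then obtain l' where l': "nxt l r = Some l'" by auto
      have "q = nxs a (pvs a q)" using nxs_pvs[OF assms(2)] by simp
      also have "\<dots> = nxs (Lm l r) (SB l r r)" using * Lm by metis
      finally have "q = SA l' 0" using * l' by simp
      then show ?thesis using that(4)[of l r l'] x Lm False * l' by (auto simp: wr map_replicate_const)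
    qed
  qed
qed

section \<open>Passing over an interval without markers\<close>

definition nm :: "tl wrd \<Rightarrow> bool" where "nm w \<longleftrightarrow> (\<forall>x\<in>set w. fst x = Lx \<or> fst x = Lu)"

lemma nm_simps [simp]: "nm []" "nm (u @ v) \<longleftrightarrow> nm u \<and> nm v" "nm (x # w) \<longleftrightarrow> (fst x = Lx \<or> fst x = Lu) \<and> nm w"
  "nm (replicate n (Lx, e))"
  by (auto simp: nm_def)

fun ee :: "tl \<Rightarrow> tl wrd \<Rightarrow> int" where
  "ee a [] = 0" | "ee a (x # w) = (if fst x = a then (if snd x then 1 else - 1) else 0) + ee a w"

lemma ee_append [simp]: "ee a (u @ v) = ee a u + ee a v"
  by (induction u) auto

lemma ee_rep [simp]: "ee Lx (replicate n (Lx, e)) = (if e then int n else - int n)"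
  by (induction n) auto

lemma wi_rep: "wi (replicate n (y, e)) = replicate n (y, \<not> e)"
  by (simp add: wi_def)

text \<open>In phase A each x becomes a u with the same sign, letters u vanish, and the state adds
  the signed count modulo M. Only the signed counts \<open>ee\<close> matter; intervals are not
  freely reduced.\<close>

lemma readA:
  assumes "nm w" "s < M"
  shows "sxs (SA l s) w = SA l (nat ((int s + ee Lx w) mod int M))" "ee Lu (oxs (SA l s) w) = ee Lx w"
    "fst ` set (oxs (SA l s) w) \<subseteq> {Lu}"
  using assms
proof (induction w arbitrary: s)
  case (Cons x w)
  case 1
  obtain a e where x: "x = (a, e)" by force
  consider "a = Lx" "e" | "a = Lx" "\<not> e" | "a = Lu" using 1 x by auto
  then show ?case
  proof cases
    case c: 1
    have "int (Suc s mod M) = (int s + 1) mod int M" by (simp add: zmod_int add.commute)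
    then show ?thesis using Cons.IH(1)[of "Suc s mod M"] 1 M x c by (simp add: mod_simps add.assoc)
  next
    case 2
    have "int ((s + (M - 1)) mod M) = (int s + (int M - 1)) mod int M" using M by (simp add: zmod_int of_nat_diff algebra_simps)
    then have "(int ((s + (M - 1)) mod M) + y) mod int M = (int s + (int M - 1) + y) mod int M" for y
      by (simp only: mod_simps)
    moreover have "(int s + (int M - 1) + y) mod int M = (int s + (- 1 + y)) mod int M" for y
    proof -
      have "int s + (int M - 1) + y = (int s + (- 1 + y)) + int M" by simp
      then show ?thesis by (simp only: mod_add_self2)
    qed
    ultimately have "(int ((s + (M - 1)) mod M) + y) mod int M = (int s + (- 1 + y)) mod int M" for y by simp
    then show ?thesis using Cons.IH(1)[of "(s + (M - 1)) mod M"] 1 M x 2 by simp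
  next
    case 3 then show ?thesis using Cons.IH(1)[of s] 1 x by auto
  qed
next
  case (Cons x w)
  case 2
  obtain a e where x: "x = (a, e)" by force
  have p: "Suc s mod M < M" "(s + (M - 1)) mod M < M" using M by auto
  show ?case using Cons.IH(2)[OF _ p(1)] Cons.IH(2)[OF _ p(2)] Cons.IH(2)[of s] 2 x by (auto simp: wi_Cons)
next
  case (Cons x w)
  case 3
  obtain a e where x: "x = (a, e)" by force
  have p: "Suc s mod M < M" "(s + (M - 1)) mod M < M" using M by auto
  show ?case using Cons.IH(3)[OF _ p(1)] Cons.IH(3)[OF _ p(2)] Cons.IH(3)[of s] 3 x by (auto simp: wi_Cons image_subset_iff)
qed (simp_all add: nat_mod_as_int)

lemma div_mod_M: "(y + int M) div int M = y div int M + 1" "(y + int M) mod int M = y mod int M"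
  using M by (simp_all add: div_add_self2)

text \<open>Each passage of the counter from M - 1 to 0 emits a packet of letters x, and each
  passage from 0 to M - 1 a packet of inverses. The net number of packets is a quotient rounded
  down, also for negative counts.\<close>

lemma readB:
  assumes "nm w" "s < M"
  shows "sxs (SB l r s) w = SB l r (nat ((int s + ee Lu w) mod int M))"
    "ee Lx (oxs (SB l r s) w) = int (ca l r) * ((int s + ee Lu w) div int M)"
    "fst ` set (oxs (SB l r s) w) \<subseteq> {Lx}"
proof -
  have "sxs (SB l r s) w = SB l r (nat ((int s + ee Lu w) mod int M)) \<and>
    ee Lx (oxs (SB l r s) w) = int (ca l r) * ((int s + ee Lu w) div int M) \<and> fst ` set (oxs (SB l r s) w) \<subseteq> {Lx}"
    using assms
  proof (induction w arbitrary: s)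
    case (Cons x w)
    obtain a e where x: "x = (a, e)" by force
    consider "a = Lu" "e" "Suc s < M" | "a = Lu" "e" "Suc s = M" | "a = Lu" "\<not> e" "s = 0" | k where "a = Lu" "\<not> e" "s = Suc k" | "a = Lx"
      using Cons.prems x by (cases s) force+
    then show ?case
    proof cases
      case 1
      then show ?thesis using Cons.IH[of "Suc s"] Cons.prems x by (simp add: algebra_simps)
    next
      case 2
      then have e: "(int s + (1 + ee Lu w)) = ee Lu w + int M" by simp
      have "(int s + (1 + ee Lu w)) mod int M = ee Lu w mod int M" "(int s + (1 + ee Lu w)) div int M = ee Lu w div int M + 1"
        unfolding e by (fact div_mod_M)+
      moreover have "sx (SB l r s) x = SB l r 0" "ox (SB l r s) x = replicate (ca l r) (Lx, True)"
        using x 2 by (simp_all add: map_replicate_const)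
      ultimately show ?thesis using Cons.IH[of 0] Cons.prems x 2 M by (auto simp: distrib_left)
    next
      case 3
      have m: "(M - 1) mod M = M - 1" using M by simp
      have e: "int (M - 1) + ee Lu w = (- 1 + ee Lu w) + int M" using M by (simp add: of_nat_diff)
      have "(int (M - 1) + ee Lu w) mod int M = (- 1 + ee Lu w) mod int M" "(int (M - 1) + ee Lu w) div int M = (- 1 + ee Lu w) div int M + 1"
        unfolding e by (fact div_mod_M)+
      moreover have "sx (SB l r s) x = SB l r (M - 1)" "ox (SB l r s) x = replicate (ca l r) (Lx, False)"
        using x 3 m M by (simp_all add: map_replicate_const wi_rep)
      ultimately show ?thesis using Cons.IH[of "M - 1"] Cons.prems x 3 M by (auto simp: distrib_left)
    next
      case 4
      have e: "(s + (M - 1)) mod M = k"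
        using 4 Cons.prems M mod_pred(1)[of k] by simp
      have "Suc k \<noteq> M" using 4 Cons.prems by simp
      then have "sx (SB l r s) x = SB l r k" "ox (SB l r s) x = []"
        using x 4 e by simp_all
      then show ?thesis using Cons.IH[of k] Cons.prems x 4 M by simp
    next
      case 5 then show ?thesis using Cons.IH[of s] Cons.prems x by auto
    qed
  qed (use M in \<open>simp add: nat_mod_as_int\<close>)
  then show "sxs (SB l r s) w = SB l r (nat ((int s + ee Lu w) mod int M))"
    "ee Lx (oxs (SB l r s) w) = int (ca l r) * ((int s + ee Lu w) div int M)"
    "fst ` set (oxs (SB l r s) w) \<subseteq> {Lx}" by blast+
qed

lemma nm_oxs: "nm w \<Longrightarrow> q \<in> VS \<Longrightarrow> nm (oxs q w)"
proof (cases q)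
  case (SA l s)
  then show "nm w \<Longrightarrow> q \<in> VS \<Longrightarrow> nm (oxs q w)" using readA(3)[of w s l] by (auto simp: nm_def)
next
  case (SB l r s)
  then show "nm w \<Longrightarrow> q \<in> VS \<Longrightarrow> nm (oxs q w)" using readB(3)[of w s l r] by (auto simp: nm_def)
qed


declare sx.simps [simp del] ox.simps [simp del]

lemma mk_nm: "\<not> mk x \<longleftrightarrow> fst x = Lx \<or> fst x = Lu"
  by (auto simp: mk_def)

lemma nu_0: "nu w = 0 \<longleftrightarrow> nm w"
  by (induction w) (auto simp: mk_nm)

lemma first_marker:
  assumes "nu w \<noteq> 0"
  obtains \<xi> x rest where "w = \<xi> @ x # rest" "nm \<xi>" "mk x"
proof -
  have "\<exists>x\<in>set w. mk x" using assms by (auto simp: nu_def filter_empty_conv)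
  then obtain \<xi> x rest where "w = \<xi> @ x # rest" "mk x" "\<forall>y\<in>set \<xi>. \<not> mk y"
    using split_list_first_prop[of w mk] by metis
  then show ?thesis using that by (auto simp: nm_def mk_nm)
qed

lemma live_VS: "live q w \<Longrightarrow> q \<in> VS" by (simp add: live_def)

lemma live_pd_at: "live q (\<xi> @ x # rest) \<Longrightarrow> mk x \<Longrightarrow> pd (sxs q \<xi>) x"
  using live_pd[of "sxs q \<xi>" x "rest @ oxs q \<xi>"] live_reach[OF _ reach_pass[of q \<xi> "x # rest"]] by simp

lemma ends_split:
  assumes "\<xi> @ x # rest = \<zeta> @ y # \<tau>" "nm \<xi>" "mk y"
  shows "(x = y \<and> rest = \<tau>) \<or> (\<exists>\<zeta>'. rest = \<zeta>' @ y # \<tau>)"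
proof -
  have "y \<notin> set \<xi>" using assms by (auto simp: nm_def mk_def)
  then show ?thesis using assms(1) by (auto simp: append_eq_append_conv2 append_eq_Cons_conv Cons_eq_append_conv)
qed

lemma reach_pass1: "reach q (\<xi> @ x # rest) (sx (sxs q \<xi>) x) (rest @ oxs q \<xi> @ ox (sxs q \<xi>) x)"
  using reach_trans[OF reach_pass[of q \<xi> "x # rest"]] r_step[OF r_refl, of "sxs q \<xi>" x "rest @ oxs q \<xi>"] by simp

text \<open>A pass over the queue from its front through the marker y. The image of the interval
  \<xi> before the first marker x stands directly in front of the output of x, preceded by \<tau>,
  and the new queue ends with the output of y. So the cyclic interval from y over the end of the
  queue to x is kept; x and y may be the same marker.\<close>

lemma rotate:
  assumes "live q w" "w = \<xi> @ x # rest" "w = \<zeta> @ y # \<tau>" "nm \<xi>" "mk x" "mk y"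
  obtains q3 \<nu> \<nu>' where "pd (sxs q \<xi>) x" "pd q3 y" "q3 \<in> VS"
    "reach q w (sx q3 y) (\<tau> @ oxs q \<xi> @ ox (sxs q \<xi>) x @ \<nu>)" "ox (sxs q \<xi>) x @ \<nu> = \<nu>' @ ox q3 y"
proof -
  let ?q1 = "sxs q \<xi>"
  have p: "pd ?q1 x" using live_pd_at assms by blast
  have q1: "?q1 \<in> VS" using sxs_VS live_VS assms by blast
  have r: "reach q w (sx ?q1 x) (rest @ oxs q \<xi> @ ox ?q1 x)" using reach_pass1 assms(2) by simp
  from ends_split[of \<xi> x rest \<zeta> y \<tau>] assms have "(x = y \<and> rest = \<tau>) \<or> (\<exists>\<zeta>'. rest = \<zeta>' @ y # \<tau>)" by simp
  then show ?thesis
  proof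
    assume "x = y \<and> rest = \<tau>"
    then show ?thesis using that[of ?q1 "[]" "[]"] p q1 r by simp
  next
    assume "\<exists>\<zeta>'. rest = \<zeta>' @ y # \<tau>"
    then obtain \<zeta>' where z: "rest = \<zeta>' @ y # \<tau>" by blast
    let ?q2 = "sx ?q1 x" let ?q3 = "sxs ?q2 \<zeta>'"
    have l2: "live ?q2 (\<zeta>' @ y # (\<tau> @ oxs q \<xi> @ ox ?q1 x))" using live_reach[OF assms(1) r] z by simp
    have p3: "pd ?q3 y" using live_pd_at[OF l2 assms(6)] .
    have q3: "?q3 \<in> VS" using sxs_VS sx_VS q1 by blast
    have "reach ?q2 (rest @ oxs q \<xi> @ ox ?q1 x) (sx ?q3 y) ((\<tau> @ oxs q \<xi> @ ox ?q1 x) @ oxs ?q2 \<zeta>' @ ox ?q3 y)"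
      using reach_pass1[of ?q2 \<zeta>' y "\<tau> @ oxs q \<xi> @ ox ?q1 x"] z by simp
    then have "reach q w (sx ?q3 y) (\<tau> @ oxs q \<xi> @ ox ?q1 x @ (oxs ?q2 \<zeta>' @ ox ?q3 y))"
      using reach_trans[OF r] by simp
    then show ?thesis by (rule that[OF p p3 q3, where \<nu>' = "ox ?q1 x @ oxs ?q2 \<zeta>'"]) simp
  qed
qed

lemma pd_LmT: "pd q (Lm l r, True) \<Longrightarrow> q \<in> VS \<Longrightarrow> \<exists>l'. nxt l r = Some l' \<and> q = SB l r r \<and>
    sx q (Lm l r, True) = SA l' 0 \<and> ox q (Lm l r, True) = replicate (cb l r) (Lx, True) @ [(Ly, True)]"
  by (erule (1) pd_cases) simp_all

lemma pd_LmF: "pd q (Lm l r, False) \<Longrightarrow> q \<in> VS \<Longrightarrow> \<exists>l'. nxt l r = Some l' \<and> q = SA l' 0 \<and>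
    sx q (Lm l r, False) = SB l r r \<and> ox q (Lm l r, False) = [(Ly, False)] @ replicate (cb l r) (Lx, False)"
  by (erule (1) pd_cases) simp_all

lemma pd_LyT: "pd q (Ly, True) \<Longrightarrow> q \<in> VS \<Longrightarrow> \<exists>l s. q = SA l s \<and> sx q (Ly, True) = SB l s 0 \<and> ox q (Ly, True) = [(Lm l s, True)]"
  by (erule (1) pd_cases) simp_all

lemma pd_LyF: "pd q (Ly, False) \<Longrightarrow> q \<in> VS \<Longrightarrow> \<exists>l r. q = SB l r 0 \<and> sx q (Ly, False) = SA l r \<and> ox q (Ly, False) = [(Lm l r, False)]"
  by (erule (1) pd_cases) simp_all

text \<open>Phases of a live configuration in which two cyclically consecutive markers have the same sign: the letters between
  them store the integer N, which evolves under the map with label l.\<close>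

definition Pos1 :: "nat \<Rightarrow> int \<Rightarrow> stt \<Rightarrow> tl wrd \<Rightarrow> bool" where
  "Pos1 l N q w \<longleftrightarrow> (\<exists>\<xi> rest \<zeta>. let y = (Lm l (nat (N mod int M)), True) in
     q = SB l (nat (N mod int M)) 0 \<and> nm \<xi> \<and> ee Lu \<xi> = N \<and> w = \<xi> @ y # rest \<and> w = \<zeta> @ [y])"

definition Pos2 :: "nat \<Rightarrow> int \<Rightarrow> stt \<Rightarrow> tl wrd \<Rightarrow> bool" where
  "Pos2 l N q w \<longleftrightarrow> (\<exists>\<xi> rest \<zeta>. let y = (Ly, True) in
     q = SA l 0 \<and> nm \<xi> \<and> ee Lx \<xi> = N \<and> w = \<xi> @ y # rest \<and> w = \<zeta> @ [y])"

definition Neg1 :: "nat \<Rightarrow> int \<Rightarrow> stt \<Rightarrow> tl wrd \<Rightarrow> bool" where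
  "Neg1 l N q w \<longleftrightarrow> (\<exists>r l2 \<rho> \<xi> rest \<zeta>.
     q = SA l r \<and> nm \<xi> \<and> ee Lx \<xi> = - N \<and> w = \<xi> @ (Lm l2 \<rho>, False) # rest \<and> w = \<zeta> @ [(Lm l r, False)])"

definition Neg2 :: "nat \<Rightarrow> int \<Rightarrow> stt \<Rightarrow> tl wrd \<Rightarrow> bool" where
  "Neg2 l N q w \<longleftrightarrow> (\<exists>l' \<xi> rest \<zeta>. let r = nat (N mod int M); y = (Ly, False) in nxt l r = Some l' \<and>
     q = SB l r r \<and> nm \<xi> \<and> ee Lu \<xi> = - N \<and> w = \<xi> @ y # rest \<and> w = \<zeta> @ y # replicate (cb l r) (Lx, False))"

lemma nat_mod_less [simp]: "nat (N mod int M) < M"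
  using M by (simp add: nat_less_iff)

text \<open>The marker survives only in the state \<open>SB l s s\<close> and only if
  \<open>nxt l s\<close> is defined; so a live queue forces the map to make a step.\<close>

lemma pos1:
  assumes "live q w" "Pos1 l N q w"
  shows "\<exists>l' N' q' w'. cstep l N = Some (l', N') \<and> reach q w q' w' \<and> Pos2 l' N' q' w'"
proof -
  define s where "s = nat (N mod int M)"
  from assms(2) obtain \<xi> rest \<zeta> where h: "q = SB l s 0" "nm \<xi>" "ee Lu \<xi> = N"
    "w = \<xi> @ (Lm l s, True) # rest" "w = \<zeta> @ [(Lm l s, True)]"
    unfolding Pos1_def Let_def s_def by blast
  have R: "sxs q \<xi> = SB l s s" "ee Lx (oxs q \<xi>) = int (ca l s) * (N div int M)"
    using readB[OF h(2), of 0 l s] M h by (simp_all add: s_def)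
  have nmo: "nm (oxs q \<xi>)" using nm_oxs[OF h(2)] live_VS assms(1) by blast
  obtain q3 \<nu> \<nu>' where r: "pd (sxs q \<xi>) (Lm l s, True)" "pd q3 (Lm l s, True)" "q3 \<in> VS"
    "reach q w (sx q3 (Lm l s, True)) ([] @ oxs q \<xi> @ ox (sxs q \<xi>) (Lm l s, True) @ \<nu>)"
    "ox (sxs q \<xi>) (Lm l s, True) @ \<nu> = \<nu>' @ ox q3 (Lm l s, True)"
    by (rule rotate[OF assms(1) h(4,5,2) mk_simps(4,4)])
  obtain l' where l': "nxt l s = Some l'" "q3 = SB l s s" "sx q3 (Lm l s, True) = SA l' 0"
    "ox q3 (Lm l s, True) = replicate (cb l s) (Lx, True) @ [(Ly, True)]"
    using pd_LmT[OF r(2,3)] by blast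
  have "cstep l N = Some (l', int (ca l s) * (N div int M) + int (cb l s))"
    using l'(1) by (simp add: cstep_def Let_def s_def)
  moreover have "Pos2 l' (int (ca l s) * (N div int M) + int (cb l s)) (SA l' 0) (oxs q \<xi> @ ox (sxs q \<xi>) (Lm l s, True) @ \<nu>)"
    unfolding Pos2_def Let_def
    apply (rule exI[of _ "oxs q \<xi> @ replicate (cb l s) (Lx, True)"], rule exI[of _ \<nu>], rule exI[of _ "oxs q \<xi> @ \<nu>' @ replicate (cb l s) (Lx, True)"])
    using R nmo r(5) l' by simp
  ultimately show ?thesis using r(4) l'(3) by fastforce
qed

lemma pos2:
  assumes "live q w" "Pos2 l N q w"
  shows "\<exists>q' w'. reach q w q' w' \<and> Pos1 l N q' w'"
proof -
  define s where "s = nat (N mod int M)"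
  from assms(2) obtain \<xi> rest \<zeta> where h: "q = SA l 0" "nm \<xi>" "ee Lx \<xi> = N"
    "w = \<xi> @ (Ly, True) # rest" "w = \<zeta> @ [(Ly, True)]"
    unfolding Pos2_def Let_def by blast
  have R: "sxs q \<xi> = SA l s" "ee Lu (oxs q \<xi>) = N"
    using readA[OF h(2), of 0 l] M h by (simp_all add: s_def)
  have nmo: "nm (oxs q \<xi>)" using nm_oxs[OF h(2)] live_VS assms(1) by blast
  obtain q3 \<nu> \<nu>' where r: "pd q3 (Ly, True)" "q3 \<in> VS"
    "reach q w (sx q3 (Ly, True)) ([] @ oxs q \<xi> @ ox (sxs q \<xi>) (Ly, True) @ \<nu>)"
    "ox (sxs q \<xi>) (Ly, True) @ \<nu> = \<nu>' @ ox q3 (Ly, True)"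
    by (rule rotate[OF assms(1) h(4,5,2) mk_simps(3,3)])
  obtain l2 s2 where l2: "sx q3 (Ly, True) = SB l2 s2 0" "ox q3 (Ly, True) = [(Lm l2 s2, True)]"
    using pd_LyT[OF r(1,2)] by blast
  have o: "ox (sxs q \<xi>) (Ly, True) = [(Lm l s, True)]" using R by (simp add: ox.simps wi_def)
  define w' where "w' = oxs q \<xi> @ (Lm l s, True) # \<nu>"
  have rr: "reach q w (SB l2 s2 0) w'" using r(3) l2 o by (simp add: w'_def)
  have lv: "live (SB l2 s2 0) w'" by (rule live_reach[OF assms(1) rr])
  have v: "l2 < L" "s2 < M" using live_VS[OF lv] by auto
  \<comment> \<open>The labels l2 and s2 stem from the last marker. A look ahead identifies them:
    the next pass meets the first marker, \<open>Lm l s\<close>, in state \<open>SB l2 s2 s\<close>,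
    and it survives only if the labels agree.\<close>
  have sx': "sxs (SB l2 s2 0) (oxs q \<xi>) = SB l2 s2 s"
    using readB[OF nmo, of 0 l2 s2] M R(2) by (simp add: s_def)
  have "pd (SB l2 s2 s) (Lm l s, True)" using live_pd_at[of _ "oxs q \<xi>" "(Lm l s, True)" \<nu>] lv sx' unfolding w'_def by force
  moreover have "SB l2 s2 s \<in> VS" using v by (simp add: s_def)
  ultimately have e: "l2 = l" "s2 = s" using pd_LmT by blast+
  have "Pos1 l N (SB l2 s2 0) w'"
    unfolding Pos1_def Let_def
    apply (rule exI[of _ "oxs q \<xi>"], rule exI[of _ \<nu>], rule exI[of _ "oxs q \<xi> @ \<nu>'"])
    using R nmo r(4) l2 o e by (simp add: w'_def s_def)
  then show ?thesis using rr by blast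
qed

text \<open>With inverse markers the map is followed forwards as well, but remainders are checked
  instead of computed: r comes with the last marker, and the first one survives only if counting
  from r over the exponent -N ends at 0, that is, r is N modulo M.\<close>

lemma neg1:
  assumes "live q w" "Neg1 l N q w"
  shows "\<exists>q' w'. reach q w q' w' \<and> Neg2 l N q' w'"
proof -
  from assms(2) obtain r l2 \<rho> \<xi> rest \<zeta> where h: "q = SA l r" "nm \<xi>" "ee Lx \<xi> = - N"
    "w = \<xi> @ (Lm l2 \<rho>, False) # rest" "w = \<zeta> @ [(Lm l r, False)]"
    unfolding Neg1_def by blast
  have v: "l < L" "r < M" using live_VS[OF assms(1)] h by auto
  have R: "sxs q \<xi> = SA l (nat ((int r - N) mod int M))" "ee Lu (oxs q \<xi>) = - N"
    using readA[OF h(2), of r l] v h by simp_all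
  have nmo: "nm (oxs q \<xi>)" using nm_oxs[OF h(2)] live_VS assms(1) by blast
  obtain q3 \<nu> \<nu>' where r: "pd (sxs q \<xi>) (Lm l2 \<rho>, False)" "pd q3 (Lm l r, False)" "q3 \<in> VS"
    "reach q w (sx q3 (Lm l r, False)) ([] @ oxs q \<xi> @ ox (sxs q \<xi>) (Lm l2 \<rho>, False) @ \<nu>)"
    "ox (sxs q \<xi>) (Lm l2 \<rho>, False) @ \<nu> = \<nu>' @ ox q3 (Lm l r, False)"
    by (rule rotate[OF assms(1) h(4,5,2) mk_simps(4,4)])
  have q1: "sxs q \<xi> \<in> VS" using sxs_VS live_VS assms(1) by blast
  have a: "nat ((int r - N) mod int M) = 0 \<and> ox (sxs q \<xi>) (Lm l2 \<rho>, False) = [(Ly, False)] @ replicate (cb l2 \<rho>) (Lx, False)"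
    using pd_LmF[OF r(1) q1] R(1) by auto
  then have "int M dvd int r - N" using M by (simp add: nat_eq_iff dvd_eq_mod_eq_0)
  then have "int r mod int M = N mod int M" by (simp add: mod_eq_dvd_iff)
  then have rN: "nat (N mod int M) = r" using v by simp
  obtain l' where l': "nxt l r = Some l'" "sx q3 (Lm l r, False) = SB l r r"
    "ox q3 (Lm l r, False) = [(Ly, False)] @ replicate (cb l r) (Lx, False)"
    using pd_LmF[OF r(2,3)] by blast
  have "Neg2 l N (SB l r r) (oxs q \<xi> @ ox (sxs q \<xi>) (Lm l2 \<rho>, False) @ \<nu>)"
    unfolding Neg2_def Let_def rN
    apply (rule exI[of _ l'], rule exI[of _ "oxs q \<xi>"], rule exI[of _ "replicate (cb l2 \<rho>) (Lx, False) @ \<nu>"], rule exI[of _ "oxs q \<xi> @ \<nu>'"])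
    using R nmo r(5) l' a by simp
  then show ?thesis using r(4) l'(2) by fastforce
qed

text \<open>Counting from s = N mod M over the exponent -N gives the exact multiple -M (N div M), so
  the state returns to 0 and the net number of packets is -(N div M). The inverse letters for
  \<open>cb l s\<close> already wait behind the last marker.\<close>

lemma neg2:
  assumes "live q w" "Neg2 l N q w"
  shows "\<exists>l' N' q' w'. cstep l N = Some (l', N') \<and> reach q w q' w' \<and> Neg1 l' N' q' w'"
proof -
  define s where "s = nat (N mod int M)"
  from assms(2) obtain l' \<xi> rest \<zeta> where h: "q = SB l s s" "nm \<xi>" "ee Lu \<xi> = - N"
    "w = \<xi> @ (Ly, False) # rest" "w = \<zeta> @ (Ly, False) # replicate (cb l s) (Lx, False)" "nxt l s = Some l'"
    unfolding Neg2_def Let_def s_def by blast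
  have sM: "s < M" "int s = N mod int M" using M by (simp_all add: s_def)
  have "int s - N = - (N div int M) * int M" using sM(2) by (simp add: minus_div_mult_eq_mod[symmetric])
  then have d: "(int s - N) mod int M = 0" "(int s - N) div int M = - (N div int M)"
    using M nonzero_mult_div_cancel_right[of "int M" "- (N div int M)"] by simp_all
  have R: "sxs q \<xi> = SB l s 0" "ee Lx (oxs q \<xi>) = - (int (ca l s) * (N div int M))"
    using readB[OF h(2), of s l s] sM d h by simp_all
  have nmo: "nm (oxs q \<xi>)" using nm_oxs[OF h(2)] live_VS assms(1) by blast
  obtain q3 \<nu> \<nu>' where r: "pd q3 (Ly, False)" "q3 \<in> VS"
    "reach q w (sx q3 (Ly, False)) (replicate (cb l s) (Lx, False) @ oxs q \<xi> @ ox (sxs q \<xi>) (Ly, False) @ \<nu>)"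
    "ox (sxs q \<xi>) (Ly, False) @ \<nu> = \<nu>' @ ox q3 (Ly, False)"
    by (rule rotate[OF assms(1) h(4,5,2) mk_simps(3,3)])
  obtain l2 s2 where l2: "sx q3 (Ly, False) = SA l2 s2" "ox q3 (Ly, False) = [(Lm l2 s2, False)]"
    using pd_LyF[OF r(1,2)] by blast
  have o: "ox (sxs q \<xi>) (Ly, False) = [(Lm l s, False)]" using R by (simp add: ox.simps wi_def)
  define \<xi>' where "\<xi>' = replicate (cb l s) (Lx, False) @ oxs q \<xi>"
  define w' where "w' = \<xi>' @ (Lm l s, False) # \<nu>"
  have rr: "reach q w (SA l2 s2) w'" using r(3) l2 o by (simp add: w'_def \<xi>'_def)
  have lv: "live (SA l2 s2) w'" by (rule live_reach[OF assms(1) rr])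
  have v: "l2 < L" "s2 < M" using live_VS[OF lv] by auto
  have n': "nm \<xi>'" using nmo by (simp add: \<xi>'_def)
  have p: "pd (sxs (SA l2 s2) \<xi>') (Lm l s, False)" using live_pd_at[of _ \<xi>' "(Lm l s, False)" \<nu>] lv unfolding w'_def by force
  have "sxs (SA l2 s2) \<xi>' \<in> VS" using sxs_VS v by simp
  then have e: "l2 = l'" using readA(1)[OF n' v(2), of l2] h(6) pd_LmF[OF p] by auto
  have "cstep l N = Some (l', int (ca l s) * (N div int M) + int (cb l s))"
    using h(6) by (simp add: cstep_def Let_def s_def)
  moreover have "Neg1 l' (int (ca l s) * (N div int M) + int (cb l s)) (SA l2 s2) w'"
    unfolding Neg1_def
    apply (rule exI[of _ s2], rule exI[of _ l], rule exI[of _ s], rule exI[of _ \<xi>'], rule exI[of _ \<nu>], rule exI[of _ "\<xi>' @ \<nu>'"])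
    using R n' r(4) l2 o e by (simp add: w'_def) (simp add: \<xi>'_def)
  ultimately show ?thesis using rr by blast
qed

lemma halts_dead:
  assumes "halts l N" "live q w"
  shows "\<not> (Pos1 l N q w \<or> Pos2 l N q w \<or> Neg1 l N q w \<or> Neg2 l N q w)"
  using assms
proof (induction arbitrary: q w rule: halts.induct)
  case (halts l N)
  have 1: False if "live q w" "Pos1 l N q w" for q w
    using pos1[OF that] halts.IH live_reach[OF that(1)] by blast
  have 2: False if "live q w" "Neg2 l N q w" for q w
    using neg2[OF that] halts.IH live_reach[OF that(1)] by blast
  have 3: False if "live q w" "Pos2 l N q w" for q w
    using pos2[OF that] 1 live_reach[OF that(1)] by blast
  have 4: False if "live q w" "Neg1 l N q w" for q w
    using neg1[OF that] 2 live_reach[OF that(1)] by blast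
  show ?case using 1 2 3 4 halts.prems by blast
qed

definition fk :: "tl wrd \<Rightarrow> bool" where "fk w \<longleftrightarrow> fst (hd (filter mk w)) = Ly"

lemma nm_filter: "nm w \<Longrightarrow> filter mk w = []"
  by (auto simp: filter_empty_conv nm_def mk_def)

lemma fk_simps: "nm u \<Longrightarrow> fk (u @ v) = fk v" "mk x \<Longrightarrow> fk (x # v) \<longleftrightarrow> fst x = Ly"
  by (simp_all add: fk_def nm_filter)

lemma pd_kind:
  assumes "pd q x" "q \<in> VS"
  shows "fk (ox q x @ v) \<longleftrightarrow> fst x \<noteq> Ly"
  using assms by (cases rule: pd_cases) (auto simp: fk_simps)

lemma nm_ox: "\<not> mk x \<Longrightarrow> nm (ox q x)"
  using nu_ox[of q x] nu_0 by simp

text \<open>After one full pass over the queue every marker has switched its kind, so somewhere two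
  consecutive markers of different kinds are read.\<close>

lemma kind_change:
  assumes "live q w" "nu w \<noteq> 0"
  shows "\<exists>q' x v. reach q w q' (x # v) \<and> mk x \<and> (fk (v @ ox q' x) \<longleftrightarrow> fst x \<noteq> Ly)"
proof (rule ccontr)
  assume *: "\<not> ?thesis"
  \<comment> \<open>Under the assumption to be refuted, a marker that is read agrees in kind with
    the one that comes next, so the kind of the first marker of the queue never changes.\<close>
  have n: "fk (v @ ox q' x) \<longleftrightarrow> fst x = Ly" if "reach q w q' (x # v)" "mk x" for q' x v
    using * that by blast
  have "fk w' = fk w1" if "reach q1 w1 q' w'" "reach q w q1 w1" for q1 w1 q' w'
    using that
  proof (induction rule: reach.induct)
    case (r_step q1 x v q' w')
    have r: "reach q w (sx q1 x) (v @ ox q1 x)"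
      using reach_trans[OF r_step.prems] reach.intros by blast
    have lv: "live q1 (x # v)" using live_reach assms(1) r_step.prems by blast
    show ?case
    proof (cases "mk x")
      case True
      then show ?thesis using r_step.IH[OF r] n[OF r_step.prems True] by (simp add: fk_simps)
    next
      case False
      then have "filter mk (v @ ox q1 x) = filter mk (x # v)" using nm_ox[OF False, of q1] by (simp add: nm_filter)
      then show ?thesis using r_step.IH[OF r] by (simp add: fk_def)
    qed
  qed simp
  from this[OF reach_pass[of q w "[]"]] have e: "fk (oxs q w) = fk w" using r_refl by simp
  obtain \<xi> x rest where h: "w = \<xi> @ x # rest" "nm \<xi>" "mk x" using first_marker[OF assms(2)] by blast
  have ap: "oxs q (u @ v) = oxs q u @ oxs (sxs q u) v" for q u v by (induction u arbitrary: q) auto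
  have "pd (sxs q \<xi>) x" using live_pd_at assms(1) h by blast
  then have "fk (oxs q w) \<longleftrightarrow> fst x \<noteq> Ly"
    using nm_oxs[OF h(2) live_VS[OF assms(1)]] pd_kind sxs_VS[OF live_VS[OF assms(1)]] h(1) by (simp add: ap fk_simps)
  moreover have "fk w \<longleftrightarrow> fst x = Ly" using h by (simp add: fk_simps)
  ultimately show False using e by simp
qed

text \<open>Reading the marker x of \<open>kind_change\<close> switches its kind, so its output, now
  the last marker, has the same kind as the next marker y. That y survives in a state derived from
  the one left by x yields one phase for each of the four ways in which x survives.\<close>

lemma live_phase:
  assumes "live q w" "nu w \<noteq> 0"
  shows "\<exists>l N q' w'. l < L \<and> live q' w' \<and> (Pos1 l N q' w' \<or> Pos2 l N q' w' \<or> Neg1 l N q' w' \<or> Neg2 l N q' w')"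
proof -
  obtain q1 x v where h: "reach q w q1 (x # v)" "mk x" "fk (v @ ox q1 x) \<longleftrightarrow> fst x \<noteq> Ly"
    using kind_change[OF assms] by blast
  have l1: "live q1 (x # v)" by (rule live_reach[OF assms(1) h(1)])
  have q1: "q1 \<in> VS" using live_VS l1 by blast
  have p1: "pd q1 x" using live_pd l1 h(2) by blast
  define q2 w2 where "q2 = sx q1 x" and "w2 = v @ ox q1 x"
  have l2: "live q2 w2" using live_reach[OF l1 r_step[OF r_refl]] by (simp add: q2_def w2_def)
  have q2: "q2 \<in> VS" using live_VS l2 by blast
  have "nu w2 \<noteq> 0" using p1 by (simp add: w2_def pd_def)
  then obtain \<xi> y rest where y: "w2 = \<xi> @ y # rest" "nm \<xi>" "mk y" using first_marker by blast
  have ky: "fst y = Ly \<longleftrightarrow> fst x \<noteq> Ly" using h(3) y by (simp add: w2_def[symmetric] fk_simps)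
  have p2: "pd (sxs q2 \<xi>) y" using live_pd_at l2 y by blast
  have q3: "sxs q2 \<xi> \<in> VS" using sxs_VS q2 by blast
  from p1 q1 show ?thesis
  proof (cases rule: pd_cases)
    case (1 l s)
    then have q2': "q2 = SB l s 0" by (simp add: q2_def)
    have v: "l < L" "s < M" using q2 q2' by simp_all
    have R: "sxs q2 \<xi> = SB l s (nat (ee Lu \<xi> mod int M))" using readB(1)[OF y(2), of 0 l s] M q2' by simp
    have e: "s = nat (ee Lu \<xi> mod int M) \<and> y = (Lm l s, True)"
      using p2 q3 by (rule pd_cases) (use R ky 1 in auto)
    have "Pos1 l (ee Lu \<xi>) q2 w2"
      unfolding Pos1_def Let_def using e y q2' 1 w2_def by (intro exI[of _ \<xi>] exI[of _ rest] exI[of _ v]) auto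
    then show ?thesis using v l2 by blast
  next
    case (2 l r)
    then have q2': "q2 = SA l r" by (simp add: q2_def)
    have v: "l < L" "r < M" using q2 q2' by simp_all
    have R: "sxs q2 \<xi> = SA l (nat ((int r + ee Lx \<xi>) mod int M))" using readA(1)[OF y(2), of r l] v q2' by simp
    have "\<exists>l2 \<rho>. y = (Lm l2 \<rho>, False)"
      using p2 q3 by (rule pd_cases) (use R ky 2 in auto)
    then have "Neg1 l (- ee Lx \<xi>) q2 w2"
      unfolding Neg1_def using y q2' 2 w2_def by fastforce
    then show ?thesis using v l2 by blast
  next
    case (3 l r l')
    then have q2': "q2 = SA l' 0" by (simp add: q2_def)
    have v: "l' < L" using q2 q2' by simp_all
    have R: "sxs q2 \<xi> = SA l' (nat (ee Lx \<xi> mod int M))" using readA(1)[OF y(2), of 0 l'] M q2' by simp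
    have e: "y = (Ly, True)"
      using p2 q3 by (rule pd_cases) (use R ky 3 in auto)
    have "Pos2 l' (ee Lx \<xi>) q2 w2"
      unfolding Pos2_def Let_def using e y q2' 3 w2_def
      by (intro exI[of _ \<xi>] exI[of _ rest] exI[of _ "v @ replicate (cb l r) (Lx, True)"]) auto
    then show ?thesis using v l2 by blast
  next
    case (4 l r l')
    then have q2': "q2 = SB l r r" by (simp add: q2_def)
    have R: "sxs q2 \<xi> = SB l r (nat ((int r + ee Lu \<xi>) mod int M))" using readB(1)[OF y(2), of r l r] 4 q2' by simp
    have e: "nat ((int r + ee Lu \<xi>) mod int M) = 0 \<and> y = (Ly, False)"
      using p2 q3 by (rule pd_cases) (use R ky 4 in auto)
    then have "int M dvd int r - (- ee Lu \<xi>)" using M by (simp add: nat_eq_iff dvd_eq_mod_eq_0)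
    then have "int r mod int M = (- ee Lu \<xi>) mod int M" by (simp only: mod_eq_dvd_iff)
    then have rN: "nat ((- ee Lu \<xi>) mod int M) = r" using 4 by (metis mod_less nat_int of_nat_mod)
    have "Neg2 l (- ee Lu \<xi>) q2 w2"
      unfolding Neg2_def Let_def rN using e y q2' 4 w2_def
      by (intro exI[of _ l'] exI[of _ \<xi>] exI[of _ rest] exI[of _ v]) auto
    then show ?thesis using 4 l2 by blast
  qed
qed

text \<open>Without markers the phase cannot change. A pass in phase A leaves only letters u and one
  in phase B only letters x, and a second pass in the same phase erases these.\<close>

lemma erase_nm:
  assumes "nm w" "q \<in> VS"
  shows "\<exists>q'\<in>VS. reach q w q' []"
proof -
  let ?q = "sxs q w" and ?w = "oxs q w"
  have n: "nm ?w" by (rule nm_oxs[OF assms])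
  have q: "?q \<in> VS" by (rule sxs_VS[OF assms(2)])
  have "oxs ?q ?w = []"
  proof (cases q)
    case (SA l s)
    have s': "?q = SA l (nat ((int s + ee Lx w) mod int M))" using readA(1)[OF assms(1), of s l] SA assms(2) by simp
    have f: "fst ` set ?w \<subseteq> {Lu}" using readA(3)[OF assms(1), of s l] SA assms(2) by simp
    have "oxs (SA l t) u = []" if "fst ` set u \<subseteq> {Lu}" for u t using that by (induction u) (auto simp: sx.simps ox.simps)
    from this[OF f] show ?thesis unfolding s' .
  next
    case (SB l r s)
    have s': "?q = SB l r (nat ((int s + ee Lu w) mod int M))" using readB(1)[OF assms(1), of s l r] SB assms(2) by simp
    have f: "fst ` set ?w \<subseteq> {Lx}" using readB(3)[OF assms(1), of s l r] SB assms(2) by simp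
    have "oxs (SB l r t) u = []" if "fst ` set u \<subseteq> {Lx}" for u t using that by (induction u) (auto simp: sx.simps ox.simps)
    from this[OF f] show ?thesis unfolding s' .
  qed
  then have "reach q w (sxs ?q ?w) []"
    using reach_trans reach_pass[of q w "[]"] reach_pass[of ?q ?w "[]"] by fastforce
  then show ?thesis using sxs_VS[OF q] by blast
qed

lemma queue_terminates:
  assumes "\<And>l N. l < L \<Longrightarrow> halts l N" "q \<in> VS"
  shows "\<exists>q'\<in>VS. reach q w q' []"
  using assms(2)
proof (induction "nu w" arbitrary: q w rule: less_induct)
  case less
  show ?case
  proof (cases "live q w")
    case True
    have "nu w = 0"
    proof (rule ccontr)
      assume "nu w \<noteq> 0"
      then obtain l N q' w' where "l < L" "live q' w'" "Pos1 l N q' w' \<or> Pos2 l N q' w' \<or> Neg1 l N q' w' \<or> Neg2 l N q' w'"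
        using live_phase[OF True] by metis
      then show False using halts_dead[OF assms(1)] by metis
    qed
    then show ?thesis using erase_nm nu_0 less.prems by blast
  next
    case False
    then obtain q' w' where r: "reach q w q' w'" "nu w' \<noteq> nu w" using less.prems by (auto simp: live_def)
    then have "nu w' < nu w" using reach_nu[OF r(1)] by simp
    then show ?thesis using less.hyps reach_VS[OF r(1) less.prems] reach_trans[OF r(1)] by blast
  qed
qed


section \<open>Positive runs follow the map\<close>

inductive prn :: "nat \<Rightarrow> stt \<Rightarrow> tl list \<Rightarrow> stt \<Rightarrow> tl list \<Rightarrow> bool" where
  prn_refl: "prn 0 q w q w"
| prn_step: "prn t (nxs a q) (w @ outs a q) q' w' \<Longrightarrow> prn (Suc t) q (a # w) q' w'"

lemma prn_trans: "prn t q w q' w' \<Longrightarrow> prn t' q' w' q'' w'' \<Longrightarrow> prn (t + t') q w q'' w''"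
  by (induction rule: prn.induct) (auto intro: prn.intros)

lemma prn_A: "s < M \<Longrightarrow> prn n (SA l s) (replicate n Lx @ v) (SA l ((s + n) mod M)) (v @ replicate n Lu)"
proof (induction n arbitrary: s v)
  case (Suc n)
  have "prn n (SA l (Suc s mod M)) (replicate n Lx @ (v @ [Lu])) (SA l ((Suc s mod M + n) mod M)) ((v @ [Lu]) @ replicate n Lu)"
    using M by (intro Suc.IH) simp
  then show ?case using prn_step[of n Lx "SA l s" "replicate n Lx @ v"] by (simp add: mod_simps)
qed (simp add: prn_refl)

lemma prn_B: "s < M \<Longrightarrow> prn n (SB l r s) (replicate n Lu @ v) (SB l r ((s + n) mod M))
    (v @ replicate (ca l r * ((s + n) div M)) Lx)"
proof (induction n arbitrary: s v)
  case (Suc n)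
  show ?case
  proof (cases "Suc s = M")
    case True
    have IH: "prn n (SB l r 0) (replicate n Lu @ (v @ replicate (ca l r) Lx)) (SB l r ((0 + n) mod M))
      ((v @ replicate (ca l r) Lx) @ replicate (ca l r * ((0 + n) div M)) Lx)" using M by (intro Suc.IH)
    have e: "s + Suc n = n + M" using True by simp
    have "(s + Suc n) mod M = n mod M" "(s + Suc n) div M = Suc (n div M)" unfolding e using M by (simp_all add: div_add_self2)
    then show ?thesis using IH prn_step[of n Lu "SB l r s" "replicate n Lu @ v"] True
      by (simp add: replicate_add[symmetric])
  next
    case False
    then have "Suc s < M" using Suc.prems by simp
    then show ?thesis using Suc.IH[of "Suc s" v] prn_step[of n Lu "SB l r s" "replicate n Lu @ v"] False by simp
  qed
qed (simp add: prn_refl)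

text \<open>One step of the map takes two passes over the queue: through N letters x with
  \<open>Ly\<close>, and through N letters u with \<open>Lm l r\<close>.\<close>

lemma prn_cstep:
  assumes "cstep l (int N) = Some (l', int N')" "l < L"
  shows "\<exists>t. prn (Suc t) (SA l 0) (replicate N Lx @ [Ly]) (SA l' 0) (replicate N' Lx @ [Ly])"
proof -
  define r where "r = N mod M"
  have r: "r < M" "nat (int N mod int M) = r" using M by (simp_all add: r_def zmod_int[symmetric])
  have c: "nxt l r = Some l'" "int N' = int (ca l r) * (int N div int M) + int (cb l r)"
    using assms(1) by (auto simp: cstep_def Let_def r)
  then have "int N' = int (ca l r * (N div M) + cb l r)" by (simp add: zdiv_int)
  then have N': "N' = ca l r * (N div M) + cb l r" by (simp only: of_nat_eq_iff)
  have 1: "prn N (SA l 0) (replicate N Lx @ [Ly]) (SA l r) ([Ly] @ replicate N Lu)"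
    using prn_A[of 0 N l "[Ly]"] M by (simp add: r_def)
  have 2: "prn 1 (SA l r) ([Ly] @ replicate N Lu) (SB l r 0) (replicate N Lu @ [Lm l r])"
    using prn_step[OF prn_refl, where a = Ly and q = "SA l r" and w = "replicate N Lu"] by simp
  have 3: "prn N (SB l r 0) (replicate N Lu @ [Lm l r]) (SB l r r) ([Lm l r] @ replicate (ca l r * (N div M)) Lx)"
    using prn_B[of 0 N l r "[Lm l r]"] M by (simp add: r_def)
  have 4: "prn 1 (SB l r r) ([Lm l r] @ replicate (ca l r * (N div M)) Lx) (SA l' 0) (replicate N' Lx @ [Ly])"
    using prn_step[OF prn_refl, where a = "Lm l r" and q = "SB l r r" and w = "replicate (ca l r * (N div M)) Lx"] c(1) assms(2) r
    by (simp add: N' replicate_add)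
  have "prn (((N + 1) + N) + 1) (SA l 0) (replicate N Lx @ [Ly]) (SA l' 0) (replicate N' Lx @ [Ly])"
    by (rule prn_trans[OF prn_trans[OF prn_trans[OF 1 2] 3] 4])
  then show ?thesis by auto
qed

inductive crun :: "nat \<Rightarrow> nat \<Rightarrow> nat \<Rightarrow> bool" where
  crun_0: "crun 0 l N"
| crun_Suc: "cstep l (int N) = Some (l', int N') \<Longrightarrow> crun k l' N' \<Longrightarrow> crun (Suc k) l N"

lemma cstep_less: "cstep l N = Some (l', N') \<Longrightarrow> l < L \<Longrightarrow> l' < L"
  using nxt[of l "nat (N mod int M)"] by (auto simp: cstep_def Let_def)

lemma prn_crun: "crun k l N \<Longrightarrow> l < L \<Longrightarrow> \<exists>t q' w'. k \<le> t \<and> prn t (SA l 0) (replicate N Lx @ [Ly]) q' w' \<and> w' \<noteq> []"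
proof (induction rule: crun.induct)
  case (crun_0 l N) then show ?case using prn_refl by blast
next
  case (crun_Suc l N l' N' k)
  then obtain t q' w' where "k \<le> t" "prn t (SA l' 0) (replicate N' Lx @ [Ly]) q' w'" "w' \<noteq> []"
    using cstep_less by blast
  moreover obtain t' where "prn (Suc t') (SA l 0) (replicate N Lx @ [Ly]) (SA l' 0) (replicate N' Lx @ [Ly])"
    using prn_cstep[OF crun_Suc.hyps(1) crun_Suc.prems] by blast
  ultimately have "prn (Suc t' + t) (SA l 0) (replicate N Lx @ [Ly]) q' w'" "Suc k \<le> Suc t' + t" "w' \<noteq> []"
    using prn_trans[of "Suc t'"] by fastforce+
  then show ?case by blast
qed

lemma finite_VS: "finite VS"
proof -
  have "VS = case_prod SA ` ({..<L} \<times> {..<M}) \<union> (\<lambda>(l, r, s). SB l r s) ` ({..<L} \<times> {..<M} \<times> {..<M})"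
    by (auto simp: VS_def image_iff)
  then show ?thesis by simp
qed

theorem collatz_theorem:
  assumes hl: "\<And>l N. l < L \<Longrightarrow> halts l N"
  shows "\<exists>PG PH \<phi> c. fin_pres PG \<and> fin_pres PH \<and> subgroup_emb PH PG \<phi> \<and> dehn PG \<simeq> (\<lambda>n. n ^ 2) \<and>
    (\<forall>k l N n. crun k l N \<longrightarrow> l < L \<longrightarrow> 4 * N + c \<le> n \<longrightarrow> k \<le> dehn PH n)"
proof -
  define m where "m = card VS"
  obtain h where h: "bij_betw h VS {0..<m}" using ex_bij_betw_finite_nat[OF finite_VS] m_def by blast
  define g where "g = inv_into VS h"
  have hg: "q < m \<Longrightarrow> h (g q) = q" and gV: "q < m \<Longrightarrow> g q \<in> VS" for q
    using h by (auto simp: g_def bij_betw_def f_inv_into_f inv_into_into)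
  have gh: "q \<in> VS \<Longrightarrow> g (h q) = q" and hm: "q \<in> VS \<Longrightarrow> h q < m" for q
    using h by (auto simp: g_def bij_betw_def)
  define nx pv out where "nx = (\<lambda>a q. h (nxs a (g q)))" and "pv = (\<lambda>a q. h (pvs a (g q)))" and "out = (\<lambda>a q. outs a (g q))"
  define Bs where "Bs = {Lx, Lu, Ly} \<union> case_prod Lm ` ({..<L} \<times> {..<M})"
  have Lm_Bs: "Lm l r \<in> Bs \<longleftrightarrow> l < L \<and> r < M" for l r by (auto simp: Bs_def image_iff)
  have Bs3: "Lx \<in> Bs" "Lu \<in> Bs" "Ly \<in> Bs" by (auto simp: Bs_def)
  have "SA 0 0 \<in> VS" using L M by simp
  then have "VS \<noteq> {}" by blast
  then have m0: "0 < m" using finite_VS by (auto simp: m_def card_gt_0_iff)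
  interpret Q: qaut m nx pv out Bs
  proof
    show "0 < m" by (rule m0)
    show "finite Bs" by (simp add: Bs_def)
    fix a q assume q: "q < m"
    show "nx a q < m" using hm nxs_VS gV q by (simp add: nx_def)
    show "pv a q < m" using hm pvs_VS gV q by (simp add: pv_def)
    show "pv a (nx a q) = q" using gV q by (simp add: nx_def pv_def gh nxs_VS pvs_nxs hg)
    show "nx a (pv a q) = q" using gV q by (simp add: nx_def pv_def gh pvs_VS nxs_pvs hg)
    show "a \<notin> set (out a q)" by (cases "(a, g q)" rule: outs.cases) (auto simp: out_def)
    show "set (out a q) \<subseteq> Bs" if "a \<in> Bs"
      using gV[OF q] Lm_Bs Bs3 by (cases "(a, g q)" rule: outs.cases) (auto simp: out_def)
    assume a: "a \<notin> Bs"
    then obtain l r where lr: "a = Lm l r" "\<not> (l < L \<and> r < M)" using Bs3 Lm_Bs by (cases a) auto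
    show "nx a q = q" using lr hg[OF q] by (auto simp: nx_def)
    show "out a q = []" using lr by (auto simp: out_def)
  qed
  have st: "Q.st (h q) x = h (sx q x)" "Q.ot (h q) x = ox q x" if q: "q \<in> VS" for q x
  proof -
    obtain a e where x: "x = (a, e)" by force
    show "Q.st (h q) x = h (sx q x)" unfolding x Q.st.simps sx.simps unfolding nx_def pv_def gh[OF q] by simp
    show "Q.ot (h q) x = ox q x" unfolding x Q.ot.simps ox.simps unfolding pv_def out_def gh[OF q] gh[OF pvs_VS[OF q]] by (rule refl)
  qed
  have rq: "reach q w q' w' \<Longrightarrow> q \<in> VS \<Longrightarrow> Q.qsteps (h q) w (h q') w'" for q w q' w'
  proof (induction rule: reach.induct)
    case (r_step q x w q' w')
    then have "Q.qsteps (Q.st (h q) x) (w @ Q.ot (h q) x) (h q') w'" using sx_VS st by simp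
    then show ?case by (rule Q.qs_step)
  qed (rule Q.qs_refl)
  have pq: "prn t q w q' w' \<Longrightarrow> q \<in> VS \<Longrightarrow> Q.prun t (h q) w (h q') w'" for t q w q' w'
  proof (induction rule: prn.induct)
    case (prn_step t a q w q' w')
    then have "Q.prun t (nx a (h q)) (w @ out a (h q)) (h q') w'" using nxs_VS by (simp add: nx_def out_def gh)
    then show ?case by (rule Q.pr_step)
  qed (rule Q.pr_refl)
  have tm: "\<exists>q'. q' < m \<and> Q.qsteps q w q' []" if q: "q < m" for q w
  proof -
    obtain q' where "q' \<in> VS" "reach (g q) w q' []" using queue_terminates[OF hl gV[OF q]] by metis
    then have "h q' < m \<and> Q.qsteps (h (g q)) w (h q') []" using rq gV[OF q] hm by simp
    then show ?thesis using hg[OF q] by auto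
  qed
  obtain PG PH \<phi> where P: "fin_pres PG" "fin_pres PH" "subgroup_emb PH PG \<phi>" "dehn PG \<simeq> (\<lambda>n. n ^ 2)"
    "\<And>t q w q' w' n. Q.prun t q w q' w' \<Longrightarrow> q < m \<Longrightarrow> set w \<subseteq> Bs \<Longrightarrow> w' \<noteq> [] \<Longrightarrow> 4 * (m + length w) + 4 \<le> n \<Longrightarrow> t \<le> dehn PH n"
    using Q.queue_theorem[OF tm] by blast
  \<comment> \<open>The start queue x^N y has N + 1 letters, and 4 (m + N + 1) + 4 = 4 N + (4 m +
    8).\<close>
  have "k \<le> dehn PH n" if c: "crun k l N" "l < L" "4 * N + (4 * m + 8) \<le> n" for k l N n
  proof -
    obtain t q' w' where t: "k \<le> t" "prn t (SA l 0) (replicate N Lx @ [Ly]) q' w'" "w' \<noteq> []"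
      using prn_crun[OF c(1,2)] by blast
    have V: "SA l 0 \<in> VS" using c M by simp
    have "t \<le> dehn PH n"
      by (rule P(5)[OF pq[OF t(2) V] hm[OF V] _ t(3)]) (use c Bs3 in auto)
    then show ?thesis using t(1) by simp
  qed
  then show ?thesis using P(1-4) by blast
qed

end

section \<open>Counter machines\<close>

type_synonym regs = "nat \<Rightarrow> nat"
datatype instr = IInc nat nat | IDec nat nat nat

fun istep :: "instr \<Rightarrow> regs \<Rightarrow> nat \<times> regs" where
  "istep (IInc i l) s = (l, s(i := Suc (s i)))"
| "istep (IDec i l1 l2) s = (if s i = 0 then (l2, s) else (l1, s(i := s i - 1)))"

fun ireg :: "instr \<Rightarrow> nat" where "ireg (IInc i l) = i" | "ireg (IDec i l1 l2) = i"

text \<open>A jump out of the program counts as halting before the jump, so a run meets only labels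
  of the program, in keeping with the bound on labels in \<open>collatz\<close>.\<close>

definition mstep :: "instr list \<Rightarrow> nat \<Rightarrow> regs \<Rightarrow> (nat \<times> regs) option" where
  "mstep P l s = (if l < length P \<and> fst (istep (P ! l) s) < length P then Some (istep (P ! l) s) else None)"

inductive mhalts :: "instr list \<Rightarrow> nat \<Rightarrow> regs \<Rightarrow> bool" for P where
  mhalts: "(\<And>l' s'. mstep P l s = Some (l', s') \<Longrightarrow> mhalts P l' s') \<Longrightarrow> mhalts P l s"

inductive mrun :: "instr list \<Rightarrow> nat \<Rightarrow> nat \<Rightarrow> regs \<Rightarrow> nat \<Rightarrow> regs \<Rightarrow> bool" for P where
  mr_refl: "mrun P 0 l s l s"
| mr_step: "mstep P l s = Some (l1, s1) \<Longrightarrow> mrun P k l1 s1 l' s' \<Longrightarrow> mrun P (Suc k) l s l' s'"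

lemma mrun_trans: "mrun P k l s l' s' \<Longrightarrow> mrun P k' l' s' l'' s'' \<Longrightarrow> mrun P (k + k') l s l'' s''"
  by (induction rule: mrun.induct) (auto intro: mrun.intros)

lemma mrun_mhalts: "mrun P k l s l' s' \<Longrightarrow> mhalts P l' s' \<Longrightarrow> mhalts P l s"
proof (induction rule: mrun.induct)
  case (mr_step l s l1 s1 k l' s')
  then have "\<And>l2 s2. mstep P l s = Some (l2, s2) \<Longrightarrow> mhalts P l2 s2" by simp
  then show ?case by (rule mhalts)
qed

lemma mstep_reg:
  assumes "mstep P l s = Some (l', s')"
  shows "s' i \<le> Suc (s i)" "(\<forall>I\<in>set P. ireg I \<noteq> i) \<Longrightarrow> s' i = s i"
proof -
  have e: "istep (P ! l) s = (l', s')" and l: "l < length P" using assms by (auto simp: mstep_def split: if_splits)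
  show "s' i \<le> Suc (s i)" using e by (cases "P ! l") (auto split: if_splits)
  assume "\<forall>I\<in>set P. ireg I \<noteq> i"
  then have "ireg (P ! l) \<noteq> i" using l by simp
  then show "s' i = s i" using e by (cases "P ! l") (auto split: if_splits)
qed

lemma mrun_reg: "mrun P k l s l' s' \<Longrightarrow> s' i \<le> s i + k" "mrun P k l s l' s' \<Longrightarrow> (\<forall>I\<in>set P. ireg I \<noteq> i) \<Longrightarrow> s' i = s i"
proof (induction rule: mrun.induct)
  case (mr_step l s l1 s1 k l' s')
  { case 1 show ?case using mr_step.IH(1) mstep_reg(1)[OF mr_step.hyps(1), of i] by simp }
  { case 2 then show ?case using mr_step.IH(2) mstep_reg(2)[OF mr_step.hyps(1), of i] by simp }
qed simp_all

text \<open>A register that no instruction mentions has no influence. This is for the last register,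
  to which an arbitrary integer may give any content.\<close>

lemma mhalts_upd:
  assumes "\<forall>I\<in>set P. ireg I \<noteq> i" "mhalts P l s"
  shows "mhalts P l (s(i := v))"
  using assms(2)
proof (induction rule: mhalts.induct)
  case (mhalts l s)
  show ?case
  proof (rule mhalts.intros)
    fix l' s' assume st: "mstep P l (s(i := v)) = Some (l', s')"
    then have l: "l < length P" "l' < length P" "istep (P ! l) (s(i := v)) = (l', s')"
      by (auto simp: mstep_def split: if_splits)
    then have "ireg (P ! l) \<noteq> i" using assms(1) by simp
    then have "istep (P ! l) s = (l', s'(i := s i)) \<and> s' i = v"
      using l(3) by (cases "P ! l") (auto split: if_splits simp: fun_upd_twist)
    then have "mstep P l s = Some (l', s'(i := s i))" "s' i = v" using l by (simp_all add: mstep_def)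
    from mhalts.IH[OF this(1)] this(2) show "mhalts P l' s'" by (metis fun_upd_triv fun_upd_upd)
  qed
qed

section \<open>Coding of registers by prime exponents\<close>

definition pr :: "nat \<Rightarrow> nat" where "pr = enumerate {p. prime p}"

lemma pr_prime: "prime (pr i)"
  using enumerate_in_set[OF primes_infinite] by (simp add: pr_def)

lemma pr_inj: "pr i = pr j \<longleftrightarrow> i = j"
  using enumerate_mono[OF _ primes_infinite, of i j] enumerate_mono[OF _ primes_infinite, of j i]
  by (cases i j rule: linorder_cases) (auto simp: pr_def)

lemma pr_0: "pr 0 = 2"
proof -
  have "(LEAST p. prime (p :: nat)) = 2" by (intro Least_equality) (auto simp: prime_ge_2_nat)
  then show ?thesis by (simp add: pr_def enumerate_0)
qed

lemma pri: "prime (int (pr i))" using pr_prime by simp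

text \<open>The contents of the registers are the exponents of the first D primes in N; the last register
  is never used, so that N is not divisible by the product M of these primes during a proper run.\<close>

locale cmachine =
  fixes P :: "instr list" and D :: nat
  assumes P: "P \<noteq> []" and D: "I \<in> set P \<Longrightarrow> ireg I < D"
begin

definition M :: nat where "M = (\<Prod>i\<le>D. pr i)"

text \<open>As the primes in question divide M, the remainder r shows which of them divide N.
  Remainder 0 stops the map; this covers N = 0, which codes no register contents and might otherwise
  run forever.\<close>

definition nxt :: "nat \<Rightarrow> nat \<Rightarrow> nat option" where
  "nxt l r = (let l' = (case P ! l of IInc i l1 \<Rightarrow> l1 | IDec i l1 l2 \<Rightarrow> if pr i dvd r then l1 else l2)
     in if r = 0 \<or> length P \<le> l' then None else Some l')"
text \<open>An increment multiplies N = M k + r by a prime and a decrement divides N by it; on a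
  fixed residue class both are affine in k.\<close>

definition ca :: "nat \<Rightarrow> nat \<Rightarrow> nat" where
  "ca l r = (case P ! l of IInc i l1 \<Rightarrow> pr i * M | IDec i l1 l2 \<Rightarrow> if pr i dvd r then M div pr i else M)"
definition cb :: "nat \<Rightarrow> nat \<Rightarrow> nat" where
  "cb l r = (case P ! l of IInc i l1 \<Rightarrow> pr i * r | IDec i l1 l2 \<Rightarrow> if pr i dvd r then r div pr i else r)"

lemma M_pos: "0 < M"
  unfolding M_def using pr_prime by (intro prod_pos) (auto simp: prime_gt_0_nat)

sublocale C: collatz "length P" M nxt ca cb
  by unfold_locales (use P M_pos in \<open>auto simp: nxt_def Let_def split: if_splits\<close>)

definition rep :: "int \<Rightarrow> regs \<Rightarrow> bool" where
  "rep N s \<longleftrightarrow> N \<noteq> 0 \<and> (\<forall>i. s i = (if i \<le> D then multiplicity (int (pr i)) N else 0))"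

lemma rep_mult:
  assumes "rep N s" "i \<le> D"
  shows "rep (int (pr i) * N) (s(i := Suc (s i)))"
proof -
  have "int (pr i) \<noteq> 0" using pri[of i] by force
  moreover have "multiplicity (int (pr j)) (int (pr i) * N) = (if j = i then Suc (multiplicity (int (pr j)) N) else multiplicity (int (pr j)) N)" for j
  proof -
    have "multiplicity (int (pr j)) (int (pr i) * N) = multiplicity (int (pr j)) (int (pr i)) + multiplicity (int (pr j)) N"
      using assms(1) pri[of j] \<open>int (pr i) \<noteq> 0\<close> by (intro prime_elem_multiplicity_mult_distrib) (auto simp: rep_def)
    moreover have "multiplicity (int (pr j)) (int (pr i)) = (if j = i then 1 else 0)"
      using pri prime_multiplicity_other[OF pri pri, of j i] pr_inj by auto
    ultimately show ?thesis by simp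
  qed
  ultimately show ?thesis using assms by (auto simp: rep_def)
qed

lemma rep_pos: "rep N s \<Longrightarrow> i \<le> D \<Longrightarrow> s i = 0 \<longleftrightarrow> \<not> int (pr i) dvd N"
  using pri[of i] by (auto simp: rep_def prime_elem_multiplicity_eq_zero_iff)

lemma pr_dvd_M: "i \<le> D \<Longrightarrow> pr i dvd M"
  unfolding M_def by (rule dvd_prodI) auto

lemma cstep_dvd: "int M dvd N \<Longrightarrow> C.cstep l N = None"
  by (simp add: C.cstep_def nxt_def Let_def)

lemma cstep_rep:
  assumes r: "rep N s" and l: "l < length P" and dv: "\<not> int M dvd N"
  shows "\<exists>N'. rep N' (snd (istep (P ! l) s)) \<and> (0 < N \<longrightarrow> 0 < N') \<and>
    C.cstep l N = (if fst (istep (P ! l) s) < length P then Some (fst (istep (P ! l) s), N') else None)"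
proof -
  define k \<rho> where "k = N div int M" and "\<rho> = nat (N mod int M)"
  have N: "N = int M * k + int \<rho>" using M_pos by (simp add: k_def \<rho>_def)
  have \<rho>0: "\<rho> \<noteq> 0" using dv M_pos by (auto simp: \<rho>_def dvd_eq_mod_eq_0 nat_eq_iff)
  have ir: "ireg (P ! l) < D" using D l by simp
  have cs: "C.cstep l N = map_option (\<lambda>l'. (l', int (ca l \<rho>) * k + int (cb l \<rho>))) (nxt l \<rho>)"
    by (simp add: C.cstep_def k_def \<rho>_def Let_def)
  have pos: "\<And>i. 0 < int (pr i)" using pr_prime prime_gt_0_nat by simp
  show ?thesis
  proof (cases "P ! l")
    case (IInc i l1)
    then have i: "i \<le> D" using ir by simp
    have "int (ca l \<rho>) * k + int (cb l \<rho>) = int (pr i) * N" using IInc N by (simp add: ca_def cb_def distrib_left)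
    then show ?thesis using rep_mult[OF r i] IInc cs \<rho>0 pos[of i] by (auto simp: nxt_def)
  next
    case (IDec i l1 l2)
    then have i: "i \<le> D" using ir by simp
    have dr: "pr i dvd \<rho> \<longleftrightarrow> int (pr i) dvd N"
      using pr_dvd_M[OF i] N by (metis dvd_add_right_iff dvd_mult2 int_dvd_int_iff)
    show ?thesis
    proof (cases "s i = 0")
      case True
      then have nd: "\<not> pr i dvd \<rho>" using rep_pos[OF r i] dr by simp
      have "int (ca l \<rho>) * k + int (cb l \<rho>) = N" using IDec N nd by (simp add: ca_def cb_def)
      then show ?thesis using r IDec True cs \<rho>0 nd by (auto simp: nxt_def)
    next
      case False
      then have d: "pr i dvd \<rho>" using rep_pos[OF r i] dr by simp
      define N' where "N' = int (M div pr i) * k + int (\<rho> div pr i)"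
      have cc: "int (ca l \<rho>) * k + int (cb l \<rho>) = N'" using IDec d by (simp add: ca_def cb_def N'_def)
      have "int (pr i) * N' = int (pr i * (M div pr i)) * k + int (pr i * (\<rho> div pr i))"
        by (simp add: N'_def distrib_left)
      then have NN': "N = int (pr i) * N'" using N d pr_dvd_M[OF i] by simp
      have "N \<noteq> 0" using r by (simp add: rep_def)
      then have "rep N' (\<lambda>i. if i \<le> D then multiplicity (int (pr i)) N' else 0)" (is "rep N' ?s'")
        using NN' by (auto simp: rep_def)
      from rep_mult[OF this i] have "rep N (?s'(i := Suc (?s' i)))" using NN' by simp
      then have "s = ?s'(i := Suc (?s' i))" using r unfolding rep_def by presburger
      then have "s(i := s i - 1) = ?s'" by auto
      then have "rep N' (s(i := s i - 1))" using \<open>rep N' ?s'\<close> by simp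
      moreover have "0 < N \<longrightarrow> 0 < N'" using NN' pos[of i] by (simp add: zero_less_mult_iff)
      ultimately show ?thesis using IDec False cs \<rho>0 d cc by (auto simp: nxt_def)
    qed
  qed
qed

text \<open>The map may stop earlier than the machine, at a multiple of M, but never runs longer.
  Negative N are covered, as multiplicities ignore the sign.\<close>

lemma halts_transfer: "mhalts P l s \<Longrightarrow> l < length P \<Longrightarrow> rep N s \<Longrightarrow> C.halts l N"
proof (induction arbitrary: N rule: mhalts.induct)
  case (mhalts l s)
  show ?case
  proof (rule C.halts)
    fix l' N' assume c: "C.cstep l N = Some (l', N')"
    then have "\<not> int M dvd N" using cstep_dvd by fastforce
    from cstep_rep[OF mhalts.prems(2,1) this] c obtain s' where "istep (P ! l) s = (l', s')" "rep N' s'" "l' < length P"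
      by (cases "istep (P ! l) s") (auto split: if_splits)
    then show "C.halts l' N'" using mhalts.IH mhalts.prems by (auto simp: mstep_def)
  qed
qed

lemma crun_transfer: "mrun P k l s l' s' \<Longrightarrow> rep (int N) s \<Longrightarrow> s D = 0 \<Longrightarrow> C.crun k l N"
proof (induction arbitrary: N rule: mrun.induct)
  case (mr_step l s l1 s1 k l' s')
  have "\<not> int (pr D) dvd int N" using rep_pos[OF mr_step.prems(1), of D] mr_step.prems by simp
  moreover have "int (pr D) dvd int M" using pr_dvd_M by simp
  ultimately have nd: "\<not> int M dvd int N" using dvd_trans by blast
  have l: "l < length P" "istep (P ! l) s = (l1, s1)" "l1 < length P"
    using mr_step.hyps(1) by (auto simp: mstep_def split: if_splits)
  obtain N' where N': "rep N' s1" "0 < int N \<longrightarrow> 0 < N'" "C.cstep l (int N) = Some (l1, N')"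
    using cstep_rep[OF mr_step.prems(1) l(1) nd] l by auto
  have "0 < int N" using mr_step.prems(1) by (auto simp: rep_def)
  then obtain N1 where N1: "N' = int N1" using N'(2) by (metis less_imp_le nonneg_int_cases)
  have "s1 D = 0" using mstep_reg(2)[OF mr_step.hyps(1), of D] D mr_step.prems(2) by fastforce
  then have "C.crun k l1 N1" using mr_step.IH N' N1 by simp
  then show ?case using C.crun_Suc N' N1 by simp
qed (rule C.crun_0)

theorem cmachine_theorem:
  assumes hl: "\<And>l s. l < length P \<Longrightarrow> (\<And>i. D < i \<Longrightarrow> s i = 0) \<Longrightarrow> mhalts P l s"
  shows "\<exists>PG PH \<phi> c. fin_pres PG \<and> fin_pres PH \<and> subgroup_emb PH PG \<phi> \<and> dehn PG \<simeq> (\<lambda>n. n ^ 2) \<and>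
    (\<forall>k j l' s' n. mrun P k 0 ((\<lambda>_. 0)(0 := j)) l' s' \<longrightarrow> 4 * 2 ^ j + c \<le> n \<longrightarrow> k \<le> dehn PH n)"
proof -
  have all: "C.halts l N" if l: "l < length P" for l N
  proof (cases "N = 0")
    case True
    then have "C.cstep l N = None" using cstep_dvd[of N l] by simp
    then show ?thesis by (auto intro: C.halts)
  next
    case False
    then have "rep N (\<lambda>i. if i \<le> D then multiplicity (int (pr i)) N else 0)" by (simp add: rep_def)
    then show ?thesis by (intro halts_transfer[OF hl l]) (use l in auto)
  qed
  have D0: "0 < D" using D[of "hd P"] P by (metis gr0I hd_in_set not_less0)
  have r: "rep (int (2 ^ j)) ((\<lambda>_. 0)(0 := j))" for j
  proof -
    have "multiplicity (int (pr i)) (2 ^ j) = (if i = 0 then j else 0)" for i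
    proof (cases "i = 0")
      case True then show ?thesis using pr_0 by simp
    next
      case False
      then have "pr i \<noteq> 2" using pr_inj[of i 0] pr_0 by simp
      then have "multiplicity (int (pr i)) (2 ^ j) = 0"
        using pri[of i] by (intro multiplicity_distinct_prime_power) auto
      then show ?thesis using False by simp
    qed
    then show ?thesis by (simp add: rep_def)
  qed
  obtain PG PH \<phi> c where Q: "fin_pres PG" "fin_pres PH" "subgroup_emb PH PG \<phi>" "dehn PG \<simeq> (\<lambda>n. n ^ 2)"
    "\<And>k l N n. C.crun k l N \<Longrightarrow> l < length P \<Longrightarrow> 4 * N + c \<le> n \<Longrightarrow> k \<le> dehn PH n"
    using C.collatz_theorem[OF all] by blast
  have "k \<le> dehn PH n" if "mrun P k 0 ((\<lambda>_. 0)(0 := j)) l' s'" "4 * 2 ^ j + c \<le> n" for k j l' s' n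
    by (rule Q(5)[OF crun_transfer[OF that(1) r]]) (use D0 P that in auto)
  then show ?thesis using Q(1-4) by blast
qed

end

section \<open>Loop programs and their counter machine code\<close>

datatype com = Incr nat | Decr nat | Seq com com | Loop nat com

fun run :: "com \<Rightarrow> regs \<Rightarrow> regs" where
  "run (Incr i) s = s(i := Suc (s i))"
| "run (Decr i) s = s(i := s i - 1)"
| "run (Seq c1 c2) s = run c2 (run c1 s)"
| "run (Loop i c) s = ((\<lambda>s. run c (s(i := s i - 1))) ^^ (s i)) s"

fun wrt :: "com \<Rightarrow> nat set" where
  "wrt (Incr i) = {i}" | "wrt (Decr i) = {i}" | "wrt (Seq c1 c2) = wrt c1 \<union> wrt c2" | "wrt (Loop i c) = insert i (wrt c)"

fun wfc :: "com \<Rightarrow> bool" where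
  "wfc (Incr i) \<longleftrightarrow> True" | "wfc (Decr i) \<longleftrightarrow> True" | "wfc (Seq c1 c2) \<longleftrightarrow> wfc c1 \<and> wfc c2"
| "wfc (Loop i c) \<longleftrightarrow> i \<notin> wrt c \<and> wfc c"

fun clen :: "com \<Rightarrow> nat" where
  "clen (Incr i) = 1" | "clen (Decr i) = 1" | "clen (Seq c1 c2) = clen c1 + clen c2" | "clen (Loop i c) = Suc (clen c)"

text \<open>\<open>p\<close> is the label where the code is placed and \<open>k\<close> the label to
  which it exits. A loop begins with a decrement instruction that doubles as its test.\<close>

fun code :: "com \<Rightarrow> nat \<Rightarrow> nat \<Rightarrow> instr list" where
  "code (Incr i) p k = [IInc i k]"
| "code (Decr i) p k = [IDec i k k]"
| "code (Seq c1 c2) p k = code c1 p (p + clen c1) @ code c2 (p + clen c1) k"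
| "code (Loop i c) p k = IDec i (Suc p) k # code c (Suc p) p"

lemma length_code [simp]: "length (code c p k) = clen c"
  by (induction c arbitrary: p k) auto

lemma clen_pos: "0 < clen c"
  by (induction c) auto

lemma ireg_code: "I \<in> set (code c p k) \<Longrightarrow> ireg I \<in> wrt c"
  by (induction c arbitrary: p k) auto

lemma run_frame: "i \<notin> wrt c \<Longrightarrow> run c s i = s i"
proof (induction c arbitrary: s)
  case (Loop j c)
  have "((\<lambda>s. run c (s(j := s j - 1))) ^^ n) s i = s i" for n
    using Loop by (induction n) auto
  then show ?case by simp
qed auto

definition loc :: "instr list \<Rightarrow> nat \<Rightarrow> instr list \<Rightarrow> bool" where
  "loc P p C \<longleftrightarrow> p + length C \<le> length P \<and> (\<forall>j < length C. P ! (p + j) = C ! j)"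

lemma loc_append: "loc P p (A @ B) \<Longrightarrow> loc P p A \<and> loc P (p + length A) B"
  unfolding loc_def
proof (intro conjI allI impI)
  assume h: "p + length (A @ B) \<le> length P \<and> (\<forall>j<length (A @ B). P ! (p + j) = (A @ B) ! j)"
  then show "p + length A \<le> length P" "p + length A + length B \<le> length P" by simp_all
  show "P ! (p + j) = A ! j" if "j < length A" for j
    using h that by (auto simp: nth_append dest!: spec[of _ j])
  show "P ! (p + length A + j) = B ! j" if "j < length B" for j
    using conjunct2[OF h, rule_format, of "length A + j"] that by (simp add: nth_append add.assoc)
qed

lemma loc_Cons: "loc P p (I # B) \<Longrightarrow> p < length P \<and> P ! p = I \<and> loc P (Suc p) B"
  using loc_append[of P p "[I]" B] by (auto simp: loc_def)

lemma mrun_1: "l < length P \<Longrightarrow> istep (P ! l) s = (l', s') \<Longrightarrow> l' < length P \<Longrightarrow> mrun P 1 l s l' s'"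
  using mr_step[OF _ mr_refl, of P l s l' s'] by (simp add: mstep_def)

lemma exec:
  assumes "wfc c" "loc P p (code c p k)" "k < length P"
  shows "\<exists>n. mrun P n p s k (run c s)"
  using assms
proof (induction c arbitrary: p k s)
  case (Incr i)
  then have "p < length P" "istep (P ! p) s = (k, run (Incr i) s)" using loc_Cons[of P p "IInc i k" "[]"] by simp_all
  then show ?case using mrun_1[of p P s k] Incr.prems by blast
next
  case (Decr i)
  have "s(i := 0) = s" if "s i = 0" using that by auto
  then have "p < length P" "istep (P ! p) s = (k, run (Decr i) s)"
    using Decr.prems loc_Cons[of P p "IDec i k k" "[]"] by simp_all
  then show ?case using mrun_1[of p P s k] Decr.prems by blast
next
  case (Seq c1 c2)
  have l: "loc P p (code c1 p (p + clen c1))" "loc P (p + clen c1) (code c2 (p + clen c1) k)"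
    using Seq.prems loc_append[of P p "code c1 p (p + clen c1)"] by simp_all
  have "p + clen c1 < length P" using l(2) clen_pos[of c2] by (simp add: loc_def)
  then obtain n1 where 1: "mrun P n1 p s (p + clen c1) (run c1 s)" using Seq.IH(1)[OF _ l(1)] Seq.prems by auto
  obtain n2 where "mrun P n2 (p + clen c1) (run c1 s) k (run c2 (run c1 s))" using Seq.IH(2)[OF _ l(2)] Seq.prems by auto
  then show ?case using mrun_trans[OF 1] by auto
next
  case (Loop i c)
  have l: "p < length P" "P ! p = IDec i (Suc p) k" "loc P (Suc p) (code c (Suc p) p)"
    using Loop.prems loc_Cons[of P p "IDec i (Suc p) k"] by simp_all
  have sp: "Suc p < length P" using l(3) clen_pos[of c] by (simp add: loc_def)
  have "\<exists>n. mrun P n p s k (((\<lambda>s. run c (s(i := s i - 1))) ^^ m) s)" if "s i = m" for m s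
    using that
  proof (induction m arbitrary: s)
    case 0
    then show ?case using mrun_1[of p P s k s] l Loop.prems by auto
  next
    case (Suc m)
    let ?s = "s(i := s i - 1)"
    have 1: "mrun P 1 p s (Suc p) ?s" using Suc.prems l sp by (intro mrun_1) auto
    obtain n2 where 2: "mrun P n2 (Suc p) ?s p (run c ?s)" using Loop.IH[OF _ l(3) l(1)] Loop.prems by auto
    have "run c ?s i = m" using run_frame[of i c ?s] Loop.prems Suc.prems by simp
    then obtain n3 where 3: "mrun P n3 p (run c ?s) k (((\<lambda>s. run c (s(i := s i - 1))) ^^ m) (run c ?s))"
      using Suc.IH by blast
    show ?case unfolding funpow_Suc_right o_apply using mrun_trans[OF mrun_trans[OF 1 2] 3] by blast
  qed
  then show ?case by simp
qed

text \<open>Execution may begin in the middle of the code, inside nested loops and with arbitrary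
  registers; loops still end, since a body does not write its loop register. The machine has to halt
  from all of these configurations.\<close>

lemma exec_any:
  assumes "wfc c" "loc P p (code c p k)" "k < length P" "p \<le> l" "l < p + clen c"
  shows "\<exists>n s'. mrun P n l s k s'"
  using assms
proof (induction c arbitrary: p k s l)
  case (Incr i)
  then show ?case using exec[OF Incr.prems(1-3)] by (metis clen.simps(1) le_antisym less_Suc_eq_le add.commute plus_1_eq_Suc)
next
  case (Decr i)
  then show ?case using exec[OF Decr.prems(1-3)] by (metis clen.simps(2) le_antisym less_Suc_eq_le add.commute plus_1_eq_Suc)
next
  case (Seq c1 c2)
  have l: "loc P p (code c1 p (p + clen c1))" "loc P (p + clen c1) (code c2 (p + clen c1) k)"
    using Seq.prems loc_append[of P p "code c1 p (p + clen c1)"] by simp_all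
  have w: "wfc c1" "wfc c2" using Seq.prems by auto
  have pl: "p + clen c1 < length P" using l(2) clen_pos[of c2] by (simp add: loc_def)
  show ?case
  proof (cases "l < p + clen c1")
    case True
    then obtain n s' where 1: "mrun P n l s (p + clen c1) s'" using Seq.IH(1)[OF w(1) l(1) pl] Seq.prems by blast
    obtain n2 where "mrun P n2 (p + clen c1) s' k (run c2 s')" using exec[OF w(2) l(2)] Seq.prems by blast
    then show ?thesis using mrun_trans[OF 1] by blast
  next
    case False
    then show ?thesis using Seq.IH(2)[OF w(2) l(2)] Seq.prems by simp
  qed
next
  case (Loop i c)
  have l: "p < length P" "loc P (Suc p) (code c (Suc p) p)"
    using Loop.prems loc_Cons[of P p "IDec i (Suc p) k"] by simp_all
  show ?case
  proof (cases "l = p")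
    case True
    then show ?thesis using exec[OF Loop.prems(1-3)] by blast
  next
    case False
    then have "wfc c" "Suc p \<le> l" "l < Suc p + clen c" using Loop.prems by simp_all
    then obtain n s' where 1: "mrun P n l s p s'" using Loop.IH[OF _ l(2,1)] by blast
    obtain n2 where "mrun P n2 p s' k (run (Loop i c) s')" using exec[OF Loop.prems(1-3)] by blast
    then show ?thesis using mrun_trans[OF 1] by blast
  qed
qed

text \<open>\<open>B\<close> is repeated until register \<open>e\<close> is 0. The test is a
  decrement instruction, so \<open>e\<close> loses one before the next round.\<close>

inductive until :: "com \<Rightarrow> nat \<Rightarrow> regs \<Rightarrow> regs \<Rightarrow> bool" for B e where
  until_stop: "run B s e = 0 \<Longrightarrow> until B e s (run B s)"
| until_again: "run B s e \<noteq> 0 \<Longrightarrow> until B e ((run B s)(e := run B s e - 1)) s' \<Longrightarrow> until B e s s'"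

text \<open>Register \<open>r\<close> starts at 0, because only register 0 receives the input, and
  grows by at most one in a step. So a run that ends with F j in it takes at least F j
  steps.\<close>

theorem until_theorem:
  assumes B: "wfc B" "wrt B \<subseteq> {..<D}" "e < D"
    and tot: "\<And>s. (\<And>i. D \<le> i \<Longrightarrow> s i = 0) \<Longrightarrow> \<exists>s'. until B e s s'"
    and val: "\<And>j s'. until B e ((\<lambda>_. 0)(0 := j)) s' \<Longrightarrow> s' r = F j" and r: "r \<noteq> 0"
  shows "\<exists>PG PH \<phi> c. fin_pres PG \<and> fin_pres PH \<and> subgroup_emb PH PG \<phi> \<and> dehn PG \<simeq> (\<lambda>n. n ^ 2) \<and>
    (\<forall>j n. 4 * 2 ^ j + c \<le> n \<longrightarrow> F j \<le> dehn PH n)"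
proof -
  define m where "m = clen B"
  \<comment> \<open>The exit label \<open>Suc m\<close> lies just outside the program, so the jump
    there halts the machine.\<close>
  define P where "P = code B 0 m @ [IDec e 0 (Suc m)]"
  have len: "length P = Suc m" by (simp add: P_def m_def)
  have lc: "loc P 0 (code B 0 m)" by (auto simp: loc_def P_def nth_append)
  have Pm: "P ! m = IDec e 0 (Suc m)" by (simp add: P_def m_def nth_append)
  have reg: "ireg I < D" if "I \<in> set P" for I using that ireg_code B by (fastforce simp: P_def)
  have zero: "s' i = 0" if "mrun P n l s l' s'" "\<And>i. D \<le> i \<Longrightarrow> s i = 0" "D \<le> i" for n l s l' s' i
  proof -
    have "\<forall>I\<in>set P. ireg I \<noteq> i" using reg that(3) by force
    then show ?thesis using mrun_reg(2)[OF that(1)] that(2,3) by simp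
  qed
  interpret cmachine P D using reg by unfold_locales (auto simp: P_def)
  have un: "\<exists>n. mrun P n 0 s m s' \<and> mhalts P m s'" if "until B e s s'" for s s'
    using that
  proof (induction rule: until.induct)
    case (until_stop s)
    then have "mstep P m (run B s) = None" by (simp add: mstep_def len Pm)
    then have "mhalts P m (run B s)" by (auto intro: mhalts)
    then show ?case using exec[OF B(1) lc, of s] len by auto
  next
    case (until_again s s')
    obtain n1 where 1: "mrun P n1 0 s m (run B s)" using exec[OF B(1) lc, of s] len by auto
    have 2: "mrun P 1 m (run B s) 0 ((run B s)(e := run B s e - 1))"
      using until_again.hyps(1) by (intro mrun_1) (auto simp: len Pm)
    from until_again.IH obtain n3 where 3: "mrun P n3 0 ((run B s)(e := run B s e - 1)) m s'" "mhalts P m s'" by blast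
    show ?case using mrun_trans[OF mrun_trans[OF 1 2] 3(1)] 3(2) by blast
  qed
  have h0: "mhalts P 0 s" if z: "\<And>i. D \<le> i \<Longrightarrow> s i = 0" for s
  proof -
    obtain s' where "until B e s s'" using tot[of s] z by blast
    then show ?thesis using un mrun_mhalts by blast
  qed
  have hm: "mhalts P m s" if z: "\<And>i. D \<le> i \<Longrightarrow> s i = 0" for s
  proof (rule mhalts)
    fix l' s' assume st: "mstep P m s = Some (l', s')"
    then have "l' = 0" by (auto simp: mstep_def len Pm split: if_splits)
    moreover have "mrun P 1 m s l' s'" using mr_step[OF st mr_refl] by simp
    ultimately show "mhalts P l' s'" using h0 zero z by blast
  qed
  have hl: "mhalts P l s" if "l < length P" "\<And>i. D < i \<Longrightarrow> s i = 0" for l s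
  proof -
    let ?s = "s(D := 0)"
    have z: "?s i = 0" if "D \<le> i" for i using that \<open>\<And>i. D < i \<Longrightarrow> s i = 0\<close> by auto
    have "mhalts P l ?s"
    proof (cases "l < m")
      case True
      then obtain n s' where "mrun P n l ?s m s'" using exec_any[OF B(1) lc, of l ?s] len m_def by auto
      then show ?thesis using hm zero z mrun_mhalts by metis
    next
      case False
      then show ?thesis using hm[of ?s] z that(1) len by (metis less_Suc_eq)
    qed
    moreover have "\<forall>I\<in>set P. ireg I \<noteq> D" using reg by fastforce
    ultimately have "mhalts P l (?s(D := s D))" by (metis mhalts_upd)
    then show ?thesis by simp
  qed
  obtain PG PH \<phi> c where Q: "fin_pres PG" "fin_pres PH" "subgroup_emb PH PG \<phi>" "dehn PG \<simeq> (\<lambda>n. n ^ 2)"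
    "\<And>k j l' s' n. mrun P k 0 ((\<lambda>_. 0)(0 := j)) l' s' \<Longrightarrow> 4 * 2 ^ j + c \<le> n \<Longrightarrow> k \<le> dehn PH n"
    using cmachine_theorem[OF hl] by blast
  have "F j \<le> dehn PH n" if n: "4 * 2 ^ j + c \<le> n" for j n
  proof -
    obtain s' where u: "until B e ((\<lambda>_. 0)(0 := j)) s'" using tot[of "(\<lambda>_. 0)(0 := j)"] B(3) by auto
    obtain k where k: "mrun P k 0 ((\<lambda>_. 0)(0 := j)) m s'" using un[OF u] by blast
    have "F j \<le> k" using mrun_reg(1)[OF k, of r] val[OF u] r by simp
    then show ?thesis using Q(5)[OF k n] by simp
  qed
  then show ?thesis using Q(1-4) by blast
qed

section \<open>Bounded evaluation of recursive functions\<close>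

primrec pri :: "(nat list \<Rightarrow> nat \<times> nat) \<Rightarrow> nat list \<Rightarrow> nat \<times> nat \<Rightarrow> nat \<Rightarrow> nat \<times> nat" where
  "pri G ys b 0 = b"
| "pri G ys b (Suc n) = (let (y, e) = pri G ys b n; (z, e') = G (y # n # ys) in (z, e + e'))"

text \<open>The candidate c advances only while the value at c is non-zero, so it stays at the first
  zero it meets.\<close>

primrec mni :: "(nat list \<Rightarrow> nat \<times> nat) \<Rightarrow> nat list \<Rightarrow> nat \<Rightarrow> nat \<times> nat" where
  "mni G ys 0 = (0, 0)"
| "mni G ys (Suc n) = (let (c, e) = mni G ys n; (v, e') = G (c # ys) in (c + (if v = 0 then 0 else 1), e + e'))"

text \<open>The value of p, with searches cut off after t rounds, and the number of failures that occurred.\<close>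

fun te :: "nat \<Rightarrow> recf \<Rightarrow> nat list \<Rightarrow> nat \<times> nat" where
  "te t Z xs = (0, 0)"
| "te t S xs = (case xs of [] \<Rightarrow> (0, 1) | x # _ \<Rightarrow> (Suc x, 0))"
| "te t (Id i) xs = (if i < length xs then (xs ! i, 0) else (0, 1))"
| "te t (Cn f gs) xs = (let rs = map (\<lambda>g. te t g xs) gs; (y, e) = te t f (map fst rs) in (y, sum_list (map snd rs) + e))"
| "te t (Pr f g) xs = (case xs of [] \<Rightarrow> (0, 1) | n # ys \<Rightarrow> pri (te t g) ys (te t f ys) n)"
| "te t (Mn f) xs = (let (c, e) = mni (te t f) xs t; (v, e') = te t f (c # xs) in (c, e + e' + (if v = 0 then 0 else 1)))"

lemma common_bound:
  assumes "\<forall>m<n. \<exists>t0. \<forall>t\<ge>t0. Q m t"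
  shows "\<exists>t0::nat. \<forall>t\<ge>t0. \<forall>m<(n::nat). Q m t"
  using assms
proof (induction n)
  case (Suc n)
  then obtain t0 t1 where "\<forall>t\<ge>t0. \<forall>m<n. Q m t" "\<forall>t\<ge>t1. Q n t" by (metis lessI less_Suc_eq)
  then show ?case by (intro exI[of _ "max t0 t1"]) (auto simp: less_Suc_eq)
qed simp

lemma te_complete:
  "eval p xs y \<Longrightarrow> \<exists>t0. \<forall>t\<ge>t0. te t p xs = (y, 0)"
  "eval_list gs xs ys \<Longrightarrow> \<exists>t0. \<forall>t\<ge>t0. map (\<lambda>g. te t g xs) gs = map (\<lambda>y. (y, 0)) ys"
proof (induction rule: eval_eval_list.inducts)
  case (eval_Cn gs xs ys f z)
  then obtain t0 t1 where "\<forall>t\<ge>t0. map (\<lambda>g. te t g xs) gs = map (\<lambda>y. (y, 0)) ys" "\<forall>t\<ge>t1. te t f ys = (z, 0)" by blast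
  then have "te t (Cn f gs) xs = (z, 0)" if "t \<ge> max t0 t1" for t
    using that by (simp add: o_def)
  then show ?case by blast
next
  case (eval_PrS f g n xs y z)
  then obtain t0 t1 where "\<forall>t\<ge>t0. te t (Pr f g) (n # xs) = (y, 0)" "\<forall>t\<ge>t1. te t g (y # n # xs) = (z, 0)" by blast
  then have "te t (Pr f g) (Suc n # xs) = (z, 0)" if "t \<ge> max t0 t1" for t
    using that by simp
  then show ?case by blast
next
  case (eval_Mn f n xs)
  have "\<forall>m<n. \<exists>t0. \<forall>t\<ge>t0. \<exists>y. y \<noteq> 0 \<and> te t f (m # xs) = (y, 0)" using eval_Mn by metis
  from common_bound[OF this] obtain t0 where t0: "\<forall>t\<ge>t0. \<forall>m<n. \<exists>y. y \<noteq> 0 \<and> te t f (m # xs) = (y, 0)" by blast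
  obtain t1 where t1: "\<forall>t\<ge>t1. te t f (n # xs) = (0, 0)" using eval_Mn by blast
  have "te t (Mn f) xs = (n, 0)" if t: "t \<ge> max n (max t0 t1)" for t
  proof -
    have a: "\<exists>y. y \<noteq> 0 \<and> te t f (m # xs) = (y, 0)" if "m < n" for m using t0 t that by auto
    have b: "te t f (n # xs) = (0, 0)" using t1 t by auto
    have "mni (te t f) xs j = (min j n, 0)" for j
    proof (induction j)
      case (Suc j)
      show ?case
      proof (cases "j < n")
        case True
        then obtain y where "y \<noteq> 0" "te t f (j # xs) = (y, 0)" using a by blast
        then show ?thesis using Suc True by simp
      next
        case False
        then show ?thesis using Suc b by simp
      qed
    qed simp
    moreover have "min t n = n" using t by simp
    ultimately show ?thesis using b by simp
  qed
  then show ?case by blast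
next
  case (evl_Cons g xs y gs ys)
  then obtain t0 t1 where "\<forall>t\<ge>t0. te t g xs = (y, 0)" "\<forall>t\<ge>t1. map (\<lambda>g. te t g xs) gs = map (\<lambda>y. (y, 0)) ys" by blast
  then have "map (\<lambda>g. te t g xs) (g # gs) = map (\<lambda>y. (y, 0)) (y # ys)" if "t \<ge> max t0 t1" for t
    using that by simp
  then show ?case by blast
qed auto

text \<open>Once the candidate of a search rests on a zero, further rounds do not move it. With
  \<open>te_complete\<close> this makes failure-free results correct: such a result persists for
  larger t, where it must be the true value.\<close>

lemma te_mono: "te t p xs = (y, 0) \<Longrightarrow> t \<le> t' \<Longrightarrow> te t' p xs = (y, 0)"
proof (induction p arbitrary: xs y)
  case (Cn f gs)
  let ?r = "\<lambda>t. map (\<lambda>g. te t g xs) gs"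
  obtain e where e: "te t f (map fst (?r t)) = (y, e)" "sum_list (map snd (?r t)) + e = 0"
    using Cn.prems by (auto simp: Let_def split: prod.splits)
  then have z: "snd (te t g xs) = 0" if "g \<in> set gs" for g using that by auto
  have "te t' g xs = te t g xs" if "g \<in> set gs" for g
    using Cn.IH(2)[OF that, of xs "fst (te t g xs)"] z[OF that] Cn.prems(2) by (metis prod.collapse)
  then have r: "?r t' = ?r t" by simp
  have "te t' f (map fst (?r t)) = (y, 0)" using Cn.IH(1) e Cn.prems(2) by simp
  moreover have "sum_list (map snd (?r t)) = 0" using e(2) by blast
  ultimately show ?case unfolding te.simps Let_def r by simp
next
  case (Pr f g)
  obtain n ys where xs: "xs = n # ys" using Pr.prems by (cases xs) auto
  have "pri (te t' g) ys (te t' f ys) n = (y, 0)" if "pri (te t g) ys (te t f ys) n = (y, 0)" for n y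
    using that
  proof (induction n arbitrary: y)
    case 0
    then show ?case using Pr.IH(1) Pr.prems(2) by simp
  next
    case (Suc n)
    obtain z e where z: "pri (te t g) ys (te t f ys) n = (z, e)" by force
    then have e: "e = 0" "te t g (z # n # ys) = (y, 0)" using Suc.prems by (auto split: prod.splits)
    then show ?case using Suc.IH z Pr.IH(2) Pr.prems(2) by simp
  qed
  then show ?case using Pr.prems(1) xs by simp
next
  case (Mn f)
  obtain c e where c: "mni (te t f) xs t = (c, e)" by force
  obtain v e' where v: "te t f (c # xs) = (v, e')" by force
  have h: "c = y" "e = 0" "e' = 0" "v = 0" using Mn.prems(1) c v by (auto split: if_splits)
  have b: "te t' f (c # xs) = (0, 0)" using Mn.IH v h Mn.prems(2) by simp
  have s: "mni (te t' f) xs j = (c', 0)" if "mni (te t f) xs j = (c', 0)" for j c'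
    using that
  proof (induction j arbitrary: c')
    case (Suc j)
    obtain d e where d: "mni (te t f) xs j = (d, e)" by force
    obtain v e' where v: "te t f (d # xs) = (v, e')" by force
    have "e = 0" "e' = 0" using Suc.prems d v by auto
    then show ?case using Suc.IH[of d] Suc.prems d v Mn.IH[of "d # xs" v] Mn.prems(2) by simp
  qed simp
  have "mni (te t' f) xs (t + k) = (c, 0)" for k
    using s[of t c] c h b by (induction k) auto
  then have "mni (te t' f) xs t' = (c, 0)" using Mn.prems(2) by (metis le_add_diff_inverse)
  then show ?case using b h by simp
qed (auto split: list.splits if_splits)

section \<open>Compilation of recursive functions to loop programs\<close>

text \<open>\<open>f j\<close> describes the registers after j rounds except for the loop register,
  whose content is forced.\<close>

lemma run_Loop_inv:
  assumes "\<And>j. j < n \<Longrightarrow> run c ((f j)(i := n - Suc j)) = (f (Suc j))(i := n - Suc j)" "s = (f 0)(i := n)"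
  shows "run (Loop i c) s = (f n)(i := 0)"
proof -
  have "((\<lambda>s. run c (s(i := s i - 1))) ^^ j) s = (f j)(i := n - j)" if "j \<le> n" for j
    using that
  proof (induction j)
    case (Suc j)
    let ?G = "\<lambda>s. run c (s(i := s i - 1))"
    have "(?G ^^ Suc j) s = ?G ((?G ^^ j) s)" unfolding funpow.simps o_apply ..
    also have "(?G ^^ j) s = (f j)(i := n - j)" by (rule Suc.IH) (use Suc.prems in simp)
    also have "?G ((f j)(i := n - j)) = run c ((f j)(i := n - Suc j))" by simp
    also have "\<dots> = (f (Suc j))(i := n - Suc j)" by (rule assms(1)) (use Suc.prems in simp)
    finally show ?case .
  qed (simp add: assms(2))
  from this[of n] show ?thesis using assms(2) by simp
qed

declare run.simps(4) [simp del]

text \<open>There is no empty command, in accordance with \<open>clen_pos\<close>; a neutral pair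
  takes its place.\<close>

definition skp :: "nat \<Rightarrow> com" where "skp z = Seq (Incr z) (Decr z)"
definition clr :: "nat \<Rightarrow> nat \<Rightarrow> com" where "clr i z = Loop i (skp z)"
definition mov :: "nat \<Rightarrow> nat \<Rightarrow> com" where "mov a b = Loop a (Incr b)"
definition cpy :: "nat \<Rightarrow> nat \<Rightarrow> nat \<Rightarrow> com" where "cpy a b t = Seq (Loop a (Seq (Incr b) (Incr t))) (mov t a)"
definition sg :: "nat \<Rightarrow> nat \<Rightarrow> nat \<Rightarrow> com" where "sg v w z = Loop v (Seq (clr w z) (Incr w))"

lemma run_skp [simp]: "run (skp z) s = s"
  by (simp add: skp_def)

lemma run_clr [simp]: "i \<noteq> z \<Longrightarrow> run (clr i z) s = s(i := 0)"
  unfolding clr_def using run_Loop_inv[of "s i" "skp z" "\<lambda>j. s" i s] by simp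

lemma run_mov [simp]: "a \<noteq> b \<Longrightarrow> run (mov a b) s = s(a := 0, b := s b + s a)"
  unfolding mov_def using run_Loop_inv[of "s a" "Incr b" "\<lambda>j. s(b := s b + j)" a s] by (simp add: fun_upd_twist)

lemma run_cpy [simp]:
  assumes "a \<noteq> b" "a \<noteq> t" "b \<noteq> t" "s t = 0"
  shows "run (cpy a b t) s = s(b := s b + s a)"
proof -
  have "run (Loop a (Seq (Incr b) (Incr t))) s = (s(b := s b + s a, t := s a))(a := 0)"
    by (rule run_Loop_inv[of "s a" _ "\<lambda>j. s(b := s b + j, t := j)"]) (use assms in \<open>auto simp: fun_eq_iff\<close>)
  then show ?thesis using assms by (auto simp: cpy_def fun_eq_iff)
qed

lemma run_sg [simp]:
  assumes "v \<noteq> w" "z \<noteq> v" "z \<noteq> w"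
  shows "run (sg v w z) s = s(v := 0, w := if s v = 0 then s w else 1)"
proof -
  have "run (Loop v (Seq (clr w z) (Incr w))) s = (s(w := if s v = 0 then s w else 1))(v := 0)"
    by (rule run_Loop_inv[of "s v" _ "\<lambda>j. s(w := if j = 0 then s w else 1)"]) (use assms in \<open>auto simp: fun_eq_iff\<close>)
  then show ?thesis using assms by (auto simp: sg_def fun_eq_iff)
qed

lemma wrt_macros [simp]: "wrt (skp z) = {z}" "wrt (clr i z) = {i, z}" "wrt (mov a b) = {a, b}" "wrt (cpy a b t) = {a, b, t}"
  "wrt (sg v w z) = {v, w, z}"
  by (auto simp: skp_def clr_def mov_def cpy_def sg_def)

lemma wfc_macros [simp]: "wfc (skp z)" "wfc (clr i z) \<longleftrightarrow> i \<noteq> z" "wfc (mov a b) \<longleftrightarrow> a \<noteq> b"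
  "wfc (cpy a b t) \<longleftrightarrow> a \<noteq> b \<and> a \<noteq> t" "wfc (sg v w z) \<longleftrightarrow> v \<noteq> w \<and> v \<noteq> z \<and> w \<noteq> z"
  by (auto simp: skp_def clr_def[unfolded skp_def] mov_def cpy_def sg_def)

fun seqs :: "nat \<Rightarrow> com list \<Rightarrow> com" where
  "seqs z [] = skp z" | "seqs z (c # cs) = Seq c (seqs z cs)"

lemma wrt_seqs: "wrt (seqs z cs) = {z} \<union> (\<Union>c\<in>set cs. wrt c)" and wfc_seqs: "wfc (seqs z cs) \<longleftrightarrow> (\<forall>c\<in>set cs. wfc c)"
  by (induction cs) auto

lemma run_clrs: "z \<notin> set is \<Longrightarrow> run (seqs z (map (\<lambda>i. clr i z) is)) s = (\<lambda>i. if i \<in> set is then 0 else s i)"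
  by (induction "is" arbitrary: s) (auto simp: fun_eq_iff)

text \<open>\<open>as\<close> holds the arguments, \<open>r\<close> receives the result and is 0 at
  the start, \<open>e\<close> counts failures, \<open>t\<close> is the cut-off, and registers from
  \<open>d\<close> on are free and 0. Primitive recursion keeps the value in d, the index in d + 1,
  the remaining rounds in d + 2 and the next value in d + 3; a search keeps the candidate in d, the
  value there in d + 1, the remaining rounds in d + 2 and the next candidate in d + 3. Clearing uses
  \<open>e\<close> as scratch without changing it.\<close>

function compile :: "recf \<Rightarrow> nat list \<Rightarrow> nat \<Rightarrow> nat \<Rightarrow> nat \<Rightarrow> nat \<Rightarrow> com" where
  "compile Z as r e t d = skp e"
| "compile S as r e t d = (case as of [] \<Rightarrow> Incr e | a # _ \<Rightarrow> Seq (cpy a r d) (Incr r))"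
| "compile (Id i) as r e t d = (if i < length as then cpy (as ! i) r d else Incr e)"
| "compile (Cn f gs) as r e t d =
    Seq (seqs e (map (\<lambda>j. compile (gs ! j) as (d + j) e t (d + length gs)) [0..<length gs]))
     (Seq (compile f [d..<d + length gs] r e t (d + length gs)) (seqs e (map (\<lambda>j. clr j e) [d..<d + length gs])))"
| "compile (Pr f g) as r e t d = (case as of [] \<Rightarrow> Incr e | a # bs \<Rightarrow>
    Seq (compile f bs d e t (d + 4)) (Seq (cpy a (d + 2) (d + 4))
     (Seq (Loop (d + 2) (Seq (compile g (d # (d + 1) # bs) (d + 3) e t (d + 4)) (Seq (clr d e) (Seq (mov (d + 3) d) (Incr (d + 1))))))
     (Seq (mov d r) (clr (d + 1) e)))))"
| "compile (Mn f) as r e t d = Seq (cpy t (d + 2) (d + 4))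
    (Seq (Loop (d + 2) (Seq (compile f (d # as) (d + 1) e t (d + 4)) (Seq (sg (d + 1) (d + 3) e) (mov (d + 3) d))))
    (Seq (compile f (d # as) (d + 1) e t (d + 4)) (Seq (sg (d + 1) (d + 3) e) (Seq (mov (d + 3) e) (mov d r)))))"
  by pat_completeness auto
termination
proof (relation "measure (\<lambda>(p, _). size p)")
  fix f :: recf and gs :: "recf list" and as r e t d j
  assume "j \<in> set [0..<length gs]"
  then have "size (gs ! j) < Suc (size_list size gs)" using size_list_estimation'[of "gs ! j" gs _ size] by (simp add: less_Suc_eq_le)
  then show "((gs ! j, as, d + j, e, t, d + length gs), Cn f gs, as, r, e, t, d) \<in> measure (\<lambda>(p, _). size p)" by simp
qed auto

definition okr :: "nat list \<Rightarrow> nat \<Rightarrow> nat \<Rightarrow> nat \<Rightarrow> nat \<Rightarrow> bool" where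
  "okr as r e t d \<longleftrightarrow> r \<noteq> e \<and> r \<noteq> t \<and> e \<noteq> t \<and> {r, e, t} \<inter> set as = {} \<and> {r, e, t} \<union> set as \<subseteq> {..<d}"

lemma compile_wf: "okr as r e t d \<Longrightarrow> wfc (compile p as r e t d) \<and> wrt (compile p as r e t d) \<subseteq> set as \<union> {r, e, t} \<union> {d..}"
proof (induction p arbitrary: as r e t d)
  case Z then show ?case by simp
next
  case S then show ?case by (cases as) (auto simp: okr_def)
next
  case (Id i)
  then have "i < length as \<Longrightarrow> as ! i \<noteq> r \<and> as ! i < d" using nth_mem by (fastforce simp: okr_def)
  then show ?case by (auto simp: less_imp_neq)
next
  case (Cn f gs)
  let ?D = "d + length gs"
  have 1: "wfc (compile (gs ! j) as (d + j) e t ?D) \<and> wrt (compile (gs ! j) as (d + j) e t ?D) \<subseteq> set as \<union> {d + j, e, t} \<union> {?D..}"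
    if "j < length gs" for j
    using Cn.prems that by (intro Cn.IH(2)) (auto simp: okr_def)
  have 2: "wfc (compile f [d..<?D] r e t ?D) \<and> wrt (compile f [d..<?D] r e t ?D) \<subseteq> set [d..<?D] \<union> {r, e, t} \<union> {?D..}"
    using Cn.prems by (intro Cn.IH(1)) (auto simp: okr_def)
  have e: "e < d" using Cn.prems by (simp add: okr_def)
  have "wfc (compile (Cn f gs) as r e t d)" using 1 2 e by (auto simp: wfc_seqs)
  moreover have "wrt (compile (Cn f gs) as r e t d) \<subseteq> set as \<union> {r, e, t} \<union> {d..}"
    using 1 2 by (fastforce simp: wrt_seqs)
  ultimately show ?case by blast
next
  case (Pr f g)
  show ?case
  proof (cases as)
    case (Cons a bs)
    have 1: "wfc (compile f bs d e t (d + 4)) \<and> wrt (compile f bs d e t (d + 4)) \<subseteq> set bs \<union> {d, e, t} \<union> {d + 4..}"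
      using Pr.prems Cons by (intro Pr.IH(1)) (auto simp: okr_def)
    have 2: "wfc (compile g (d # (d + 1) # bs) (d + 3) e t (d + 4)) \<and>
      wrt (compile g (d # (d + 1) # bs) (d + 3) e t (d + 4)) \<subseteq> set (d # (d + 1) # bs) \<union> {d + 3, e, t} \<union> {d + 4..}"
      using Pr.prems Cons by (intro Pr.IH(2)) (auto simp: okr_def)
    have l: "a < d" "e < d" "r < d" "t < d" "\<forall>b\<in>set bs. b < d" using Pr.prems Cons by (auto simp: okr_def)
    have n: "d + 2 \<notin> wrt (compile g (d # (d + 1) # bs) (d + 3) e t (d + 4))" using 2 l by fastforce
    have "wfc (compile (Pr f g) as r e t d)" using 1 2 l n Cons by auto
    moreover have "wrt (compile (Pr f g) as r e t d) \<subseteq> set as \<union> {r, e, t} \<union> {d..}"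
      using 1 2 Cons by fastforce
    ultimately show ?thesis by blast
  qed simp
next
  case (Mn f)
  have 2: "wfc (compile f (d # as) (d + 1) e t (d + 4)) \<and>
    wrt (compile f (d # as) (d + 1) e t (d + 4)) \<subseteq> set (d # as) \<union> {d + 1, e, t} \<union> {d + 4..}"
    using Mn.prems by (intro Mn.IH) (auto simp: okr_def)
  have l: "e < d" "r < d" "t < d" "e \<noteq> t" "\<forall>b\<in>set as. b < d" using Mn.prems by (auto simp: okr_def)
  have n: "d + 2 \<notin> wrt (compile f (d # as) (d + 1) e t (d + 4))" using 2 l by fastforce
  have "wfc (compile (Mn f) as r e t d)" using 2 l n by auto
  moreover have "wrt (compile (Mn f) as r e t d) \<subseteq> set as \<union> {r, e, t} \<union> {d..}"
    using 2 by fastforce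
  ultimately show ?case by blast
qed

text \<open>Arguments, cut-off and scratch registers are restored, the latter to 0; this allows the
  code to be run again inside a loop.\<close>

lemma compile_correct:
  assumes "okr as r e t d" "s r = 0" "\<And>i. d \<le> i \<Longrightarrow> s i = 0"
  shows "run (compile p as r e t d) s = s(r := fst (te (s t) p (map s as)), e := s e + snd (te (s t) p (map s as)))"
  using assms
proof (induction p arbitrary: as r e t d s)
  case Z
  then have "s(r := 0) = s" by auto
  then show ?case by simp
next
  case S
  show ?case
  proof (cases as)
    case Nil
    have "s(r := 0) = s" using S by auto
    then show ?thesis using Nil by simp
  next
    case (Cons a bs)
    have "a \<noteq> r" "a \<noteq> d" "r \<noteq> d" "s d = 0" "r \<noteq> e" using S Cons by (auto simp: okr_def)
    then show ?thesis using Cons S by (auto simp: fun_eq_iff)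
  qed
next
  case (Id i)
  show ?case
  proof (cases "i < length as")
    case True
    then have "as ! i \<in> set as" by simp
    then have "as ! i \<noteq> r" "as ! i \<noteq> d" "r \<noteq> d" "s d = 0" "r \<noteq> e" using Id by (auto simp: okr_def)
    then show ?thesis using True Id by (auto simp: fun_eq_iff)
  next
    case False
    have "s(r := 0) = s" using Id by auto
    then show ?thesis using False by simp
  qed
next
  case (Cn f gs)
  let ?D = "d + length gs" and ?v = "\<lambda>j. te (s t) (gs ! j) (map s as)"
  have ok: "r < d" "e < d" "t < d" "r \<noteq> e" "t \<noteq> e" "e \<noteq> r" "\<forall>a\<in>set as. a < d \<and> a \<noteq> e" using Cn.prems(1) by (auto simp: okr_def)
  \<comment> \<open>In \<open>st j\<close> the first j values lie in the registers from d on, and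
    their failures are added to e.\<close>
  define st where "st = (\<lambda>j i. if d \<le> i \<and> i < d + j then fst (?v (i - d)) else if i = e then s e + (\<Sum>m<j. snd (?v m)) else s i)"
  have stp: "run (compile (gs ! j) as (d + j) e t ?D) (st j) = st (Suc j)" if j: "j < length gs" for j
  proof -
    have 1: "okr as (d + j) e t ?D" using Cn.prems(1) j by (auto simp: okr_def)
    have 2: "st j (d + j) = 0" using Cn.prems(3)[of "d + j"] ok by (simp add: st_def)
    have 3: "st j i = 0" if "?D \<le> i" for i using Cn.prems(3)[of i] ok j that by (simp add: st_def)
    have 4: "map (st j) as = map s as" "st j t = s t" using ok by (auto simp: st_def)
    have "gs ! j \<in> set gs" using j by simp
    from Cn.IH(2)[where s = "st j", OF this 1 2 3] have "run (compile (gs ! j) as (d + j) e t ?D) (st j) = (st j)(d + j := fst (?v j), e := st j e + snd (?v j))"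
      unfolding 4 .
    also have "\<dots> = st (Suc j)" using ok by (auto simp: fun_eq_iff st_def less_Suc_eq)
    finally show ?thesis .
  qed
  have "run (seqs e (map (\<lambda>j. compile (gs ! j) as (d + j) e t ?D) [m..<length gs])) (st m) = st (length gs)" if "m \<le> length gs" for m
    using that by (induction "length gs - m" arbitrary: m) (auto simp: upt_rec stp Suc_le_eq)
  from this[of 0] have A: "run (seqs e (map (\<lambda>j. compile (gs ! j) as (d + j) e t ?D) [0..<length gs])) s = st (length gs)"
  proof -
    have "st 0 = s" using ok by (auto simp: st_def fun_eq_iff)
    then show ?thesis using \<open>0 \<le> length gs \<Longrightarrow> _\<close> by simp
  qed
  let ?rs = "map (\<lambda>g. te (s t) g (map s as)) gs"
  have m: "map (st (length gs)) [d..<?D] = map fst ?rs"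
    by (rule nth_equalityI) (auto simp: st_def)
  have sm: "(\<Sum>m<length gs. snd (?v m)) = sum_list (map snd ?rs)"
    by (simp add: sum_list_sum_nth atLeast0LessThan)
  have 1: "okr [d..<?D] r e t ?D" using Cn.prems(1) by (auto simp: okr_def)
  have 2: "st (length gs) r = 0" using Cn.prems(2) ok by (simp add: st_def)
  have 3: "st (length gs) i = 0" if "?D \<le> i" for i using Cn.prems(3)[of i] ok that by (simp add: st_def)
  have tt: "st (length gs) t = s t" using ok by (simp add: st_def)
  have B: "run (compile f [d..<?D] r e t ?D) (st (length gs)) = (st (length gs))(r := fst (te (s t) f (map fst ?rs)),
      e := st (length gs) e + snd (te (s t) f (map fst ?rs)))"
    using Cn.IH(1)[where s = "st (length gs)", OF 1 2 3] unfolding m tt .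
  have C: "e \<notin> set [d..<?D]" using ok by simp
  have "run (compile (Cn f gs) as r e t d) s = (\<lambda>i. if i \<in> set [d..<?D] then 0 else ((st (length gs))(r := fst (te (s t) f (map fst ?rs)),
      e := st (length gs) e + snd (te (s t) f (map fst ?rs)))) i)"
    by (simp only: compile.simps run.simps A B run_clrs[OF C])
  also have "\<dots> = s(r := fst (te (s t) f (map fst ?rs)), e := s e + (sum_list (map snd ?rs) + snd (te (s t) f (map fst ?rs))))"
    using ok Cn.prems(3) sm by (auto simp: fun_eq_iff st_def)
  finally show ?case unfolding te.simps Let_def case_prod_beta fst_conv snd_conv .
next
  case (Pr f g)
  show ?case
  proof (cases as)
    case Nil
    have "s(r := 0) = s" using Pr by auto
    then show ?thesis using Nil by simp
  next
    case (Cons a bs)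
    have ok: "r < d" "e < d" "t < d" "r \<noteq> e" "t \<noteq> e" "t \<noteq> r" "a < d" "a \<noteq> e" "\<forall>b\<in>set bs. b < d \<and> b \<noteq> e"
      using Pr.prems(1) Cons by (auto simp: okr_def)
    define W where "W = pri (te (s t) g) (map s bs) (te (s t) f (map s bs))"
    define st where "st = (\<lambda>j. s(d := fst (W j), d + 1 := j, e := s e + snd (W j)))"
    have z: "s (d + k) = 0" for k using Pr.prems(3) by simp
    have 1: "run (compile f bs d e t (d + 4)) s = st 0"
    proof -
      have "okr bs d e t (d + 4)" using Pr.prems(1) Cons by (auto simp: okr_def)
      from Pr.IH(1)[OF this, of s] show ?thesis using Pr.prems(3) z[of 1] by (auto simp: st_def W_def fun_eq_iff)
    qed
    have 2: "run (cpy a (d + 2) (d + 4)) (st 0) = (st 0)(d + 2 := s a)"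
      using ok z[of 2] z[of 4] by (subst run_cpy) (auto simp: st_def)
    have 3: "run (Loop (d + 2) (Seq (compile g (d # (d + 1) # bs) (d + 3) e t (d + 4)) (Seq (clr d e) (Seq (mov (d + 3) d) (Incr (d + 1))))))
       ((st 0)(d + 2 := s a)) = (st (s a))(d + 2 := 0)"
    proof (rule run_Loop_inv[where f = st])
      fix j assume "j < s a"
      let ?X = "(st j)(d + 2 := s a - Suc j)"
      have o: "okr (d # (d + 1) # bs) (d + 3) e t (d + 4)" using Pr.prems(1) Cons by (auto simp: okr_def)
      have x3: "?X (d + 3) = 0" using ok z[of 3] by (simp add: st_def)
      have x4: "?X i = 0" if "d + 4 \<le> i" for i using ok Pr.prems(3)[of i] that by (simp add: st_def)
      have m: "map ?X (d # (d + 1) # bs) = fst (W j) # j # map s bs" "?X t = s t" using ok by (auto simp: st_def)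
      have w: "W (Suc j) = (fst (te (s t) g (fst (W j) # j # map s bs)), snd (W j) + snd (te (s t) g (fst (W j) # j # map s bs)))"
        by (simp add: W_def Let_def case_prod_beta)
      have "run (compile g (d # (d + 1) # bs) (d + 3) e t (d + 4)) ?X =
          ?X(d + 3 := fst (W (Suc j)), e := ?X e + snd (te (s t) g (fst (W j) # j # map s bs)))"
        using Pr.IH(2)[where s = ?X, OF o x3 x4] unfolding m w fst_conv .
      then show "run (Seq (compile g (d # (d + 1) # bs) (d + 3) e t (d + 4)) (Seq (clr d e) (Seq (mov (d + 3) d) (Incr (d + 1))))) ?X
          = (st (Suc j))(d + 2 := s a - Suc j)"
        using ok z[of 3] w by (auto simp: fun_eq_iff st_def)
    qed simp
    have "run (compile (Pr f g) as r e t d) s = run (Seq (mov d r) (clr (d + 1) e)) ((st (s a))(d + 2 := 0))"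
      unfolding Cons compile.simps list.case run.simps(3) 1 2 3 ..
    also have "\<dots> = s(r := fst (W (s a)), e := s e + snd (W (s a)))"
      using ok z[of 0] z[of 1] z[of 2] Pr.prems(2) by (auto simp: fun_eq_iff st_def)
    finally show ?thesis unfolding W_def Cons te.simps list.case list.map .
  qed
next
  case (Mn f)
  have ok: "r < d" "e < d" "t < d" "r \<noteq> e" "t \<noteq> e" "t \<noteq> r" "\<forall>b\<in>set as. b < d \<and> b \<noteq> e"
    using Mn.prems(1) by (auto simp: okr_def)
  define W where "W = mni (te (s t) f) (map s as)"
  define st where "st = (\<lambda>j. s(d := fst (W j), e := s e + snd (W j)))"
  define V where "V = (\<lambda>j. te (s t) f (fst (W j) # map s as))"
  have z: "s (d + k) = 0" for k using Mn.prems(3) by simp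
  have w: "W (Suc j) = (fst (W j) + (if fst (V j) = 0 then 0 else 1), snd (W j) + snd (V j))" for j
    by (simp add: W_def V_def Let_def case_prod_beta)
  have o: "okr (d # as) (d + 1) e t (d + 4)" using Mn.prems(1) by (auto simp: okr_def)
  have c: "run (compile f (d # as) (d + 1) e t (d + 4)) ((st j)(d + 2 := k)) =
      ((st j)(d + 2 := k))(d + 1 := fst (V j), e := s e + snd (W j) + snd (V j))" for j k
  proof -
    let ?X = "(st j)(d + 2 := k)"
    have x1: "?X (d + 1) = 0" using ok z[of 1] by (simp add: st_def)
    have x4: "?X i = 0" if "d + 4 \<le> i" for i using ok Mn.prems(3)[of i] that by (simp add: st_def)
    have m: "map ?X (d # as) = fst (W j) # map s as" "?X t = s t" "?X e = s e + snd (W j)" using ok by (auto simp: st_def)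
    show ?thesis using Mn.IH[where s = ?X, OF o x1 x4] unfolding m V_def .
  qed
  have 1: "run (cpy t (d + 2) (d + 4)) s = (st 0)(d + 2 := s t)"
    using ok z[of 0] z[of 2] z[of 4] by (subst run_cpy) (auto simp: st_def W_def fun_eq_iff)
  have 2: "run (Loop (d + 2) (Seq (compile f (d # as) (d + 1) e t (d + 4)) (Seq (sg (d + 1) (d + 3) e) (mov (d + 3) d))))
     ((st 0)(d + 2 := s t)) = (st (s t))(d + 2 := 0)"
  proof (rule run_Loop_inv[where f = st])
    fix j assume "j < s t"
    show "run (Seq (compile f (d # as) (d + 1) e t (d + 4)) (Seq (sg (d + 1) (d + 3) e) (mov (d + 3) d))) ((st j)(d + 2 := s t - Suc j))
       = (st (Suc j))(d + 2 := s t - Suc j)"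
      unfolding run.simps(3) c using ok z[of 1] z[of 3] w[of j] by (auto simp: fun_eq_iff st_def)
  qed simp
  have "run (compile (Mn f) as r e t d) s = run (Seq (sg (d + 1) (d + 3) e) (Seq (mov (d + 3) e) (mov d r)))
     (((st (s t))(d + 2 := 0))(d + 1 := fst (V (s t)), e := s e + snd (W (s t)) + snd (V (s t))))"
    unfolding compile.simps run.simps(3) 1 2 c ..
  also have "\<dots> = s(r := fst (W (s t)), e := s e + (snd (W (s t)) + snd (V (s t)) + (if fst (V (s t)) = 0 then 0 else 1)))"
    using ok z[of 0] z[of 1] z[of 2] z[of 3] Mn.prems(2) by (auto simp: fun_eq_iff st_def)
  finally show ?case unfolding W_def V_def te.simps Let_def case_prod_beta fst_conv snd_conv .
qed

lemma finite_wrt: "finite (wrt c)"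
  by (induction c) auto

theorem recursive_theorem:
  assumes F: "\<And>n. eval p [n] (F n)"
  shows "\<exists>PG PH \<phi> c. fin_pres PG \<and> fin_pres PH \<and> subgroup_emb PH PG \<phi> \<and> dehn PG \<simeq> (\<lambda>n. n ^ 2) \<and>
    (\<forall>j n. 4 * 2 ^ j + c \<le> n \<longrightarrow> F j \<le> dehn PH n)"
proof -
  define C where "C = compile p [0] 1 2 3 4"
  have ok: "okr [0] 1 2 3 4" by (auto simp: okr_def)
  have wC: "wfc C" using compile_wf[OF ok] by (simp add: C_def)
  obtain D0 where "wrt C \<subseteq> {..<D0}" using finite_wrt finite_nat_iff_bounded by blast
  define D where "D = max D0 4"
  have D: "wrt C \<subseteq> {..<D}" "4 \<le> D" using \<open>wrt C \<subseteq> {..<D0}\<close> by (auto simp: D_def)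
  \<comment> \<open>Only the input in register 0 and the cut-off in register 3 survive from round to
    round. The other registers below D are cleared, as the machine may start with arbitrary
    contents; register 2 serves as scratch for this and is cleared last, with register 3 as its
    scratch.\<close>
  define B where "B = Seq (seqs 2 (map (\<lambda>i. clr i 2) (1 # [4..<D]))) (Seq (clr 2 3) (Seq (Incr 3) C))"
  have wB: "wfc B" "wrt B \<subseteq> {..<D}" using wC D by (auto simp: B_def wfc_seqs wrt_seqs simp del: list.map)
  have rB: "run B s 0 = s 0" "run B s 3 = Suc (s 3)" "run B s 1 = fst (te (Suc (s 3)) p [s 0])"
      "run B s 2 = snd (te (Suc (s 3)) p [s 0])" "\<forall>i\<ge>D. run B s i = 0"
    if s: "\<forall>i\<ge>D. s i = 0" for s
  proof -
    define s1 where "s1 = (\<lambda>i. if i \<in> set (1 # [4..<D]) \<or> i = 2 then 0 else if i = 3 then Suc (s 3) else s i)"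
    have "run (seqs 2 (map (\<lambda>i. clr i 2) (1 # [4..<D]))) s = (\<lambda>i. if i \<in> set (1 # [4..<D]) then 0 else s i)"
      by (rule run_clrs) simp
    then have "run B s = run C s1" by (auto simp: B_def s1_def fun_eq_iff intro!: arg_cong[of _ _ "\<lambda>s. run C s _"] simp del: list.map)
    also have "\<dots> = s1(1 := fst (te (s1 3) p (map s1 [0])), 2 := s1 2 + snd (te (s1 3) p (map s1 [0])))"
      unfolding C_def by (rule compile_correct[OF ok]) (use s in \<open>auto simp: s1_def\<close>)
    finally have e: "run B s = s1(1 := fst (te (Suc (s 3)) p [s 0]), 2 := snd (te (Suc (s 3)) p [s 0]))"
      by (simp add: s1_def)
    show "run B s 0 = s 0" "run B s 3 = Suc (s 3)" "run B s 1 = fst (te (Suc (s 3)) p [s 0])"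
      "run B s 2 = snd (te (Suc (s 3)) p [s 0])" "\<forall>i\<ge>D. run B s i = 0"
      unfolding e using s D(2) by (auto simp: s1_def)
  qed
  have tot: "\<exists>s'. until B 2 s s'" if "\<And>i. D \<le> i \<Longrightarrow> s i = 0" for s
  proof -
    obtain t0 where t0: "\<forall>t\<ge>t0. te t p [s 0] = (F (s 0), 0)" using te_complete(1)[OF F] by blast
    \<comment> \<open>The cut-off grows in each round, and from t0 on there are no failures.\<close>
    have "\<exists>s'. until B 2 s1 s'" if "\<forall>i\<ge>D. s1 i = 0" "s1 0 = s 0" for s1
      using that
    proof (induction "t0 - s1 3" arbitrary: s1 rule: less_induct)
      case less
      note R = rB[OF less.prems(1)]
      show ?case
      proof (cases "run B s1 2 = 0")
        case True
        then show ?thesis using until_stop by blast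
      next
        case False
        then have "s1 3 < t0" using R(4) t0 less.prems(2) by (metis le_SucI not_less snd_conv)
        let ?s = "(run B s1)(2 := run B s1 2 - 1)"
        have "t0 - ?s 3 < t0 - s1 3" using \<open>s1 3 < t0\<close> R(2) by simp
        moreover have "\<forall>i\<ge>D. ?s i = 0" "?s 0 = s 0" using R less.prems D(2) by auto
        ultimately obtain s' where "until B 2 ?s s'" using less.hyps by blast
        then show ?thesis using until_again[OF False] by blast
      qed
    qed
    then show ?thesis using that by blast
  qed
  have val: "s' 1 = F (s 0)" if "until B 2 s s'" "\<forall>i\<ge>D. s i = 0" for s s'
    using that
  proof (induction rule: until.induct)
    case (until_stop s)
    note R = rB[OF until_stop.prems]
    have a: "te (Suc (s 3)) p [s 0] = (run B s 1, 0)" using R(3,4) until_stop.hyps by (metis prod.collapse)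
    obtain t0 where t0: "\<forall>t\<ge>t0. te t p [s 0] = (F (s 0), 0)" using te_complete(1)[OF F] by blast
    have "te (max t0 (Suc (s 3))) p [s 0] = (run B s 1, 0)" using te_mono[OF a] by simp
    then show ?case using t0 by simp
  next
    case (until_again s s')
    note R = rB[OF until_again.prems]
    show ?case using until_again.IH R D(2) by simp
  qed
  show ?thesis
  proof (rule until_theorem[where B = B and D = D and e = 2 and r = 1])
    show "s' 1 = F j" if "until B 2 ((\<lambda>_. 0)(0 := j)) s'" for j s'
      using val[OF that] D(2) by simp
  qed (use wB D(2) tot in auto)
qed

section \<open>Recursiveness of the summatory function\<close>

lemma eval_list_1: "eval g xs y \<Longrightarrow> eval_list [g] xs [y]"
  by (intro evl_Cons evl_Nil)

lemma eval_list_2: "eval g xs y \<Longrightarrow> eval h xs z \<Longrightarrow> eval_list [g, h] xs [y, z]"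
  by (intro evl_Cons evl_Nil)

lemma eval_Id0: "eval (Id 0) (x # xs) x" and eval_Id1: "eval (Id 1) (x # y # xs) y"
  using eval_Id[of 0 "x # xs"] eval_Id[of 1 "x # y # xs"] by simp_all

text \<open>The step function of \<open>Pr\<close> receives the previous value as argument 0 and the
  index as argument 1, which explains the projections here and below.\<close>

definition rf_add :: recf where "rf_add = Pr (Id 0) (Cn S [Id 0])"
definition rf_pow2 :: recf where "rf_pow2 = Pr (Cn S [Z]) (Cn rf_add [Id 0, Id 0])"
definition rf_sum :: "recf \<Rightarrow> recf" where "rf_sum p = Pr Z (Cn rf_add [Id 0, Cn p [Id 1]])"

lemma eval_add: "eval rf_add [m, n] (m + n)"
proof (induction m)
  case 0 then show ?case unfolding rf_add_def using eval_Pr0[OF eval_Id0] by simp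
next
  case (Suc m)
  have "eval (Cn S [Id 0]) [m + n, m, n] (Suc (m + n))" by (rule eval_Cn[OF eval_list_1[OF eval_Id0] eval_S])
  then show ?case using Suc eval_PrS unfolding rf_add_def by fastforce
qed

lemma eval_pow2: "eval rf_pow2 [n] (2 ^ n)"
proof (induction n)
  case 0
  have "eval (Cn S [Z]) [] (Suc 0)" by (rule eval_Cn[OF eval_list_1[OF eval_Z] eval_S])
  then show ?case unfolding rf_pow2_def using eval_Pr0 by fastforce
next
  case (Suc n)
  have "eval (Cn rf_add [Id 0, Id 0]) [2 ^ n, n] (2 ^ n + 2 ^ n)" by (rule eval_Cn[OF eval_list_2[OF eval_Id0 eval_Id0] eval_add])
  then show ?case using Suc eval_PrS unfolding rf_pow2_def by (fastforce simp: mult_2)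
qed

lemma eval_sum:
  assumes "\<And>n. eval p [n] (f n)"
  shows "eval (rf_sum p) [n] (\<Sum>m<n. f m)"
proof (induction n)
  case 0 then show ?case unfolding rf_sum_def using eval_Pr0[OF eval_Z] by simp
next
  case (Suc n)
  have "eval (Cn rf_add [Id 0, Cn p [Id 1]]) [\<Sum>m<n. f m, n] ((\<Sum>m<n. f m) + f n)"
    by (rule eval_Cn[OF eval_list_2[OF eval_Id0 eval_Cn[OF eval_list_1[OF eval_Id1] assms]] eval_add])
  then show ?case using eval_PrS[OF Suc[unfolded rf_sum_def]] unfolding rf_sum_def by simp
qed

theorem theorem1p2:
  fixes f :: "nat \<Rightarrow> nat"
  assumes "recursive f"
  shows "\<exists>PG PH \<phi>. fin_pres PG \<and> fin_pres PH \<and> subgroup_emb PH PG \<phi>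
           \<and> f \<preceq> dehn PH \<and> dehn PG \<simeq> (\<lambda>n. n ^ 2)"
proof -
  obtain p where p: "\<And>n. eval p [n] (f n)" using assms by (auto simp: recursive_def)
  \<comment> \<open>f need not be monotone, and inputs are available only at the scale 2^j; as a
    sum, F j majorises f at all n below 2^(j+1).\<close>
  define F where "F j = (\<Sum>m<2 ^ Suc j. f m)" for j
  have "eval (Cn (rf_sum p) [Cn rf_pow2 [S]]) [j] (F j)" for j
    unfolding F_def by (rule eval_Cn[OF eval_list_1[OF eval_Cn[OF eval_list_1[OF eval_S] eval_pow2]] eval_sum[OF p]])
  from recursive_theorem[of _ F, OF this] obtain PG PH \<phi> c where
    P: "fin_pres PG" "fin_pres PH" "subgroup_emb PH PG \<phi>" "dehn PG \<simeq> (\<lambda>n. n ^ 2)"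
      "\<And>j n. 4 * 2 ^ j + c \<le> n \<Longrightarrow> F j \<le> dehn PH n" by blast
  \<comment> \<open>If 2^j is at most n, the length 4 * 2^j + c is at most 4 n + c n, because n is
    at least 1; hence the factor 4 + c.\<close>
  have "f n \<le> (4 + c) * dehn PH ((4 + c) * n) + (4 + c) * n" if n: "1 \<le> n" for n
  proof -
    obtain j where j: "2 ^ j \<le> n" "n < 2 ^ Suc j" using ex_power_ivl1[of 2 n] n by auto
    have "f n \<le> F j" unfolding F_def by (rule member_le_sum) (use j in auto)
    also have "4 * 2 ^ j + c \<le> 4 * n + c * n" using j(1) n by (intro add_mono) auto
    then have "F j \<le> dehn PH ((4 + c) * n)" by (intro P(5)) (simp add: distrib_right)
    also have "x \<le> (4 + c) * x + (4 + c) * n" for x by (simp add: distrib_right)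
    finally show ?thesis .
  qed
  then have "f \<preceq> dehn PH" unfolding preceq_def by (intro exI[of _ "4 + c"]) simp
  then show ?thesis using P(1-4) by blast
qed

end
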